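(* Let $1<p<\infty$ and let $f=g+\bar h\in\mathbf{h}^p$ be a harmonic mapping on the unit disk, where $g$ and $h$ are holomorphic on the unit disk, with $\Re(g(0)h(0))\le 0$. Then $$\|f\|_{\mathbf{h}^p}\le \sqrt{2}\,\max\left\{\sin\frac{\pi}{2p},\cos\frac{\pi}{2p}\right\}\left(\int_{\mathbf{T}}(|g|^2+|h|^2)^{p/2}\,d\sigma\right)^{1/p},$$ and this inequality is sharp, i.e. for each $p$ the constant $\sqrt{2}\max\{\sin\frac{\pi}{2p},\cos\frac{\pi}{2p}\}$ cannot be replaced by a smaller one.
   Context: $\mathbf{U}$ is the open unit disk in $\mathbf{C}$, $\mathbf{T}$ the unit circle, $\sigma$ the normalized (probability) arc-length measure on $\mathbf{T}$. For $p>1$, $\mathbf{h}^p$ is the class of complex-valued harmonic functions $f=g+\bar h$ on $\mathbf{U}$ ($g,h$ holomorphic on $\mathbf{U}$) with $\|f\|_{\mathbf{h}^p}=\sup_{0<r<1}\left(\int_{\mathbf{T}}|f(r\zeta)|^p\,d\sigma(\zeta)\right)^{1/p}<\infty$. On $\mathbf{T}$ the functions are understood as their radial boundary values, which exist almost everywhere, and $\|f\|_{\mathbf{h}^p}=\left(\int_{\mathbf{T}}|f|^p\,d\sigma\right)^{1/p}$. *)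

theory Defs
  imports "HOL-Complex_Analysis.Complex_Analysis"
begin

(* The measure lives on the unit circle itself, not on the whole plane: functions that are only
   specified on the unit disk (or on its boundary) may be arbitrary, even non-measurable, elsewhere. *)
definition circle_measure :: "complex measure" where
  "circle_measure =
     distr (uniform_measure lborel {0..2 * pi}) (restrict_space borel (sphere 0 1)) cis"

definition hp_mean :: "real \<Rightarrow> (complex \<Rightarrow> complex) \<Rightarrow> real \<Rightarrow> real" where
  "hp_mean p f r = (LINT z|circle_measure. cmod (f (of_real r * z)) powr p) powr (1 / p)"

definition hp_norm :: "real \<Rightarrow> (complex \<Rightarrow> complex) \<Rightarrow> real" where
  "hp_norm p f = (SUP r\<in>{0<..<1}. hp_mean p f r)"

(* Boundedness of the means is what makes the real-valued supremum in hp_norm meaningful. *)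
definition hp_class :: "real \<Rightarrow> (complex \<Rightarrow> complex) set" where
  "hp_class p =
     {f. (\<exists>g h. g holomorphic_on ball 0 1 \<and> h holomorphic_on ball 0 1 \<and>
                (\<forall>z\<in>ball 0 1. f z = g z + cnj (h z))) \<and>
         bdd_above (hp_mean p f ` {0<..<1})}"

(* Where the radial limit does not exist, Lim is an unspecified constant; for the functions
   considered here this happens only on a null set. *)
definition radial_limit :: "(complex \<Rightarrow> complex) \<Rightarrow> complex \<Rightarrow> complex" where
  "radial_limit f z = Lim (at_left (1::real)) (\<lambda>r. f (of_real r * z))"

definition pair_norm :: "real \<Rightarrow> (complex \<Rightarrow> complex) \<Rightarrow> (complex \<Rightarrow> complex) \<Rightarrow> real" where
  "pair_norm p g h =
     (LINT z|circle_measure.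
        ((cmod (radial_limit g z))\<^sup>2 + (cmod (radial_limit h z))\<^sup>2) powr (p / 2)) powr (1 / p)"

definition admissible ::
  "real \<Rightarrow> (complex \<Rightarrow> complex) \<Rightarrow> (complex \<Rightarrow> complex) \<Rightarrow> (complex \<Rightarrow> complex) \<Rightarrow> bool" where
  "admissible p f g h \<longleftrightarrow>
     f \<in> hp_class p \<and> g holomorphic_on ball 0 1 \<and> h holomorphic_on ball 0 1 \<and>
     (\<forall>z\<in>ball 0 1. f z = g z + cnj (h z)) \<and> Re (g 0 * h 0) \<le> 0"

end

theory Submission
  imports Defs
begin

text \<open>Let \<open>\<zeta> = g h\<close> and \<open>S = |g|\<^sup>2 + |h|\<^sup>2\<close>. Then \<open>|f|\<^sup>2 = S + 2 Re \<zeta>\<close> and \<open>2 |\<zeta>| \<le> S\<close>, so the size of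
  \<open>f\<close> relative to the pair is governed by the modulus and the argument of the single holomorphic
  function \<open>g h\<close>. The estimate comes from a pointwise inequality
  \<open>|f|\<^sup>p + d \<Psi>(g h) \<le> c\<^sup>p (|g|\<^sup>2 + |h|\<^sup>2)\<^bsup>p/2\<^esup>\<close>, where \<open>c\<close> is the constant of the theorem and \<open>\<Psi>\<close> is
  subharmonic, homogeneous of degree \<open>p/2\<close>, and nonnegative on the left half-plane. Integrated over a
  circle about the origin, the term with \<open>\<Psi>\<close> is at least \<open>d \<Psi>(g(0) h(0)) \<ge> 0\<close>, which is where the
  hypothesis on \<open>g(0) h(0)\<close> enters, and it can be dropped. The function \<open>\<Psi>\<close> is found in
  \<open>exists_control_function\<close>; subharmonicity is used in the form \<open>submean_of_supported\<close>.

  This bounds the means of \<open>f\<close> by those of the pair on the same circle. To reach the boundary one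
  needs radial limits of \<open>g\<close> and \<open>h\<close> almost everywhere and a bound of the interior means of
  the pair by its boundary integral. First, the means of the pair are bounded (the theorem of
  M. Riesz): this follows from a reverse pointwise inequality with \<open>\<Psi>(- g h)\<close>, namely
  \<open>pair_norm_le_harmonic_minus_control\<close>. Then uniform convexity shows that the dilations
  \<open>u(s z)\<close> of a harmonic function with bounded means converge to \<open>u\<close> in mean
  (\<open>dilations_converge_in_mean\<close>). Combined with the weak-type inequality for the radial maximal
  function (\<open>radial_maximal_weak_type\<close>) this gives radial limits almost everywhere, and combined with
  Fatou's lemma it gives the comparison of interior and boundary means
  (\<open>poisson_harmonic_mean_le_boundary\<close>).

  For the sharpness, the pointwise inequality is an equality when \<open>|g| = |h|\<close> and the argument of
  \<open>g h\<close> is a suitable angle up to sign. Powers \<open>G\<close> of the Cayley transform, with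
  \<open>g = G\<close> and \<open>h = \<plusminus> G\<close>, make the argument of \<open>g h\<close> on the circle almost that angle. Subtracting the
  constant \<open>1\<close> from \<open>G\<close> makes \<open>g(0) h(0)\<close> vanish, and this is harmless in the limit because the norm
  of \<open>G\<close> tends to infinity as its exponent increases to \<open>1/p\<close>.\<close>

section \<open>The circle measure and the Poisson formula\<close>

lemma circle_measure_eq_density:
  "circle_measure = distr (density lborel (\<lambda>t. ennreal (indicator {0..2*pi} t / (2*pi))))
      (restrict_space borel (sphere 0 1)) cis"
proof -
  have "(\<lambda>t. indicator {0..2*pi} t / emeasure lborel {0..2*pi}) = (\<lambda>t. ennreal (indicator {0..2*pi} t / (2*pi)))"
    by (rule ext) (auto simp: indicator_def divide_ennreal ennreal_1[symmetric] simp del: ennreal_1)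
  then show ?thesis
    by (simp add: circle_measure_def uniform_measure_def)
qed

lemma space_circle_measure [simp]: "space circle_measure = sphere 0 1"
  and sets_circle_measure [measurable_cong]: "sets circle_measure = sets (restrict_space borel (sphere 0 1))"
  by (simp_all add: circle_measure_def space_restrict_space)

lemma cis_measurable_circle [measurable]: "cis \<in> borel \<rightarrow>\<^sub>M restrict_space borel (sphere 0 1)"
  by (intro measurable_restrict_space2 borel_measurable_continuous_onI continuous_intros) auto

lemma emeasure_circle_space: "emeasure circle_measure (sphere 0 1) = 1"
proof -
  have "emeasure circle_measure (sphere 0 1) = emeasure (uniform_measure lborel {0..2 * pi}) (cis -` sphere 0 1 \<inter> UNIV)"
    unfolding circle_measure_def
    by (subst emeasure_distr) (auto simp: sets_restrict_space intro!: image_eqI[of _ _ UNIV])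
  also have "cis -` sphere 0 1 \<inter> UNIV = UNIV" by auto
  also have "emeasure (uniform_measure lborel {0..2 * pi}) UNIV = 1"
    by (simp add: ennreal_zero_less_top ennreal_divide_self ennreal_less_zero_iff)
  finally show ?thesis .
qed

interpretation circle: finite_measure circle_measure
  by standard (simp add: emeasure_circle_space)

lemma measure_circle_space [simp]: "measure circle_measure (sphere 0 1) = 1"
  by (simp add: measure_def emeasure_circle_space)

lemma borel_measurable_circleI: "f \<in> borel_measurable (borel :: complex measure) \<Longrightarrow> f \<in> borel_measurable circle_measure"
  by (simp add: measurable_cong_sets[OF sets_circle_measure refl] measurable_restrict_space1)

lemma borel_measurable_circle_continuous:
  "continuous_on (sphere 0 1) f \<Longrightarrow> f \<in> borel_measurable circle_measure"
  by (simp add: measurable_cong_sets[OF sets_circle_measure refl] borel_measurable_continuous_on_restrict)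

lemma integrable_circle_continuous:
  fixes f :: "complex \<Rightarrow> 'a::{banach, second_countable_topology}"
  assumes "continuous_on (sphere 0 1) f"
  shows "integrable circle_measure f"
proof -
  have "bounded (f ` sphere 0 1)"
    using assms by (intro compact_imp_bounded compact_continuous_image) auto
  then obtain B where "\<And>z. z \<in> sphere 0 1 \<Longrightarrow> norm (f z) \<le> B"
    unfolding bounded_iff by fastforce
  then show ?thesis
    by (intro circle.integrable_const_bound[where B=B] borel_measurable_circle_continuous assms) auto
qed

lemma circle_integral_eq:
  fixes f :: "complex \<Rightarrow> 'a::{banach, second_countable_topology}"
  assumes "f \<in> borel_measurable circle_measure"
  shows "(LINT z|circle_measure. f z) = (LINT t|lborel. (indicator {0..2*pi} t / (2*pi)) *\<^sub>R f (cis t))"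
proof -
  have [measurable]: "f \<in> borel_measurable (restrict_space borel (sphere 0 1))"
    using assms by (simp add: measurable_cong_sets[OF sets_circle_measure refl])
  show ?thesis
    unfolding circle_measure_eq_density
    by (subst integral_distr) (auto simp: integral_density)
qed

lemma circle_integral_continuous:
  fixes f :: "complex \<Rightarrow> 'a::euclidean_space"
  assumes "continuous_on (sphere 0 1) f"
  shows "(LINT z|circle_measure. f z) = (1/(2*pi)) *\<^sub>R integral {0..2*pi} (\<lambda>t. f (cis t))"
proof -
  have c: "continuous_on {0..2*pi} (\<lambda>t. f (cis t))"
    by (intro continuous_on_compose2[OF assms] continuous_intros) auto
  have "(LINT z|circle_measure. f z) = (LINT t|lborel. (1/(2*pi)) *\<^sub>R (indicator {0..2*pi} t *\<^sub>R f (cis t)))"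
    unfolding circle_integral_eq[OF borel_measurable_circle_continuous[OF assms]]
    by (rule Bochner_Integration.integral_cong[OF refl]) (auto simp: indicator_def)
  also have "\<dots> = (1/(2*pi)) *\<^sub>R (LINT t:{0..2*pi}|lborel. f (cis t))"
    by (simp add: set_lebesgue_integral_def del: scaleR_scaleR)
  also have "(LINT t:{0..2*pi}|lborel. f (cis t)) = integral {0..2*pi} (\<lambda>t. f (cis t))"
    by (intro set_borel_integral_eq_integral borel_integrable_compact c[THEN continuous_on_subset]
        borel_integrable_atLeastAtMost') (auto simp: c)
  finally show ?thesis .
qed

definition poisson_kernel :: "complex \<Rightarrow> complex \<Rightarrow> real" where
  "poisson_kernel w \<zeta> = (1 - (cmod w)\<^sup>2) / (cmod (\<zeta> - w))\<^sup>2"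

text \<open>Cauchy's formula at \<open>w\<close>, to which Cauchy's theorem adds \<open>0\<close> as the integral of
  \<open>cnj w * F u / (1 - cnj w * u)\<close>, whose pole is outside the closed disk. On the unit circle the sum of
  the two kernels is the Poisson kernel.\<close>

lemma poisson_formula_holomorphic:
  assumes F: "F holomorphic_on ball 0 1" and "continuous_on (cball 0 1) F" and w: "cmod w < 1"
  shows "F w = (LINT \<zeta>|circle_measure. poisson_kernel w \<zeta> *\<^sub>R F \<zeta>)"
proof -
  have ne1: "cis t - w \<noteq> 0" for t using w by (metis norm_cis less_irrefl right_minus_eq)
  have ne2: "1 - cnj w * u \<noteq> 0" if "cmod u \<le> 1" for u
  proof
    assume "1 - cnj w * u = 0"
    then have "cmod (cnj w * u) = 1" by (metis norm_one right_minus_eq)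
    moreover have "cmod w * cmod u < 1"
      using w that mult_left_le[of "cmod u" "cmod w"] by (auto)
    ultimately show False by (simp add: norm_mult)
  qed
  have "((\<lambda>u. F u/(u-w)) has_contour_integral (2 * of_real pi * \<i> * F w)) (circlepath 0 1)"
    using assms by (intro Cauchy_integral_circlepath) auto
  then have 1: "((\<lambda>t. F (cis t)/(cis t-w) * \<i> * cis t) has_integral (2 * of_real pi * \<i> * F w)) {0..2*pi}"
    unfolding circlepath_def by (subst (asm) has_contour_integral_part_circlepath_iff) auto
  have "((\<lambda>u. cnj w * F u/(1 - cnj w * u)) has_contour_integral 0) (circlepath 0 1)"
  proof (rule Cauchy_theorem_disc[of "{}"])
    show "continuous_on (cball 0 1) (\<lambda>u. cnj w * F u / (1 - cnj w * u))"
      using assms ne2 by (intro continuous_intros) auto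
    show "(\<lambda>u. cnj w * F u / (1 - cnj w * u)) field_differentiable at x" if "x \<in> ball 0 1 - {}" for x
      using that ne2[of x] holomorphic_on_imp_differentiable_at[OF F, of x]
      by (intro derivative_intros) auto
  qed auto
  then have 2: "((\<lambda>t. cnj w * F (cis t)/(1 - cnj w * cis t) * \<i> * cis t) has_integral 0) {0..2*pi}"
    unfolding circlepath_def by (subst (asm) has_contour_integral_part_circlepath_iff) auto
  have eq: "F (cis t)/(cis t-w) * \<i> * cis t + cnj w * F (cis t)/(1 - cnj w * cis t) * \<i> * cis t
      = \<i> * (poisson_kernel w (cis t) *\<^sub>R F (cis t))" for t
  proof -
    define z where "z = cis t"
    have zz: "z * cnj z = 1" unfolding z_def using complex_norm_square[of "cis t"] by simp
    have a: "z - w \<noteq> 0" "1 - cnj w * z \<noteq> 0" using ne1 ne2[of z] by (auto simp: z_def)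
    have b: "1 - cnj w * z = z * cnj (z - w)" using zz by (simp add: algebra_simps)
    have c: "of_real ((cmod (z - w))\<^sup>2) = (z - w) * cnj (z - w)"
      by (rule complex_norm_square)
    have d: "of_real ((cmod w)\<^sup>2) = w * cnj w" by (rule complex_norm_square)
    have zn: "z \<noteq> 0" "cnj z - cnj w \<noteq> 0" using a zz by auto
    have "z/(z-w) + cnj w * z / (1 - cnj w * z) = of_real (poisson_kernel w z)"
      unfolding poisson_kernel_def of_real_divide c of_real_diff d b using a zn zz
      by (simp add: divide_simps) (simp add: algebra_simps)
    then have e: "of_real (poisson_kernel w z) * F z = (z/(z-w) + cnj w * z / (1 - cnj w * z)) * F z"
      by simp
    show ?thesis unfolding z_def[symmetric] scaleR_conv_of_real e
      by (simp add: algebra_simps add_divide_distrib)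
  qed
  have "((\<lambda>t. \<i> * (poisson_kernel w (cis t) *\<^sub>R F (cis t))) has_integral (2 * of_real pi * \<i> * F w + 0)) {0..2*pi}"
    using has_integral_add[OF 1 2] by (simp only: eq)
  from has_integral_mult_right[OF this, of "-\<i>"]
  have "((\<lambda>t. poisson_kernel w (cis t) *\<^sub>R F (cis t)) has_integral - \<i> * (2 * of_real pi * \<i> * F w + 0)) {0..2*pi}"
    by (simp add: mult.assoc[symmetric])
  then have 3: "integral {0..2*pi} (\<lambda>t. poisson_kernel w (cis t) *\<^sub>R F (cis t)) = 2 * of_real pi * F w"
    by (simp add: integral_unique)
  have "continuous_on (sphere 0 1) (\<lambda>\<zeta>. poisson_kernel w \<zeta> *\<^sub>R F \<zeta>)"
    unfolding poisson_kernel_def using w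
    by (intro continuous_intros continuous_on_subset[OF assms(2)]) auto
  from circle_integral_continuous[OF this] 3 show ?thesis
    by (simp add: scaleR_conv_of_real)
qed

lemma poisson_kernel_nonneg: "cmod w < 1 \<Longrightarrow> 0 \<le> poisson_kernel w \<zeta>"
  by (simp add: poisson_kernel_def abs_square_le_1)

lemma continuous_on_poisson_kernel: "cmod w < 1 \<Longrightarrow> continuous_on (sphere 0 1) (poisson_kernel w)"
  unfolding poisson_kernel_def by (intro continuous_intros) auto

lemma integral_poisson_kernel:
  assumes "cmod w < 1" shows "(LINT \<zeta>|circle_measure. poisson_kernel w \<zeta>) = 1"
proof -
  have "(1::complex) = (LINT \<zeta>|circle_measure. of_real (poisson_kernel w \<zeta>))"
    using poisson_formula_holomorphic[of "\<lambda>_. 1" w] assms by (simp add: scaleR_conv_of_real)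
  then show ?thesis
    by (metis integral_complex_of_real of_real_eq_1_iff)
qed

text \<open>This symmetry lets Fubini's theorem integrate the kernel over the point that it represents.\<close>

lemma poisson_kernel_commute:
  assumes "cmod \<zeta> = 1" "cmod \<eta> = 1"
  shows "poisson_kernel (of_real r * \<zeta>) \<eta> = poisson_kernel (of_real r * \<eta>) \<zeta>"
proof -
  have "(cmod (\<eta> - r * \<zeta>))\<^sup>2 = (cmod (\<zeta> - r * \<eta>))\<^sup>2"
    using assms unfolding cmod_power2 norm_eq_1 cmod_def real_sqrt_eq_1_iff
    by (simp add: power2_eq_square) algebra
  then show ?thesis using assms by (simp add: poisson_kernel_def norm_mult)
qed

text \<open>For \<open>\<delta> < 1\<close> the Poisson kernel of the point \<open>(1 - \<delta>) \<zeta>\<close> is at least \<open>1 / (4 \<delta>)\<close> on the arc and has integral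
  \<open>1\<close>, so the length of the arc is bounded without parametrizing it.\<close>

lemma measure_circle_cball_le:
  assumes "cmod \<zeta> = 1" "0 < \<delta>"
  shows "measure circle_measure (cball \<zeta> \<delta> \<inter> sphere 0 1) \<le> 4 * \<delta>"
proof (cases "\<delta> < 1")
  case False
  have "measure circle_measure (cball \<zeta> \<delta> \<inter> sphere 0 1) \<le> 1"
    using circle.bounded_measure[of "cball \<zeta> \<delta> \<inter> sphere 0 1"] by simp
  then show ?thesis using False by simp
next
  case True
  \<comment> \<open>For smaller \<open>\<delta>\<close> this point lies in the disk at distance \<open>\<delta>\<close> from \<open>\<zeta>\<close>.\<close>
  define w where "w = of_real (1 - \<delta>) * \<zeta>"
  have w: "cmod w = 1 - \<delta>" using assms True by (simp add: w_def norm_mult del: of_real_diff)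
  have "measure circle_measure (cball \<zeta> \<delta> \<inter> sphere 0 1) = (LINT \<eta>|circle_measure. indicator (cball \<zeta> \<delta> \<inter> sphere 0 1) \<eta>)"
    by simp
  also have "\<dots> \<le> (LINT \<eta>|circle_measure. 4 * \<delta> * poisson_kernel w \<eta>)"
  proof (rule integral_mono)
    show "integrable circle_measure (indicator (cball \<zeta> \<delta> \<inter> sphere 0 1) :: complex \<Rightarrow> real)"
      by (intro integrable_real_indicator)
        (auto simp: less_top[symmetric] sets_circle_measure sets_restrict_space Int_commute)
    show "integrable circle_measure (\<lambda>\<eta>. 4 * \<delta> * poisson_kernel w \<eta>)"
      using w assms by (intro integrable_circle_continuous continuous_intros continuous_on_poisson_kernel) auto
    fix \<eta> assume "\<eta> \<in> space circle_measure"
    show "indicator (cball \<zeta> \<delta> \<inter> sphere 0 1) \<eta> \<le> 4 * \<delta> * poisson_kernel w \<eta>"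
    proof (cases "\<eta> \<in> cball \<zeta> \<delta> \<inter> sphere 0 1")
      case True
      then have n: "cmod (\<eta> - \<zeta>) \<le> \<delta>" "cmod \<eta> = 1" by (auto simp: dist_norm norm_minus_commute)
      have "cmod (\<eta> - w) \<le> cmod (\<eta> - \<zeta>) + cmod (\<zeta> - w)"
        by (rule norm_triangle_le_diff[of "\<eta> - \<zeta>" "w - \<zeta>" , simplified])
          (simp add: norm_minus_commute)
      also have "\<zeta> - w = of_real \<delta> * \<zeta>" by (simp add: w_def algebra_simps)
      finally have le: "cmod (\<eta> - w) \<le> 2 * \<delta>" using n assms by (simp add: norm_mult)
      have "cmod (\<eta> - w) > 0" using n w assms by auto
      have "(cmod (\<eta> - w))\<^sup>2 \<le> (2*\<delta>)\<^sup>2" using le by (intro power_mono) auto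
      also have "\<dots> = 4 * \<delta> * \<delta>" by (simp add: power2_eq_square)
      also have "\<dots> \<le> 4 * \<delta> * (1 - (cmod w)\<^sup>2)"
        using assms True \<open>\<delta> < 1\<close> by (intro mult_left_mono) (auto simp: w power2_eq_square algebra_simps)
      finally show ?thesis
        using \<open>cmod (\<eta> - w) > 0\<close> True by (simp add: poisson_kernel_def field_simps)
    next
      case False
      then show ?thesis using poisson_kernel_nonneg[of w \<eta>] assms w by simp
    qed
  qed
  also have "\<dots> = 4 * \<delta>" using w assms by (simp add: integral_poisson_kernel)
  finally show ?thesis .
qed

section \<open>Functions with a Poisson representation\<close>

text \<open>The Poisson formula on all smaller circles, in place of harmonicity. In this form it applies
  to values in any Euclidean space, in particular to the pair \<open>(g, h)\<close>.\<close>

definition poisson_harmonic :: "(complex \<Rightarrow> 'a::euclidean_space) \<Rightarrow> bool" where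
  "poisson_harmonic u \<longleftrightarrow> continuous_on (ball 0 1) u \<and>
     (\<forall>s\<in>{0..<1}. \<forall>z\<in>ball 0 1. u (of_real s * z) = (LINT \<eta>|circle_measure. poisson_kernel z \<eta> *\<^sub>R u (of_real s * \<eta>)))"

definition poisson_subharmonic :: "(complex \<Rightarrow> real) \<Rightarrow> bool" where
  "poisson_subharmonic v \<longleftrightarrow> continuous_on (ball 0 1) v \<and>
     (\<forall>s\<in>{0..<1}. \<forall>z\<in>ball 0 1. v (of_real s * z) \<le> (LINT \<eta>|circle_measure. poisson_kernel z \<eta> * v (of_real s * \<eta>)))"

lemma continuous_on_circle_dilation:
  fixes u :: "complex \<Rightarrow> 'a::topological_space"
  assumes "continuous_on (ball 0 1) u" "0 \<le> s" "s < 1"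
  shows "continuous_on (sphere 0 1) (\<lambda>\<eta>. u (of_real s * \<eta>))"
  using assms by (intro continuous_on_compose2[OF assms(1)] continuous_intros) (auto simp: norm_mult)

lemma integrable_poisson:
  fixes u :: "complex \<Rightarrow> 'a::euclidean_space"
  assumes "continuous_on (ball 0 1) u" "0 \<le> s" "s < 1" "cmod z < 1"
  shows "integrable circle_measure (\<lambda>\<eta>. poisson_kernel z \<eta> *\<^sub>R u (of_real s * \<eta>))"
  by (intro integrable_circle_continuous continuous_intros continuous_on_circle_dilation
      continuous_on_poisson_kernel assms)

lemma integrable_circle_dilation:
  fixes u :: "complex \<Rightarrow> 'a::euclidean_space"
  assumes "continuous_on (ball 0 1) u" "0 \<le> s" "s < 1"
  shows "integrable circle_measure (\<lambda>\<eta>. u (of_real s * \<eta>))"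
  by (intro integrable_circle_continuous continuous_on_circle_dilation assms)

lemma poisson_harmonic_bounded_linear:
  fixes L :: "'a::euclidean_space \<Rightarrow> 'b::euclidean_space"
  assumes u: "poisson_harmonic u" and L: "bounded_linear L"
  shows "poisson_harmonic (\<lambda>z. L (u z))"
proof -
  interpret bounded_linear L by fact
  have c: "continuous_on (ball 0 1) u" using u by (simp add: poisson_harmonic_def)
  have "L (u (of_real s * z)) = (LINT \<eta>|circle_measure. poisson_kernel z \<eta> *\<^sub>R L (u (of_real s * \<eta>)))"
    if "s \<in> {0..<1}" "z \<in> ball 0 1" for s z
    using u that integral_bounded_linear[OF L integrable_poisson[OF c, of s z]]
    by (simp add: poisson_harmonic_def scaleR)
  then show ?thesis
    using bounded_linear.continuous_on[OF L c]
    by (simp add: poisson_harmonic_def)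
qed

lemma poisson_harmonic_add:
  assumes "poisson_harmonic u" "poisson_harmonic w"
  shows "poisson_harmonic (\<lambda>z. u z + w z)"
  using assms integrable_poisson[of u] integrable_poisson[of w]
  by (auto simp: poisson_harmonic_def scaleR_add_right intro!: continuous_intros)

lemma poisson_harmonic_diff:
  assumes "poisson_harmonic u" "poisson_harmonic w"
  shows "poisson_harmonic (\<lambda>z. u z - w z)"
  using assms integrable_poisson[of u] integrable_poisson[of w]
  by (auto simp: poisson_harmonic_def scaleR_diff_right intro!: continuous_intros)

lemma poisson_harmonic_dilation:
  fixes u :: "complex \<Rightarrow> 'a::euclidean_space"
  assumes u: "poisson_harmonic u" and s: "0 \<le> s" "s < 1"
  shows "poisson_harmonic (\<lambda>z. u (of_real s * z))"
  unfolding poisson_harmonic_def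
proof (intro conjI ballI)
  have sz: "s * a < 1" if "0 \<le> a" "a < 1" for a
    using mult_strict_mono[of s 1 a 1] s that by (cases "a = 0") auto
  show "continuous_on (ball 0 1) (\<lambda>z. u (of_real s * z))"
  proof (rule continuous_on_compose2[of "ball 0 1" u])
    show "continuous_on (ball 0 1) u" using u by (simp add: poisson_harmonic_def)
  qed (use s sz in \<open>auto simp: norm_mult intro!: continuous_intros\<close>)
  fix t :: real and z :: complex assume "t \<in> {0..<1}" "z \<in> ball 0 1"
  moreover have "s * t \<in> {0..<1}" using sz[of t] \<open>t \<in> {0..<1}\<close> s by auto
  ultimately have "u (of_real (s * t) * z) = (LINT \<eta>|circle_measure. poisson_kernel z \<eta> *\<^sub>R u (of_real (s * t) * \<eta>))"
    using u unfolding poisson_harmonic_def by blast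
  then show "u (of_real s * (of_real t * z)) =
      (LINT \<eta>|circle_measure. poisson_kernel z \<eta> *\<^sub>R u (of_real s * (of_real t * \<eta>)))"
    by (simp add: mult.assoc)
qed

lemma poisson_harmonic_holomorphic:
  assumes "F holomorphic_on ball 0 1"
  shows "poisson_harmonic F"
  unfolding poisson_harmonic_def
proof (intro conjI ballI)
  show "continuous_on (ball 0 1) F" using assms by (rule holomorphic_on_imp_continuous_on)
  fix s :: real and z :: complex assume sz: "s \<in> {0..<1}" "z \<in> ball 0 1"
  have lt: "s * a < 1" if "0 \<le> a" "a \<le> 1" for a
    using sz that mult_left_le[of a s] by auto
  have "(\<lambda>z. F (of_real s * z)) holomorphic_on cball 0 1"
    using holomorphic_on_compose_gen[of "\<lambda>z. of_real s * z" "cball 0 1" F "ball 0 1"] assms lt sz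
    by (auto simp: o_def norm_mult image_subset_iff intro!: holomorphic_intros)
  then have "(\<lambda>z. F (of_real s * z)) holomorphic_on ball 0 1" "continuous_on (cball 0 1) (\<lambda>z. F (of_real s * z))"
    by (auto dest: holomorphic_on_imp_continuous_on elim: holomorphic_on_subset)
  then show "F (of_real s * z) = (LINT \<eta>|circle_measure. poisson_kernel z \<eta> *\<^sub>R F (of_real s * \<eta>))"
    using sz by (intro poisson_formula_holomorphic) auto
qed

lemma poisson_harmonic_Pair:
  fixes g h :: "complex \<Rightarrow> complex"
  assumes "poisson_harmonic g" "poisson_harmonic h"
  shows "poisson_harmonic (\<lambda>z. (g z, h z))"
proof -
  have "bounded_linear (\<lambda>z::complex. (z, 0::complex))" "bounded_linear (\<lambda>z::complex. (0::complex, z))"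
    by (intro bounded_linear_Pair bounded_linear_ident bounded_linear_zero)+
  from poisson_harmonic_add[OF poisson_harmonic_bounded_linear[OF assms(1) this(1)]
      poisson_harmonic_bounded_linear[OF assms(2) this(2)]]
  show ?thesis by simp
qed

lemma powr_tangent:
  fixes x y p :: real
  assumes "0 \<le> x" "0 < y" "1 \<le> p"
  shows "y powr p + p * y powr (p - 1) * (x - y) \<le> x powr p"
proof (cases "x = 0")
  case True
  define a where "a = y powr (p - 1)"
  have a: "y powr p = a * y" using assms by (simp add: a_def powr_diff)
  have "y powr p + p * y powr (p - 1) * (x - y) = (1 - p) * y powr p"
    unfolding a a_def[symmetric] using True by (simp add: algebra_simps)
  also have "\<dots> \<le> 0" using assms by (simp add: mult_nonpos_nonneg)
  finally show ?thesis using True by simp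
next
  case False
  then have x: "x > 0" using assms by simp
  have d: "((\<lambda>x. x powr p) has_real_derivative p * y powr (p - 1)) (at y within {0<..})"
    by (rule has_field_derivative_at_within[OF has_real_derivative_powr[OF assms(2)]])
  have "x powr p - y powr p \<ge> p * y powr (p - 1) * (x - y)"
    by (rule convex_on_imp_above_tangent[OF powr_convex[OF assms(3)] _ _ _ d]) (use assms x in \<open>auto simp: interior_open\<close>)
  then show ?thesis by simp
qed

text \<open>Jensen's inequality for the probability density given by the Poisson kernel, proved by
  integrating the tangent of the power function at the Poisson average \<open>y\<close> of the norm.\<close>

lemma poisson_subharmonic_norm_powr:
  fixes u :: "complex \<Rightarrow> 'a::euclidean_space"
  assumes u: "poisson_harmonic u" and p: "1 \<le> p"
  shows "poisson_subharmonic (\<lambda>z. norm (u z) powr p)"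
  unfolding poisson_subharmonic_def
proof (intro conjI ballI)
  have c: "continuous_on (ball 0 1) u" using u by (simp add: poisson_harmonic_def)
  show cp: "continuous_on (ball 0 1) (\<lambda>z. norm (u z) powr p)"
    using p by (intro continuous_on_powr' continuous_intros c) auto
  fix s :: real and z :: complex assume s: "s \<in> {0..<1}" and z: "z \<in> ball 0 1"
  define y where "y = (LINT \<eta>|circle_measure. poisson_kernel z \<eta> * norm (u (of_real s * \<eta>)))"
  have [simp]: "integrable circle_measure (\<lambda>\<eta>. poisson_kernel z \<eta> * norm (u (of_real s * \<eta>)))"
    using integrable_poisson[of "\<lambda>z. norm (u z)" s z] c s z by (simp add: continuous_on_norm)
  have ip [simp]: "integrable circle_measure (\<lambda>\<eta>. poisson_kernel z \<eta> * norm (u (of_real s * \<eta>)) powr p)"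
    using integrable_poisson[OF cp, of s z] s z by simp
  have [simp]: "integrable circle_measure (poisson_kernel z)"
    using z by (intro integrable_circle_continuous continuous_on_poisson_kernel) auto
  have "norm (u (of_real s * z)) = norm (LINT \<eta>|circle_measure. poisson_kernel z \<eta> *\<^sub>R u (of_real s * \<eta>))"
    using u s z by (simp add: poisson_harmonic_def)
  also have "\<dots> \<le> (LINT \<eta>|circle_measure. norm (poisson_kernel z \<eta> *\<^sub>R u (of_real s * \<eta>)))"
    by (rule integral_norm_bound)
  also have "\<dots> = y" unfolding y_def using z
    by (intro Bochner_Integration.integral_cong) (auto simp: poisson_kernel_nonneg)
  finally have le: "norm (u (of_real s * z)) \<le> y" .
  have "norm (u (of_real s * z)) powr p \<le> y powr p" using le p by (intro powr_mono2) auto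
  also have "\<dots> \<le> (LINT \<eta>|circle_measure. poisson_kernel z \<eta> * norm (u (of_real s * \<eta>)) powr p)"
  proof (cases "y > 0")
    case True
    have "y powr p = y powr p * 1 + p * y powr (p-1) * (y - y * 1)" by simp
    also have "\<dots> = (LINT \<eta>|circle_measure. y powr p * poisson_kernel z \<eta> +
        p * y powr (p-1) * (poisson_kernel z \<eta> * norm (u (of_real s * \<eta>)) - y * poisson_kernel z \<eta>))"
      using integral_poisson_kernel[of z] z by (simp add: y_def)
    also have "\<dots> \<le> (LINT \<eta>|circle_measure. poisson_kernel z \<eta> * norm (u (of_real s * \<eta>)) powr p)"
    proof (rule integral_mono)
      fix \<eta>
      have "poisson_kernel z \<eta> * (y powr p + p * y powr (p - 1) * (norm (u (of_real s * \<eta>)) - y))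
          \<le> poisson_kernel z \<eta> * norm (u (of_real s * \<eta>)) powr p"
        using z True p by (intro mult_left_mono powr_tangent poisson_kernel_nonneg) auto
      then show "y powr p * poisson_kernel z \<eta> +
        p * y powr (p-1) * (poisson_kernel z \<eta> * norm (u (of_real s * \<eta>)) - y * poisson_kernel z \<eta>)
        \<le> poisson_kernel z \<eta> * norm (u (of_real s * \<eta>)) powr p"
        by (simp add: algebra_simps)
    qed auto
    finally show ?thesis .
  next
    case False
    have "0 \<le> y" unfolding y_def using z by (intro integral_nonneg_AE AE_I2) (auto simp: poisson_kernel_nonneg)
    with False have "y = 0" by simp
    moreover have "0 \<le> (LINT \<eta>|circle_measure. poisson_kernel z \<eta> * norm (u (of_real s * \<eta>)) powr p)"
      using z by (intro integral_nonneg_AE AE_I2) (auto simp: poisson_kernel_nonneg)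
    ultimately show ?thesis by simp
  qed
  finally show "norm (u (of_real s * z)) powr p \<le> \<dots>" .
qed

text \<open>Integrate the defining inequality over the smaller circle. By Fubini's theorem and the symmetry of
  the kernel, each value on the larger circle is counted with total weight \<open>1\<close>.\<close>

lemma poisson_subharmonic_mean_mono:
  assumes v: "poisson_subharmonic v" and rs: "0 \<le> r" "r \<le> s" "s < 1"
  shows "(LINT \<zeta>|circle_measure. v (of_real r * \<zeta>)) \<le> (LINT \<zeta>|circle_measure. v (of_real s * \<zeta>))"
proof (cases "r = s")
  case False
  define \<rho> where "\<rho> = r / s"
  have s0: "s > 0" using False rs by simp
  have \<rho>: "0 \<le> \<rho>" "\<rho> < 1" "r = s * \<rho>" using rs False s0 by (auto simp: \<rho>_def)
  have c: "continuous_on (ball 0 1) v" using v by (simp add: poisson_subharmonic_def)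
  have [measurable]: "(\<lambda>\<eta>. v (of_real s * \<eta>)) \<in> borel_measurable circle_measure"
    using rs by (intro borel_measurable_circle_continuous continuous_on_circle_dilation c) auto
  have [measurable]: "(\<lambda>\<eta>. \<eta>) \<in> borel_measurable circle_measure"
    by (intro borel_measurable_circle_continuous continuous_intros)
  interpret P: pair_sigma_finite circle_measure circle_measure ..
  interpret PP: finite_measure "circle_measure \<Otimes>\<^sub>M circle_measure"
    by (rule finite_measure_pair_measure) unfold_locales
  have "bounded ((\<lambda>\<eta>. v (of_real s * \<eta>)) ` sphere 0 1)"
    using rs by (intro compact_imp_bounded compact_continuous_image continuous_on_circle_dilation c) auto
  then obtain B where B: "\<And>\<eta>. cmod \<eta> = 1 \<Longrightarrow> \<bar>v (of_real s * \<eta>)\<bar> \<le> B"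
    unfolding bounded_iff by fastforce
  have B0: "B \<ge> 0" using B[of 1] by simp
  have Pb: "\<bar>poisson_kernel (of_real \<rho> * \<zeta>) \<eta>\<bar> \<le> 1 / (1 - \<rho>)\<^sup>2" if "cmod \<zeta> = 1" "cmod \<eta> = 1" for \<zeta> \<eta>
  proof -
    have "1 - \<rho> \<le> cmod (\<eta> - of_real \<rho> * \<zeta>)"
      using norm_triangle_ineq2[of \<eta> "of_real \<rho> * \<zeta>"] that \<rho> by (simp add: norm_mult)
    then have "(1 - \<rho>)\<^sup>2 \<le> (cmod (\<eta> - of_real \<rho> * \<zeta>))\<^sup>2" using \<rho> by (intro power_mono) auto
    moreover have "\<bar>1 - (cmod (of_real \<rho> * \<zeta>))\<^sup>2\<bar> \<le> 1" using \<rho> that by (simp add: norm_mult abs_square_le_1)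
    ultimately show ?thesis unfolding poisson_kernel_def abs_divide using \<rho>
      by (intro frac_le) auto
  qed
  have "(\<lambda>(\<eta>, \<zeta>). poisson_kernel (of_real \<rho> * \<zeta>) \<eta> * v (of_real s * \<eta>)) \<in> borel_measurable (circle_measure \<Otimes>\<^sub>M circle_measure)"
    unfolding poisson_kernel_def by measurable
  then have int: "integrable (circle_measure \<Otimes>\<^sub>M circle_measure) (\<lambda>(\<eta>, \<zeta>). poisson_kernel (of_real \<rho> * \<zeta>) \<eta> * v (of_real s * \<eta>))"
    apply (intro PP.integrable_const_bound[where B="1/(1-\<rho>)\<^sup>2 * B"] AE_I2)
     apply (simp only: split_beta real_norm_def abs_mult)
     apply (rule mult_mono)
        apply (rule Pb; force simp: space_pair_measure)
       apply (rule B; force simp: space_pair_measure)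
      apply simp
     apply simp
    apply simp
    done
  have "(LINT \<zeta>|circle_measure. v (of_real r * \<zeta>)) \<le>
      (LINT \<zeta>|circle_measure. (LINT \<eta>|circle_measure. poisson_kernel (of_real \<rho> * \<zeta>) \<eta> * v (of_real s * \<eta>)))"
  proof (rule integral_mono)
    show "integrable circle_measure (\<lambda>\<zeta>. v (of_real r * \<zeta>))"
      using rs by (intro integrable_circle_dilation c) auto
    show "integrable circle_measure (\<lambda>\<zeta>. (LINT \<eta>|circle_measure. poisson_kernel (of_real \<rho> * \<zeta>) \<eta> * v (of_real s * \<eta>)))"
      using P.integrable_snd[OF int] by simp
    fix \<zeta> assume "\<zeta> \<in> space circle_measure"
    then show "v (of_real r * \<zeta>) \<le> (LINT \<eta>|circle_measure. poisson_kernel (of_real \<rho> * \<zeta>) \<eta> * v (of_real s * \<eta>))"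
      using v rs \<rho> unfolding poisson_subharmonic_def by (auto simp: norm_mult mult.assoc)
  qed
  also have "\<dots> = (LINT \<eta>|circle_measure. (LINT \<zeta>|circle_measure. poisson_kernel (of_real \<rho> * \<zeta>) \<eta> * v (of_real s * \<eta>)))"
    by (rule P.Fubini_integral[OF int])
  also have "\<dots> = (LINT \<eta>|circle_measure. v (of_real s * \<eta>))"
  proof (intro Bochner_Integration.integral_cong refl)
    fix \<eta> assume \<eta>: "\<eta> \<in> space circle_measure"
    have "(LINT \<zeta>|circle_measure. poisson_kernel (of_real \<rho> * \<zeta>) \<eta> * v (of_real s * \<eta>))
      = (LINT \<zeta>|circle_measure. poisson_kernel (of_real \<rho> * \<eta>) \<zeta> * v (of_real s * \<eta>))"
      using \<eta> by (intro Bochner_Integration.integral_cong refl) (simp add: poisson_kernel_commute)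
    also have "\<dots> = v (of_real s * \<eta>)"
      using \<eta> \<rho> by (simp add: integral_poisson_kernel norm_mult)
    finally show "(LINT \<zeta>|circle_measure. poisson_kernel (of_real \<rho> * \<zeta>) \<eta> * v (of_real s * \<eta>)) = v (of_real s * \<eta>)" .
  qed
  finally show ?thesis .
qed simp

section \<open>The radial maximal function\<close>

lemma sets_circle_Int: "A \<in> sets borel \<Longrightarrow> A \<inter> sphere 0 1 \<in> sets circle_measure"
  unfolding sets_circle_measure sets_restrict_space by (auto simp: Int_commute)

text \<open>The kernel of the point \<open>r \<zeta>\<close> decays like \<open>(1 - r) / |\<eta> - \<zeta>|\<^sup>2\<close> away from \<open>\<zeta>\<close>. On the arc of radius
  \<open>2\<^sup>k (1 - r)\<close> outside the preceding one it is therefore of order \<open>1 / (4\<^sup>k (1 - r))\<close>.\<close>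

lemma poisson_kernel_le_arcs:
  assumes r: "0 \<le> r" "r < 1" and \<zeta>: "cmod \<zeta> = 1" and \<eta>: "cmod \<eta> = 1" and K: "2 \<le> 2 ^ K * (1 - r)"
  shows "poisson_kernel (of_real r * \<zeta>) \<eta>
    \<le> (\<Sum>k\<le>K. 32 / (4 ^ k * (1 - r)) * indicator (cball \<zeta> (2 ^ k * (1 - r))) \<eta>)"
proof -
  define e where "e = 1 - r"
  have e: "e > 0" using r by (simp add: e_def)
  define d where "d = cmod (\<eta> - \<zeta>)"
  define m where "m = cmod (\<eta> - of_real r * \<zeta>)"
  have m1: "e \<le> m"
    using norm_triangle_ineq2[of \<eta> "of_real r * \<zeta>"] \<zeta> \<eta> r by (simp add: norm_mult e_def m_def)
  have "d \<le> m + cmod (of_real r * \<zeta> - \<zeta>)"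
    unfolding d_def m_def using norm_triangle_ineq[of "\<eta> - of_real r * \<zeta>" "of_real r * \<zeta> - \<zeta>"] by simp
  also have "of_real r * \<zeta> - \<zeta> = - (of_real e * \<zeta>)" by (simp add: e_def algebra_simps)
  also have "cmod \<dots> = e" using \<zeta> e by (simp add: norm_mult)
  finally have m2: "d \<le> 2 * m" using m1 by simp
  have "d \<le> 2" unfolding d_def using norm_triangle_ineq4[of \<eta> \<zeta>] \<zeta> \<eta> by simp
  then have "d \<le> 2 ^ K * e" using K by (simp add: e_def)
  \<comment> \<open>The first dyadic arc that contains \<open>\<eta>\<close>; minimality bounds \<open>d\<close>, hence \<open>m\<close>, from below.\<close>
  define k where "k = (LEAST k. d \<le> 2 ^ k * e)"
  have k: "d \<le> 2 ^ k * e" unfolding k_def using \<open>d \<le> 2 ^ K * e\<close> by (rule LeastI)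
  have kK: "k \<le> K" unfolding k_def using \<open>d \<le> 2 ^ K * e\<close> by (rule Least_le)
  have num: "1 - (cmod (of_real r * \<zeta>))\<^sup>2 \<le> 2 * e"
    using r \<zeta> zero_le_power2[of "1 - r"] by (simp add: norm_mult e_def power2_eq_square algebra_simps)
  have "2 ^ k * e \<le> 4 * m"
  proof (cases k)
    case 0 then show ?thesis using m1 e by simp
  next
    case (Suc j)
    have "\<not> d \<le> 2 ^ j * e" using not_less_Least[of j "\<lambda>k. d \<le> 2 ^ k * e"] Suc by (simp add: k_def)
    moreover have "2 ^ k * e = 2 * (2 ^ j * e)" using Suc by simp
    ultimately show ?thesis using m2 by linarith
  qed
  then have "(2 ^ k * e)\<^sup>2 \<le> (4 * m)\<^sup>2" using e by (intro power_mono) auto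
  moreover have "(2 ^ k * e)\<^sup>2 = 4 ^ k * (e * e)"
  proof -
    have "(2 ^ k * e)\<^sup>2 = (2 ^ k * 2 ^ k) * (e * e)" by (simp only: power2_eq_square mult_ac)
    also have "(2::real) ^ k * 2 ^ k = 4 ^ k" by (simp flip: power_mult_distrib)
    finally show ?thesis .
  qed
  ultimately have "4 ^ k * (e * e) \<le> 16 * m\<^sup>2"
    by (simp add: power_mult_distrib)
  then have "2 * e / m\<^sup>2 \<le> 32 / (4 ^ k * e)"
    using e m1 by (simp add: field_simps)
  moreover have "poisson_kernel (of_real r * \<zeta>) \<eta> \<le> 2 * e / m\<^sup>2"
    unfolding poisson_kernel_def m_def[symmetric] using num by (intro divide_right_mono) auto
  moreover have "32 / (4 ^ k * e) = 32 / (4 ^ k * e) * indicator (cball \<zeta> (2 ^ k * e)) \<eta>"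
    using k by (simp add: d_def dist_norm norm_minus_commute)
  moreover have "\<dots> \<le> (\<Sum>k\<le>K. 32 / (4 ^ k * e) * indicator (cball \<zeta> (2 ^ k * e)) \<eta>)"
    using kK e by (intro member_le_sum) auto
  ultimately have "poisson_kernel (of_real r * \<zeta>) \<eta> \<le> (\<Sum>k\<le>K. 32 / (4 ^ k * e) * indicator (cball \<zeta> (2 ^ k * e)) \<eta>)"
    by linarith
  then show ?thesis by (simp add: e_def)
qed

text \<open>Each dyadic arc contributes at most \<open>32 \<mu> / 2\<^sup>k\<close>, and these bounds sum to at most \<open>64 \<mu>\<close>.\<close>

lemma poisson_integral_le_of_arc_averages:
  fixes v :: "complex \<Rightarrow> real"
  assumes v: "continuous_on (sphere 0 1) v" "\<And>\<eta>. cmod \<eta> = 1 \<Longrightarrow> 0 \<le> v \<eta>"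
    and r: "0 \<le> r" "r < 1" and \<zeta>: "cmod \<zeta> = 1"
    and avg: "\<And>\<delta>. 0 < \<delta> \<Longrightarrow> (LINT \<eta>|circle_measure. indicator (cball \<zeta> \<delta>) \<eta> * v \<eta>) \<le> \<mu> * \<delta>"
  shows "(LINT \<eta>|circle_measure. poisson_kernel (of_real r * \<zeta>) \<eta> * v \<eta>) \<le> 64 * \<mu>"
proof -
  define e where "e = 1 - r"
  have e: "e > 0" using r by (simp add: e_def)
  obtain K where "2 / e < 2 ^ K" using real_arch_pow[of 2 "2/e"] by auto
  then have K: "2 \<le> 2 ^ K * (1 - r)" using e by (simp add: field_simps e_def)
  have "0 \<le> (LINT \<eta>|circle_measure. indicator (cball \<zeta> 1) \<eta> * v \<eta>)"
    using v(2) by (intro integral_nonneg_AE AE_I2) auto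
  with avg[of 1] have \<mu>: "\<mu> \<ge> 0" by simp
  have iv: "integrable circle_measure v" by (rule integrable_circle_continuous[OF v(1)])
  have ii: "integrable circle_measure (\<lambda>\<eta>. indicator (cball \<zeta> \<delta>) \<eta> * v \<eta>)" for \<delta>
  proof (rule Bochner_Integration.integrable_bound[OF iv])
    have "(indicator (cball \<zeta> \<delta>) :: complex \<Rightarrow> real) \<in> borel_measurable circle_measure"
      by (intro borel_measurable_circleI borel_measurable_indicator) simp
    then show "(\<lambda>\<eta>. indicator (cball \<zeta> \<delta>) \<eta> * v \<eta>) \<in> borel_measurable circle_measure"
      using iv by auto
  qed (auto simp: indicator_def)
  have "(LINT \<eta>|circle_measure. poisson_kernel (of_real r * \<zeta>) \<eta> * v \<eta>)
      \<le> (LINT \<eta>|circle_measure. (\<Sum>k\<le>K. 32 / (4 ^ k * e) * (indicator (cball \<zeta> (2 ^ k * e)) \<eta> * v \<eta>)))"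
  proof (rule integral_mono)
    show "integrable circle_measure (\<lambda>\<eta>. poisson_kernel (of_real r * \<zeta>) \<eta> * v \<eta>)"
      using r \<zeta> by (intro integrable_circle_continuous continuous_intros v continuous_on_poisson_kernel) (auto simp: norm_mult)
    show "integrable circle_measure (\<lambda>\<eta>. (\<Sum>k\<le>K. 32 / (4 ^ k * e) * (indicator (cball \<zeta> (2 ^ k * e)) \<eta> * v \<eta>)))"
      using ii by auto
    fix \<eta> assume "\<eta> \<in> space circle_measure"
    then have \<eta>: "cmod \<eta> = 1" by simp
    have "poisson_kernel (of_real r * \<zeta>) \<eta> * v \<eta> \<le> (\<Sum>k\<le>K. 32 / (4 ^ k * (1 - r)) * indicator (cball \<zeta> (2 ^ k * (1 - r))) \<eta>) * v \<eta>"
      using poisson_kernel_le_arcs[OF r \<zeta> \<eta> K] v(2)[OF \<eta>] by (rule mult_right_mono)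
    then show "poisson_kernel (of_real r * \<zeta>) \<eta> * v \<eta> \<le> (\<Sum>k\<le>K. 32 / (4 ^ k * e) * (indicator (cball \<zeta> (2 ^ k * e)) \<eta> * v \<eta>))"
      by (simp add: e_def sum_distrib_right mult.assoc)
  qed
  also have "\<dots> = (\<Sum>k\<le>K. 32 / (4 ^ k * e) * (LINT \<eta>|circle_measure. indicator (cball \<zeta> (2 ^ k * e)) \<eta> * v \<eta>))"
    using ii by (simp add: Bochner_Integration.integral_sum)
  also have "\<dots> \<le> (\<Sum>k\<le>K. 32 / (4 ^ k * e) * (\<mu> * (2 ^ k * e)))"
    using e by (intro sum_mono mult_left_mono avg) auto
  also have "\<dots> = 32 * \<mu> * (\<Sum>k\<le>K. (1/2) ^ k)"
  proof -
    have "(2::real) ^ k / 4 ^ k = (1/2) ^ k" for k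
      by (simp flip: power_divide)
    then show ?thesis using e by (simp add: sum_distrib_left field_simps)
  qed
  also have "\<dots> \<le> 32 * \<mu> * 2"
  proof -
    have "(\<Sum>k\<le>K. (1/2) ^ k) = 2 - (1/2::real) ^ K" by (induction K) auto
    then show ?thesis using \<mu> by (intro mult_left_mono) auto
  qed
  finally show ?thesis by simp
qed

text \<open>Vitali's lemma selects countably many disjoint balls whose fivefold enlargements cover \<open>E\<close>. The
  enlargement of a ball of radius \<open>\<delta>\<close> has measure at most \<open>20 \<delta>\<close>, and \<open>\<mu> \<delta>\<close> is less than the integral of
  \<open>v\<close> over the ball; by disjointness these integrals sum to at most the integral of \<open>v\<close>.\<close>

lemma circle_weak_type_covering:
  fixes v :: "complex \<Rightarrow> real"
  assumes v: "continuous_on (sphere 0 1) v" "\<And>\<eta>. cmod \<eta> = 1 \<Longrightarrow> 0 \<le> v \<eta>"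
    and \<mu>: "\<mu> > 0" and ES: "E \<subseteq> sphere 0 1" and EM: "E \<in> sets circle_measure"
    and E: "\<And>\<zeta>. \<zeta> \<in> E \<Longrightarrow> \<exists>\<delta>>0. (LINT \<eta>|circle_measure. indicator (cball \<zeta> \<delta>) \<eta> * v \<eta>) > \<mu> * \<delta>"
  shows "measure circle_measure E \<le> 20 / \<mu> * (LINT \<eta>|circle_measure. v \<eta>)"
proof -
  define I where "I = (LINT \<eta>|circle_measure. v \<eta>)"
  have iv: "integrable circle_measure v" by (rule integrable_circle_continuous[OF v(1)])
  have vm [measurable]: "v \<in> borel_measurable circle_measure" using iv by simp
  have im [measurable]: "(indicator (cball a \<delta>) :: complex \<Rightarrow> real) \<in> borel_measurable circle_measure" for a \<delta>
    by (intro borel_measurable_circleI borel_measurable_indicator) simp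
  have im' [measurable]: "(indicator (cball a \<delta>) :: complex \<Rightarrow> ennreal) \<in> borel_measurable circle_measure" for a \<delta>
    by (intro borel_measurable_circleI borel_measurable_indicator) simp
  have ii: "integrable circle_measure (\<lambda>\<eta>. indicator (cball a \<delta>) \<eta> * v \<eta>)" for a \<delta>
  proof (rule Bochner_Integration.integrable_bound[OF iv])
    show "(\<lambda>\<eta>. indicator (cball a \<delta>) \<eta> * v \<eta>) \<in> borel_measurable circle_measure"
      by (intro borel_measurable_times im vm)
  qed (auto simp: indicator_def)
  obtain R where R: "\<And>\<zeta>. \<zeta> \<in> E \<Longrightarrow> R \<zeta> > 0 \<and> (LINT \<eta>|circle_measure. indicator (cball \<zeta> (R \<zeta>)) \<eta> * v \<eta>) > \<mu> * R \<zeta>"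
    using E by metis
  have RI: "R \<zeta> \<le> I / \<mu>" if "\<zeta> \<in> E" for \<zeta>
  proof -
    have "(LINT \<eta>|circle_measure. indicator (cball \<zeta> (R \<zeta>)) \<eta> * v \<eta>) \<le> I"
      unfolding I_def using v(2) by (intro integral_mono ii iv) (auto simp: indicator_def)
    then show ?thesis using R[OF that] \<mu> by (simp add: field_simps)
  qed
  have "\<zeta> \<in> cball \<zeta> (R \<zeta>)" if "\<zeta> \<in> E" for \<zeta>
    using R[OF that] by (simp add: less_imp_le)
  then have cov: "E \<subseteq> (\<Union>i\<in>E. cball i (R i))" by blast
  obtain C where C: "countable C" "C \<subseteq> E"
      "pairwise (\<lambda>i j. disjnt (cball i (R i)) (cball j (R j))) C"
      "E \<subseteq> (\<Union>i\<in>C. cball i (5 * R i))"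
    by (rule Vitali_covering_lemma_cballs[of E "\<lambda>i. i" R E "I / \<mu>"]) (use R RI cov in auto)
  have "emeasure circle_measure E = (\<integral>\<^sup>+x. indicator E x \<partial>circle_measure)" using EM by simp
  also have "\<dots> \<le> (\<integral>\<^sup>+x. (\<integral>\<^sup>+i. indicator (cball i (5 * R i)) x \<partial>count_space C) \<partial>circle_measure)"
  proof (rule nn_integral_mono)
    fix x
    show "indicator E x \<le> (\<integral>\<^sup>+i. indicator (cball i (5 * R i)) x \<partial>count_space C :: ennreal)"
    proof (cases "x \<in> E")
      case True
      then obtain i where i: "i \<in> C" "x \<in> cball i (5 * R i)" using C(4) by auto
      have "indicator E x = (indicator (cball i (5 * R i)) x :: ennreal)" using i True by simp
      also have "\<dots> \<le> (\<integral>\<^sup>+i. indicator (cball i (5 * R i)) x \<partial>count_space C)"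
        by (rule nn_integral_ge_point[OF i(1)])
      finally show ?thesis .
    qed simp
  qed
  also have "\<dots> = (\<integral>\<^sup>+i. (\<integral>\<^sup>+x. indicator (cball i (5 * R i)) x \<partial>circle_measure) \<partial>count_space C)"
    by (intro nn_integral_count_space_nn_integral C) auto
  also have "\<dots> \<le> (\<integral>\<^sup>+i. (\<integral>\<^sup>+x. ennreal (20 / \<mu>) * (indicator (cball i (R i)) x * ennreal (v x)) \<partial>circle_measure) \<partial>count_space C)"
  proof (rule nn_integral_mono)
    fix i assume "i \<in> space (count_space C)"
    then have i: "i \<in> E" "cmod i = 1" using C ES by auto
    have "(\<integral>\<^sup>+x. indicator (cball i (5 * R i)) x \<partial>circle_measure) = (\<integral>\<^sup>+x. indicator (cball i (5 * R i) \<inter> sphere 0 1) x \<partial>circle_measure)"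
      by (intro nn_integral_cong) (auto simp: indicator_def)
    also have "\<dots> = emeasure circle_measure (cball i (5 * R i) \<inter> sphere 0 1)"
      by (intro nn_integral_indicator sets_circle_Int) simp
    also have "\<dots> \<le> ennreal (4 * (5 * R i))"
      unfolding circle.emeasure_eq_measure using R[OF i(1)] i
      by (intro ennreal_leI measure_circle_cball_le) auto
    also have "\<dots> \<le> ennreal (20 / \<mu> * (LINT \<eta>|circle_measure. indicator (cball i (R i)) \<eta> * v \<eta>))"
      using R[OF i(1)] \<mu> by (intro ennreal_leI) (simp add: field_simps)
    also have "\<dots> = (\<integral>\<^sup>+x. ennreal (20 / \<mu> * (indicator (cball i (R i)) x * v x)) \<partial>circle_measure)"
      using \<mu> v(2) by (subst nn_integral_eq_integral[OF integrable_mult_right[OF ii]]) (auto intro!: AE_I2)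
    also have "\<dots> = (\<integral>\<^sup>+x. ennreal (20 / \<mu>) * (indicator (cball i (R i)) x * ennreal (v x)) \<partial>circle_measure)"
      using \<mu> v(2) by (intro nn_integral_cong) (auto simp: indicator_def simp flip: ennreal_mult)
    finally show "(\<integral>\<^sup>+x. indicator (cball i (5 * R i)) x \<partial>circle_measure) \<le> \<dots>" .
  qed
  also have "\<dots> = (\<integral>\<^sup>+x. (\<integral>\<^sup>+i. ennreal (20 / \<mu>) * (indicator (cball i (R i)) x * ennreal (v x)) \<partial>count_space C) \<partial>circle_measure)"
    by (rule nn_integral_count_space_nn_integral[symmetric]) (use C in auto)
  also have "\<dots> \<le> (\<integral>\<^sup>+x. ennreal (20 / \<mu>) * ennreal (v x) \<partial>circle_measure)"
  proof (rule nn_integral_mono)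
    fix x
    have "(\<integral>\<^sup>+i. indicator (cball i (R i)) x \<partial>count_space C) = (\<integral>\<^sup>+i. indicator {i\<in>C. x \<in> cball i (R i)} i \<partial>count_space C :: ennreal)"
      by (intro nn_integral_cong) (auto simp: indicator_def)
    also have "\<dots> = emeasure (count_space C) {i\<in>C. x \<in> cball i (R i)}" by (intro nn_integral_indicator) auto
    also have "\<dots> \<le> 1"
    proof -
      have uniq: "i = j" if "i \<in> {i\<in>C. x \<in> cball i (R i)}" "j \<in> {i\<in>C. x \<in> cball i (R i)}" for i j
        using C(3) that unfolding pairwise_def disjnt_def by blast
      show ?thesis
      proof (cases "{i\<in>C. x \<in> cball i (R i)} = {}")
        case True then show ?thesis by (simp only: emeasure_empty zero_le)
      next
        case False
        then obtain a where "a \<in> {i\<in>C. x \<in> cball i (R i)}" by blast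
        with uniq have eq: "{i\<in>C. x \<in> cball i (R i)} = {a}" by blast
        then have "a \<in> C" by blast
        then show ?thesis unfolding eq by (simp add: emeasure_count_space_finite)
      qed
    qed
    finally have le1: "(\<integral>\<^sup>+i. indicator (cball i (R i)) x \<partial>count_space C) \<le> (1::ennreal)" .
    have "(\<integral>\<^sup>+i. ennreal (20 / \<mu>) * (indicator (cball i (R i)) x * ennreal (v x)) \<partial>count_space C)
      = (\<integral>\<^sup>+i. (ennreal (20 / \<mu>) * ennreal (v x)) * indicator (cball i (R i)) x \<partial>count_space C)"
      by (intro nn_integral_cong) (simp add: mult_ac)
    also have "\<dots> = (ennreal (20 / \<mu>) * ennreal (v x)) * (\<integral>\<^sup>+i. indicator (cball i (R i)) x \<partial>count_space C)"
      by (rule nn_integral_cmult) simp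
    also have "\<dots> \<le> (ennreal (20 / \<mu>) * ennreal (v x)) * 1" by (intro mult_left_mono le1) simp
    finally show "(\<integral>\<^sup>+i. ennreal (20 / \<mu>) * (indicator (cball i (R i)) x * ennreal (v x)) \<partial>count_space C)
      \<le> ennreal (20 / \<mu>) * ennreal (v x)" by simp
  qed
  also have "\<dots> = ennreal (20 / \<mu>) * (\<integral>\<^sup>+x. ennreal (v x) \<partial>circle_measure)"
    by (intro nn_integral_cmult) simp
  also have "(\<integral>\<^sup>+x. ennreal (v x) \<partial>circle_measure) = ennreal I"
    unfolding I_def using v by (intro nn_integral_eq_integral iv AE_I2) auto
  also have "ennreal (20 / \<mu>) * ennreal I = ennreal (20 / \<mu> * I)"
    using \<mu> v(2) by (intro ennreal_mult[symmetric]) (auto simp: I_def intro!: integral_nonneg_AE AE_I2)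
  finally have "ennreal (measure circle_measure E) \<le> ennreal (20 / \<mu> * I)"
    by (simp add: circle.emeasure_eq_measure)
  moreover have "0 \<le> I" unfolding I_def using v(2) by (intro integral_nonneg_AE AE_I2) auto
  ultimately show ?thesis using \<mu> by (simp add: I_def ennreal_le_iff)
qed

text \<open>Where the maximal function exceeds \<open>\<kappa>\<close>, some arc average of the values on the circle of
  radius \<open>s\<close> must exceed a fixed multiple of \<open>\<kappa>\<close>, since these averages dominate Poisson integrals.\<close>

lemma radial_maximal_weak_type:
  assumes v: "poisson_subharmonic v" "\<And>z. cmod z < 1 \<Longrightarrow> 0 \<le> v z" and s: "0 \<le> s" "s < 1" and \<kappa>: "\<kappa> > 0"
  shows "{\<zeta> \<in> sphere 0 1. \<exists>r\<in>{0..<1}. v (of_real (s * r) * \<zeta>) > \<kappa>} \<in> sets circle_measure"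
    and "measure circle_measure {\<zeta> \<in> sphere 0 1. \<exists>r\<in>{0..<1}. v (of_real (s * r) * \<zeta>) > \<kappa>}
       \<le> 1280 / \<kappa> * (LINT \<eta>|circle_measure. v (of_real s * \<eta>))"
proof -
  define E where "E = {\<zeta> \<in> sphere 0 1. \<exists>r\<in>{0..<1}. v (of_real (s * r) * \<zeta>) > \<kappa>}"
  have c: "continuous_on (ball 0 1) v" using v(1) by (simp add: poisson_subharmonic_def)
  have sr: "0 \<le> s * r" "s * r < 1" if "r \<in> {0..<1}" for r
    using that s mult_le_one[of s r] mult_strict_mono[of s 1 r 1] by (cases "r = 0"; auto)+
  have cc: "continuous_on (sphere 0 1) (\<lambda>\<eta>. v (of_real s * \<eta>))"
    by (rule continuous_on_circle_dilation[OF c s])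
  have E_eq: "E = (\<Union>r\<in>{0..<1}. sphere 0 1 \<inter> (\<lambda>\<zeta>. v (of_real (s * r) * \<zeta>)) -` {\<kappa><..})"
    by (auto simp: E_def)
  have "openin (top_of_set (sphere 0 1)) (sphere 0 1 \<inter> (\<lambda>\<zeta>. v (of_real (s * r) * \<zeta>)) -` {\<kappa><..})"
    if "r \<in> {0..<1}" for r
    by (rule continuous_openin_preimage_gen[OF continuous_on_circle_dilation[OF c]]) (use sr that in auto)
  then have "openin (top_of_set (sphere 0 1)) E" unfolding E_eq by (intro openin_Union) auto
  then obtain T where "open T" "E = sphere 0 1 \<inter> T" unfolding openin_open by auto
  then show EM: "E \<in> sets circle_measure" by (auto simp: sets_circle_measure sets_restrict_space)
  have "measure circle_measure E \<le> 20 / (\<kappa> / 64) * (LINT \<eta>|circle_measure. v (of_real s * \<eta>))"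
  proof (rule circle_weak_type_covering[OF cc _ _ _ EM])
    show "0 \<le> v (of_real s * \<eta>)" if "cmod \<eta> = 1" for \<eta> using that v(2) s by (simp add: norm_mult)
    fix \<zeta> assume "\<zeta> \<in> E"
    then obtain r where r: "cmod \<zeta> = 1" "0 \<le> r" "r < 1" "v (of_real (s * r) * \<zeta>) > \<kappa>" by (auto simp: E_def)
    show "\<exists>\<delta>>0. (LINT \<eta>|circle_measure. indicator (cball \<zeta> \<delta>) \<eta> * v (of_real s * \<eta>)) > \<kappa> / 64 * \<delta>"
    proof (rule ccontr)
      assume "\<not> ?thesis"
      then have "(LINT \<eta>|circle_measure. poisson_kernel (of_real r * \<zeta>) \<eta> * v (of_real s * \<eta>)) \<le> 64 * (\<kappa> / 64)"
        using v(2) s r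
        by (intro poisson_integral_le_of_arc_averages cc) (force simp: norm_mult not_less)+
      moreover have "v (of_real s * (of_real r * \<zeta>)) \<le> (LINT \<eta>|circle_measure. poisson_kernel (of_real r * \<zeta>) \<eta> * v (of_real s * \<eta>))"
        using v(1) s r unfolding poisson_subharmonic_def by (auto simp: norm_mult)
      ultimately show False using r by (simp add: mult.assoc)
    qed
  qed (use \<kappa> in \<open>auto simp: E_def\<close>)
  then show "measure circle_measure E \<le> 1280 / \<kappa> * (LINT \<eta>|circle_measure. v (of_real s * \<eta>))" by simp
qed

section \<open>Uniform convexity and mean convergence of dilations\<close>

text \<open>The factor of the first term is close to \<open>1\<close> for small \<open>t\<close>. The inequality is therefore used
  when the second term is a small or bounded perturbation: it replaces Minkowski's inequality.\<close>

lemma powr_add_le_convex: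
  fixes x y p t :: real
  assumes "0 \<le> x" "0 \<le> y" "1 \<le> p" "0 < t" "t < 1"
  shows "(x + y) powr p \<le> (1 - t) powr (1 - p) * x powr p + t powr (1 - p) * y powr p"
proof (cases "x + y = 0")
  case False
  define c where "c = x + y"
  have c: "c > 0" using False assms by (simp add: c_def)
  have *: "a * (z / a) powr p = a powr (1 - p) * z powr p" if "0 < a" "0 \<le> z" for a z :: real
    using that by (simp add: powr_divide powr_diff)
  have "c powr p = (1 - t) * (c powr p + p * c powr (p - 1) * (x / (1 - t) - c)) + t * (c powr p + p * c powr (p - 1) * (y / t - c))"
    using assms by (simp add: c_def field_simps)
  also have "\<dots> \<le> (1 - t) * (x / (1 - t)) powr p + t * (y / t) powr p"
    using assms c by (intro add_mono mult_left_mono powr_tangent) auto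
  also have "\<dots> = (1 - t) powr (1 - p) * x powr p + t powr (1 - p) * y powr p"
    using assms by (simp add: *)
  finally show ?thesis by (simp add: c_def)
qed (use assms in auto)

lemma norm_add_powr_le_convex:
  fixes a b :: "'a::real_normed_vector"
  assumes "1 \<le> p" "0 < t" "t < 1"
  shows "norm (a + b) powr p \<le> (1 - t) powr (1 - p) * norm a powr p + t powr (1 - p) * norm b powr p"
proof -
  have "norm (a + b) powr p \<le> (norm a + norm b) powr p"
    using assms by (intro powr_mono2 norm_triangle_ineq) auto
  also have "\<dots> \<le> (1 - t) powr (1 - p) * norm a powr p + t powr (1 - p) * norm b powr p"
    using assms by (intro powr_add_le_convex) auto
  finally show ?thesis .
qed

lemma powr_tangent_strict:
  fixes x y p :: real
  assumes "0 \<le> x" "0 < y" "1 < p" "x \<noteq> y"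
  shows "y powr p + p * y powr (p - 1) * (x - y) < x powr p"
proof -
  have *: "y powr p = y * y powr (p - 1)" "x powr p = x * x powr (p - 1)"
    using assms by (cases "x = 0"; simp add: powr_diff)+
  define m where "m = (x + y) / 2"
  have m: "m > 0" using assms by (simp add: m_def)
  have mm: "m powr p = m * m powr (p - 1)" using m by (simp add: powr_diff)
  have "x powr p \<ge> m powr p + p * m powr (p - 1) * (x - m)" using assms m by (intro powr_tangent) auto
  moreover have "m powr p \<ge> y powr p + p * y powr (p - 1) * (m - y)" using assms m by (intro powr_tangent) auto
  moreover have "p * m powr (p - 1) * (x - m) > p * y powr (p - 1) * (x - m)"
  proof (cases "x > y")
    case True
    then have "y powr (p - 1) < m powr (p - 1)" using assms by (intro powr_less_mono2) (auto simp: m_def)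
    then show ?thesis using True assms by (intro mult_strict_right_mono mult_strict_left_mono) (auto simp: m_def)
  next
    case False
    then have "m powr (p - 1) < y powr (p - 1)" using assms m by (intro powr_less_mono2) (auto simp: m_def)
    then show ?thesis using False assms
      by (intro mult_strict_right_mono_neg mult_strict_left_mono) (auto simp: m_def)
  qed
  moreover have "p * y powr (p - 1) * (x - m) + p * y powr (p - 1) * (m - y) = p * y powr (p - 1) * (x - y)"
    by (simp add: algebra_simps)
  ultimately show ?thesis by linarith
qed

definition convexity_defect :: "real \<Rightarrow> 'a::euclidean_space \<Rightarrow> 'a \<Rightarrow> real" where
  "convexity_defect p a b = (norm a powr p + norm b powr p) / 2 - norm ((1/2) *\<^sub>R (a + b)) powr p"

lemma powr_midpoint_less:
  fixes x y p :: real
  assumes "0 \<le> x" "0 \<le> y" "1 < p" "x \<noteq> y"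
  shows "((x + y) / 2) powr p < (x powr p + y powr p) / 2"
proof -
  define m where "m = (x + y) / 2"
  have m: "m > 0" using assms by (simp add: m_def)
  define k where "k = p * m powr (p - 1)"
  have "(m powr p + k * (x - m)) + (m powr p + k * (y - m)) < x powr p + y powr p"
    unfolding k_def using assms m by (intro add_strict_mono powr_tangent_strict; simp add: m_def)
  moreover have "y - m = - (x - m)" by (simp add: m_def field_simps)
  then have "k * (x - m) + k * (y - m) = 0" by (simp only: mult_minus_right)
  moreover have "a < s / 2" if "a + b + (a + c) < s" "b + c = 0" for a b c s :: real
    using that by linarith
  ultimately have "m powr p < (x powr p + y powr p) / 2" by blast
  then show ?thesis by (simp add: m_def)
qed

text \<open>Strictness has two sources: the power function is strictly convex, and a sum of two vectors
  of equal norm attains equality in the triangle inequality only if the vectors coincide.\<close>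

lemma convexity_defect_pos:
  assumes "1 < p" "a \<noteq> b"
  shows "0 < convexity_defect p a b"
proof -
  define x y where "x = norm a" and "y = norm b"
  have xy: "0 \<le> x" "0 \<le> y" by (auto simp: x_def y_def)
  have le: "norm ((1/2) *\<^sub>R (a + b)) \<le> (x + y) / 2"
    using norm_triangle_ineq[of a b] by (simp add: x_def y_def)
  show ?thesis
  proof (cases "x = y")
    case False
    have "norm ((1/2) *\<^sub>R (a + b)) powr p \<le> ((x + y) / 2) powr p"
      using le assms by (intro powr_mono2) auto
    also have "\<dots> < (x powr p + y powr p) / 2" using xy assms False by (intro powr_midpoint_less) auto
    finally show ?thesis by (simp add: convexity_defect_def x_def y_def)
  next
    case True
    have "norm (a + b) \<noteq> norm a + norm b"
      using True assms norm_triangle_eq[of a b] by (auto simp: x_def y_def)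
    then have "norm ((1/2) *\<^sub>R (a + b)) < x"
      using norm_triangle_ineq[of a b] True by (simp add: x_def y_def)
    then have "norm ((1/2) *\<^sub>R (a + b)) powr p < x powr p" using assms by (intro powr_less_mono2) auto
    then show ?thesis using True by (simp add: convexity_defect_def x_def y_def)
  qed
qed

lemma convexity_defect_nonneg: "1 < p \<Longrightarrow> 0 \<le> convexity_defect p a b"
  by (cases "a = b") (auto simp: convexity_defect_pos less_imp_le, simp add: convexity_defect_def)

lemma continuous_on_norm_powr:
  fixes f :: "'a::topological_space \<Rightarrow> 'b::real_normed_vector"
  assumes "continuous_on S f" "0 < p"
  shows "continuous_on S (\<lambda>x. norm (f x) powr p)"
  using assms by (intro continuous_on_powr' continuous_intros) auto

text \<open>A quantitative uniform convexity. All terms are homogeneous of degree \<open>p\<close>, so it suffices to look at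
  the unit sphere of pairs. There the set where the first term does not suffice is compact and avoids
  the diagonal, so the defect is bounded below on it.\<close>

lemma norm_diff_powr_le_convexity_defect:
  assumes p: "1 < p" and \<epsilon>: "0 < \<epsilon>"
  shows "\<exists>C\<ge>0. \<forall>a b :: 'a::euclidean_space. norm (a - b) powr p \<le> \<epsilon> * (norm a powr p + norm b powr p) + C * convexity_defect p a b"
proof -
  define N where "N = (\<lambda>(a::'a, b::'a). norm a powr p + norm b powr p)"
  define D where "D = (\<lambda>(a::'a, b::'a). convexity_defect p a b)"
  define M where "M = (\<lambda>(a::'a, b::'a). norm (a - b) powr p)"
  have cN: "continuous_on UNIV N" and cD: "continuous_on UNIV D" and cM: "continuous_on UNIV M"
    unfolding N_def D_def M_def convexity_defect_def split_beta using p
    by (intro continuous_intros continuous_on_norm_powr; simp)+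
  define K where "K = sphere 0 1 \<inter> {z. \<epsilon> * N z \<le> M z}"
  have K: "compact K" unfolding K_def
    by (intro compact_Int_closed closed_Collect_le continuous_on_mult continuous_on_const cN cM) auto
  obtain \<delta> where \<delta>: "\<delta> > 0" "\<And>z. z \<in> K \<Longrightarrow> \<delta> \<le> D z"
  proof (cases "K = {}")
    case True then show ?thesis using that[of 1] by auto
  next
    case False
    then obtain z where z: "z \<in> K" "\<And>w. w \<in> K \<Longrightarrow> D z \<le> D w"
      using continuous_attains_inf[OF K False continuous_on_subset[OF cD]] by auto
    obtain a b where ab: "z = (a, b)" by (cases z)
    have "a \<noteq> b"
    proof
      assume "a = b"
      with z ab have "\<epsilon> * (2 * norm a powr p) \<le> 0" "a \<noteq> 0" using p by (auto simp: K_def N_def M_def)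
      then show False using \<epsilon> by (simp add: mult_le_0_iff)
    qed
    then have "0 < D z" using p by (simp add: D_def ab convexity_defect_pos)
    then show ?thesis using that[of "D z"] z by auto
  qed
  have "bounded (M ` sphere 0 1)"
    by (intro compact_imp_bounded compact_continuous_image continuous_on_subset[OF cM]) auto
  then obtain B where B: "B > 0" "\<And>z. z \<in> sphere 0 1 \<Longrightarrow> \<bar>M z\<bar> \<le> B"
    unfolding bounded_pos by auto
  define C where "C = B / \<delta>"
  have C: "C \<ge> 0" using B \<delta> by (simp add: C_def)
  have D0: "0 \<le> D z" for z using p by (cases z) (simp add: D_def convexity_defect_nonneg)
  have S: "M z \<le> \<epsilon> * N z + C * D z" if "z \<in> sphere 0 1" for z
  proof (cases "z \<in> K")
    case True
    have "M z \<le> B" using B(2)[OF that] by simp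
    also have "B = C * \<delta>" using \<delta> by (simp add: C_def)
    also have "\<dots> \<le> C * D z" using \<delta>(2)[OF True] C by (rule mult_left_mono)
    finally show ?thesis using \<epsilon> by (simp add: N_def split_beta add_increasing)
  next
    case False
    then have "M z \<le> \<epsilon> * N z" using that by (auto simp: K_def)
    then show ?thesis using C D0[of z] by (simp add: add_increasing2)
  qed
  have hom: "M (c *\<^sub>R z) = c powr p * M z" "N (c *\<^sub>R z) = c powr p * N z" "D (c *\<^sub>R z) = c powr p * D z" if "c > 0" for c z
  proof -
    obtain a b where [simp]: "z = (a, b)" by (cases z)
    have "norm (c *\<^sub>R a - c *\<^sub>R b) = c * norm (a - b)"
      using that by (simp flip: scaleR_diff_right)
    then show "M (c *\<^sub>R z) = c powr p * M z" using that by (simp add: M_def powr_mult)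
    show "N (c *\<^sub>R z) = c powr p * N z" using that by (simp add: N_def powr_mult algebra_simps)
    have "norm ((1/2) *\<^sub>R (c *\<^sub>R a + c *\<^sub>R b)) = c * norm ((1/2) *\<^sub>R (a + b))"
      using that by (simp flip: scaleR_add_right)
    then show "D (c *\<^sub>R z) = c powr p * D z" using that
      by (simp add: D_def convexity_defect_def powr_mult algebra_simps)
  qed
  have "M z \<le> \<epsilon> * N z + C * D z" for z
  proof (cases "z = 0")
    case True
    then show ?thesis using p by (simp add: M_def N_def D_def convexity_defect_def zero_prod_def)
  next
    case False
    define w where "w = (1 / norm z) *\<^sub>R z"
    have "z = norm z *\<^sub>R w" "w \<in> sphere 0 1" using False by (auto simp: w_def)
    then have "M z = norm z powr p * M w" "N z = norm z powr p * N w" "D z = norm z powr p * D w"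
      using hom[of "norm z" w] False by auto
    moreover have "norm z powr p * M w \<le> norm z powr p * (\<epsilon> * N w + C * D w)"
      using S[OF \<open>w \<in> _\<close>] by (intro mult_left_mono) auto
    ultimately show ?thesis by (simp add: algebra_simps)
  qed
  then show ?thesis using C by (intro exI[of _ C]) (auto simp: M_def N_def D_def split: prod.splits)
qed

text \<open>Let \<open>L\<close> be the supremum of the means. By uniform convexity \<open>u\<close> and its dilation are close in
  mean as soon as the mean of their midpoint is close to \<open>L\<close>. The midpoint is again harmonic, so its
  mean increases with the radius; and at a fixed radius it tends, as \<open>s\<close> increases to \<open>1\<close>, to the
  mean of \<open>u\<close>, which is close to \<open>L\<close> when the radius is well chosen.\<close>

lemma dilations_converge_in_mean:
  fixes u :: "complex \<Rightarrow> 'a::euclidean_space"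
  assumes u: "poisson_harmonic u" and p: "1 < p"
    and bdd: "\<And>r. 0 \<le> r \<Longrightarrow> r < 1 \<Longrightarrow> (LINT \<zeta>|circle_measure. norm (u (of_real r * \<zeta>)) powr p) \<le> B"
    and \<epsilon>: "0 < \<epsilon>"
  shows "\<exists>s0<1. \<forall>s\<in>{s0<..<1}. 0 \<le> s \<longrightarrow> (\<forall>r\<in>{0..<1}.
     (LINT \<zeta>|circle_measure. norm (u (of_real r * \<zeta>) - u (of_real (s * r) * \<zeta>)) powr p) \<le> \<epsilon>)"
proof -
  define m where "m = (\<lambda>r. LINT \<zeta>|circle_measure. norm (u (of_real r * \<zeta>)) powr p)"
  define L where "L = (SUP r\<in>{0..<1}. m r)"
  have bm: "bdd_above (m ` {0..<1})" using bdd by (intro bdd_aboveI[of _ B]) (auto simp: m_def)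
  have mL: "m r \<le> L" if "r \<in> {0..<1}" for r unfolding L_def using that bm by (rule cSUP_upper)
  have m0: "0 \<le> m r" for r unfolding m_def by (intro integral_nonneg_AE AE_I2) auto
  have L0: "0 \<le> L" using mL[of 0] m0[of 0] by simp
  have c: "continuous_on (ball 0 1) u" using u by (simp add: poisson_harmonic_def)
  have sr: "0 \<le> s * r" "s * r < 1" if "0 \<le> s" "s < 1" "0 \<le> r" "r < 1" for s r :: real
    using that mult_strict_mono[of s 1 r 1] by (cases "r = 0"; auto)+
  have cu: "continuous_on (sphere 0 1) (\<lambda>\<zeta>. u (of_real r * \<zeta>))" if "0 \<le> r" "r < 1" for r
    by (rule continuous_on_circle_dilation[OF c that])
  have inp: "integrable circle_measure (\<lambda>\<zeta>. norm (w \<zeta>) powr p)" if "continuous_on (sphere 0 1) w" for w :: "complex \<Rightarrow> 'a"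
    using p by (intro integrable_circle_continuous continuous_on_norm_powr that) auto
  define \<epsilon>1 where "\<epsilon>1 = \<epsilon> / (4 * (L + 1))"
  have \<epsilon>1: "\<epsilon>1 > 0" using \<epsilon> L0 by (simp add: \<epsilon>1_def)
  obtain C where C: "C \<ge> 0" and UC: "\<And>a b :: 'a. norm (a - b) powr p \<le> \<epsilon>1 * (norm a powr p + norm b powr p) + C * convexity_defect p a b"
    using norm_diff_powr_le_convexity_defect[OF p \<epsilon>1, where 'a='a] by blast
  define \<delta> where "\<delta> = \<epsilon> / (2 * (C + 1))"
  have \<delta>: "\<delta> > 0" using \<epsilon> C by (simp add: \<delta>_def)
  obtain r0 where r0: "r0 \<in> {0..<1}" "L - \<delta>/2 < m r0"
    using less_cSUP_iff[OF _ bm, of "L - \<delta>/2"] \<delta> by (auto simp: L_def)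
  \<comment> \<open>Uniform continuity of the midpoint in \<open>s\<close> at the fixed radius \<open>r0\<close> makes \<open>s0\<close> independent of \<open>\<zeta>\<close>.\<close>
  define W where "W = (\<lambda>(\<zeta>, s). norm ((1/2) *\<^sub>R (u (of_real r0 * \<zeta>) + u (of_real (s * r0) * \<zeta>))) powr p)"
  have cW: "continuous_on (sphere 0 1 \<times> {0..1}) W"
  proof -
    have "continuous_on (sphere 0 1 \<times> {0..1::real}) (\<lambda>z. u (of_real r0 * fst z))"
      by (rule continuous_on_compose2[OF c]) (use r0 in \<open>auto simp: norm_mult intro!: continuous_intros\<close>)
    moreover have "continuous_on (sphere 0 1 \<times> {0..1::real}) (\<lambda>z. u (of_real (snd z * r0) * fst z))"
    proof (rule continuous_on_compose2[OF c])
      show "(\<lambda>z. of_real (snd z * r0) * fst z) ` (sphere 0 1 \<times> {0..1}) \<subseteq> ball (0::complex) 1"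
      proof clarsimp
        fix \<zeta> :: complex and s :: real assume "cmod \<zeta> = 1" "0 \<le> s" "s \<le> (1::real)"
        moreover have "s * r0 \<le> 1 * r0" using r0 \<open>s \<le> 1\<close> by (intro mult_right_mono) auto
        ultimately show "cmod (of_real s * of_real r0 * \<zeta>) < 1" using r0 by (simp add: norm_mult)
      qed
    qed (intro continuous_intros)
    ultimately show ?thesis unfolding W_def split_beta using p
      by (intro continuous_on_norm_powr continuous_intros) auto
  qed
  have "uniformly_continuous_on (sphere 0 1 \<times> {0..1}) W"
    by (intro compact_uniformly_continuous cW compact_Times) auto
  then obtain d where d: "d > 0" "\<And>z z'. z \<in> sphere 0 1 \<times> {0..1} \<Longrightarrow> z' \<in> sphere 0 1 \<times> {0..1} \<Longrightarrow> dist z' z < d \<Longrightarrow> dist (W z') (W z) < \<delta>/2"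
    using \<delta> unfolding uniformly_continuous_on_def by (meson half_gt_zero)
  define s0 where "s0 = 1 - d"
  have main: "(LINT \<zeta>|circle_measure. norm (u (of_real r * \<zeta>) - u (of_real (s * r) * \<zeta>)) powr p) \<le> \<epsilon>"
    if s: "0 \<le> s" "s0 < s" "s < 1" and r: "r0 \<le> r" "r < 1" for s r
  proof -
    have r': "0 \<le> r" using r r0 by simp
    define w where "w = (\<lambda>z. (1/2) *\<^sub>R (u z + u (of_real s * z)))"
    have hw: "poisson_harmonic w" unfolding w_def
      by (intro poisson_harmonic_bounded_linear[OF poisson_harmonic_add[OF u poisson_harmonic_dilation[OF u]]]
          bounded_linear_scaleR_right s)
    have cw: "continuous_on (ball 0 1) w" using hw by (simp add: poisson_harmonic_def)
    have "m r0 - \<delta>/2 = (LINT \<zeta>|circle_measure. norm (u (of_real r0 * \<zeta>)) powr p - \<delta>/2)"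
      using inp[OF cu[of r0]] r0 by (simp add: m_def)
    also have "\<dots> \<le> (LINT \<zeta>|circle_measure. norm (w (of_real r0 * \<zeta>)) powr p)"
    proof (rule integral_mono)
      show "integrable circle_measure (\<lambda>\<zeta>. norm (u (of_real r0 * \<zeta>)) powr p - \<delta>/2)"
        using inp[OF cu[of r0]] r0 by simp
      show "integrable circle_measure (\<lambda>\<zeta>. norm (w (of_real r0 * \<zeta>)) powr p)"
        using r0 by (intro inp continuous_on_circle_dilation[OF cw]) auto
      fix \<zeta> assume "\<zeta> \<in> space circle_measure"
      then have "dist (W (\<zeta>, s)) (W (\<zeta>, 1)) < \<delta>/2"
        using s d(1) by (intro d(2)) (auto simp: dist_Pair_Pair dist_real_def s0_def)
      moreover have "W (\<zeta>, 1) = norm (u (of_real r0 * \<zeta>)) powr p"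
        by (simp add: W_def flip: scaleR_2)
      moreover have "W (\<zeta>, s) = norm (w (of_real r0 * \<zeta>)) powr p" by (simp add: W_def w_def mult.assoc)
      ultimately show "norm (u (of_real r0 * \<zeta>)) powr p - \<delta>/2 \<le> norm (w (of_real r0 * \<zeta>)) powr p"
        unfolding dist_real_def by linarith
    qed
    also have "\<dots> \<le> (LINT \<zeta>|circle_measure. norm (w (of_real r * \<zeta>)) powr p)"
      using p r r0 by (intro poisson_subharmonic_mean_mono[OF poisson_subharmonic_norm_powr[OF hw]]) auto
    finally have low: "L - \<delta> < (LINT \<zeta>|circle_measure. norm (w (of_real r * \<zeta>)) powr p)" using r0 by simp
    let ?a = "\<lambda>\<zeta>. u (of_real r * \<zeta>)" and ?b = "\<lambda>\<zeta>. u (of_real (s * r) * \<zeta>)"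
    have ca: "continuous_on (sphere 0 1) ?a" using r r' by (intro cu) auto
    have cb: "continuous_on (sphere 0 1) ?b" using r r' s sr by (intro cu) auto
    have cd: "continuous_on (sphere 0 1) (\<lambda>\<zeta>. w (of_real r * \<zeta>))" using r r' by (intro continuous_on_circle_dilation[OF cw]) auto
    have weq: "w (of_real r * \<zeta>) = (1/2) *\<^sub>R (?a \<zeta> + ?b \<zeta>)" for \<zeta> by (simp add: w_def mult.assoc)
    have "(LINT \<zeta>|circle_measure. norm (?a \<zeta> - ?b \<zeta>) powr p)
        \<le> (LINT \<zeta>|circle_measure. \<epsilon>1 * (norm (?a \<zeta>) powr p + norm (?b \<zeta>) powr p) +
             C * ((norm (?a \<zeta>) powr p + norm (?b \<zeta>) powr p) / 2 - norm (w (of_real r * \<zeta>)) powr p))"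
    proof (rule integral_mono)
      show "norm (?a \<zeta> - ?b \<zeta>) powr p \<le> \<epsilon>1 * (norm (?a \<zeta>) powr p + norm (?b \<zeta>) powr p) +
             C * ((norm (?a \<zeta>) powr p + norm (?b \<zeta>) powr p) / 2 - norm (w (of_real r * \<zeta>)) powr p)" for \<zeta>
        using UC[of "?a \<zeta>" "?b \<zeta>"] by (simp only: convexity_defect_def weq)
      show "integrable circle_measure (\<lambda>\<zeta>. norm (?a \<zeta> - ?b \<zeta>) powr p)"
        by (intro inp continuous_on_diff ca cb)
    qed (use inp[OF ca] inp[OF cb] inp[OF cd] in auto)
    also have "\<dots> = \<epsilon>1 * (m r + m (s * r)) + C * ((m r + m (s * r)) / 2 - (LINT \<zeta>|circle_measure. norm (w (of_real r * \<zeta>)) powr p))"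
      using inp[OF ca] inp[OF cb] inp[OF cd] by (simp add: m_def)
    also have "\<dots> \<le> \<epsilon>1 * (L + L) + C * ((L + L) / 2 - (L - \<delta>))"
      using mL[of r] mL[of "s * r"] sr[of s r] s r r' low C \<epsilon>1
      by (intro add_mono mult_left_mono diff_mono divide_right_mono) auto
    also have "\<dots> \<le> \<epsilon> / 2 + \<epsilon> / 2"
    proof (rule add_mono)
      show "\<epsilon>1 * (L + L) \<le> \<epsilon> / 2" using \<epsilon> L0 by (simp add: \<epsilon>1_def field_simps)
      show "C * ((L + L) / 2 - (L - \<delta>)) \<le> \<epsilon> / 2" using \<epsilon> C by (simp add: \<delta>_def field_simps)
    qed
    finally show ?thesis by simp
  qed
  have "(LINT \<zeta>|circle_measure. norm (u (of_real r * \<zeta>) - u (of_real (s * r) * \<zeta>)) powr p) \<le> \<epsilon>"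
    if s: "s0 < s" "s < 1" "0 \<le> s" and r: "r \<in> {0..<1}" for s r
  proof (cases "r0 \<le> r")
    case True then show ?thesis using main[of s r] s r by simp
  next
    case False
    have hd: "poisson_harmonic (\<lambda>z. u z - u (of_real s * z))"
      by (intro poisson_harmonic_diff u poisson_harmonic_dilation s)
    have "(LINT \<zeta>|circle_measure. norm (u (of_real r * \<zeta>) - u (of_real s * (of_real r * \<zeta>))) powr p)
        \<le> (LINT \<zeta>|circle_measure. norm (u (of_real r0 * \<zeta>) - u (of_real s * (of_real r0 * \<zeta>))) powr p)"
      using p r r0 False by (intro poisson_subharmonic_mean_mono[OF poisson_subharmonic_norm_powr[OF hd]]) auto
    also have "\<dots> \<le> \<epsilon>" using main[of s r0] s r0 by (simp add: mult.assoc)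
    finally show ?thesis by (simp add: mult.assoc)
  qed
  then show ?thesis using d(1) by (intro exI[of _ s0]) (auto simp: s0_def)
qed

section \<open>Radial limits and boundary means\<close>

lemma filterlim_one_minus_inverse: "filterlim (\<lambda>n. 1 - 1 / (real n + 2)) (at_left 1) sequentially"
proof -
  have "(\<lambda>n. 1 / (real n + 2)) \<longlonglongrightarrow> 0"
    using LIMSEQ_ignore_initial_segment[OF lim_1_over_n[where 'a = real], of 2] by (simp add: add.commute)
  from tendsto_diff[OF tendsto_const[of 1] this] show ?thesis
    by (auto simp: filterlim_at)
qed

text \<open>Counting with natural numbers \<open>m\<close> and \<open>k\<close> exhibits the set of convergence as a countable
  intersection of countable unions.\<close>

lemma at_left_one_limit_iff_Cauchy:
  fixes \<phi> :: "real \<Rightarrow> 'a::banach"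
  shows "(\<exists>l. (\<phi> \<longlongrightarrow> l) (at_left 1)) \<longleftrightarrow>
    (\<forall>m::nat. \<exists>k::nat. \<forall>r\<in>{1 - 1/(real k+2)<..<1}. \<forall>r'\<in>{1 - 1/(real k+2)<..<1}. norm (\<phi> r - \<phi> r') \<le> 1 / (real m+1))"
    (is "?L \<longleftrightarrow> ?R")
proof
  assume ?L
  then obtain l where l: "(\<phi> \<longlongrightarrow> l) (at_left 1)" by blast
  show ?R
  proof
    fix m :: nat
    have "\<forall>\<^sub>F r in at_left 1. dist (\<phi> r) l < 1 / (2 * (real m+1))"
      by (rule tendstoD[OF l]) simp
    then obtain b where b: "b < 1" "\<And>r. b < r \<Longrightarrow> r < 1 \<Longrightarrow> dist (\<phi> r) l < 1 / (2 * (real m+1))"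
      unfolding eventually_at_left_field by blast
    obtain k :: nat where k: "1 / (1 - b) < real k" using reals_Archimedean2 by blast
    have "b \<le> 1 - 1/(real k+2)"
    proof -
      have "1 < real k * (1 - b)" using k b by (simp add: field_simps)
      also have "\<dots> \<le> (real k + 2) * (1 - b)" using b by (intro mult_right_mono) auto
      finally show ?thesis by (simp add: field_simps)
    qed
    moreover have "norm (\<phi> r - \<phi> r') \<le> 1 / (real m+1)" if "b < r" "r < 1" "b < r'" "r' < 1" for r r'
    proof -
      have "norm (\<phi> r - \<phi> r') \<le> dist (\<phi> r) l + dist (\<phi> r') l"
        using dist_triangle2[of "\<phi> r" "\<phi> r'" l] by (simp add: dist_norm)
      also have "\<dots> \<le> 1 / (2 * (real m+1)) + 1 / (2 * (real m+1))" using b(2)[of r] b(2)[of r'] that by linarith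
      also have "\<dots> = 1 / (real m+1)" by (simp add: field_simps)
      finally show ?thesis .
    qed
    ultimately show "\<exists>k::nat. \<forall>r\<in>{1 - 1/(real k+2)<..<1}. \<forall>r'\<in>{1 - 1/(real k+2)<..<1}. norm (\<phi> r - \<phi> r') \<le> 1 / (real m+1)"
      by (intro exI[of _ k]) auto
  qed
next
  assume R: ?R
  have rn: "1 - 1 / (real n + 3) \<in> {1 - 1/(real k+2)<..<1}" if "k \<le> n" for n k :: nat
    using that by (auto simp: field_simps)
  define U where "U = (\<lambda>n. \<phi> (1 - 1 / (real n + 3)))"
  have "Cauchy U"
  proof (rule metric_CauchyI)
    fix e :: real assume "0 < e"
    then obtain m :: nat where m: "1 / (real m+1) < e" using reals_Archimedean[of e] by (auto simp: inverse_eq_divide add.commute)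
    obtain k :: nat where k: "\<forall>r\<in>{1 - 1/(real k+2)<..<1}. \<forall>r'\<in>{1 - 1/(real k+2)<..<1}. norm (\<phi> r - \<phi> r') \<le> 1 / (real m+1)" using R by blast
    show "\<exists>M. \<forall>i\<ge>M. \<forall>j\<ge>M. dist (U i) (U j) < e"
    proof (intro exI[of _ k] allI impI)
      fix i j assume "k \<le> i" "k \<le> j"
      then have "norm (U i - U j) \<le> 1 / (real m+1)" unfolding U_def using k rn by blast
      then show "dist (U i) (U j) < e" using m by (simp add: dist_norm)
    qed
  qed
  then obtain l where l: "U \<longlonglongrightarrow> l" by (auto simp: Cauchy_convergent_iff convergent_def)
  have "(\<phi> \<longlongrightarrow> l) (at_left 1)"
  proof (rule tendstoI)
    fix e :: real assume "0 < e"
    then obtain m :: nat where m: "1 / (real m+1) < e" using reals_Archimedean[of e] by (auto simp: inverse_eq_divide add.commute)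
    obtain k :: nat where k: "\<forall>r\<in>{1 - 1/(real k+2)<..<1}. \<forall>r'\<in>{1 - 1/(real k+2)<..<1}. norm (\<phi> r - \<phi> r') \<le> 1 / (real m+1)" using R by blast
    have "dist (\<phi> r) l < e" if "r \<in> {1 - 1/(real k+2)<..<1}" for r
    proof -
      have "(\<lambda>n. norm (\<phi> r - U n)) \<longlonglongrightarrow> norm (\<phi> r - l)" by (intro tendsto_intros l)
      moreover have "\<forall>\<^sub>F n in sequentially. norm (\<phi> r - U n) \<le> 1 / (real m+1)"
        using eventually_ge_at_top[of k] by eventually_elim (use k rn that in \<open>auto simp: U_def\<close>)
      ultimately have "norm (\<phi> r - l) \<le> 1 / (real m+1)" by (intro tendsto_upperbound) auto
      then show ?thesis using m by (simp add: dist_norm)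
    qed
    then show "\<forall>\<^sub>F r in at_left 1. dist (\<phi> r) l < e"
      unfolding eventually_at_left_field by (intro exI[of _ "1 - 1/(real k+2)"]) auto
  qed
  then show ?L by blast
qed

text \<open>The difference between \<open>u\<close> and its dilation by \<open>s\<close> is small in mean for \<open>s\<close> near \<open>1\<close>, so by the
  maximal inequality it is uniformly small along all radii outside a set of small measure.
  The dilation has radial limits everywhere, because \<open>u\<close> is continuous inside the disk.\<close>

lemma poisson_harmonic_radial_limits_AE:
  fixes u :: "complex \<Rightarrow> 'a::euclidean_space"
  assumes u: "poisson_harmonic u" and p: "1 < p"
    and bdd: "\<And>r. 0 \<le> r \<Longrightarrow> r < 1 \<Longrightarrow> (LINT \<zeta>|circle_measure. norm (u (of_real r * \<zeta>)) powr p) \<le> B"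
  shows "AE \<zeta> in circle_measure. \<exists>l. ((\<lambda>r. u (of_real r * \<zeta>)) \<longlongrightarrow> l) (at_left 1)"
proof -
  define E where "E = (\<lambda>s \<kappa>. {\<zeta>\<in>sphere 0 1. \<exists>r\<in>{0..<1}. norm (u (of_real r * \<zeta>) - u (of_real (s * r) * \<zeta>)) powr p > \<kappa>})"
  have E: "E s \<kappa> \<in> sets circle_measure \<and> measure circle_measure (E s \<kappa>) \<le> 1280 / \<kappa> * \<epsilon>"
    if s: "0 \<le> s" "s < 1" and \<kappa>: "0 < \<kappa>" and \<epsilon>: "\<And>r. r \<in> {0..<1} \<Longrightarrow>
     (LINT \<zeta>|circle_measure. norm (u (of_real r * \<zeta>) - u (of_real (s * r) * \<zeta>)) powr p) \<le> \<epsilon>" for s \<kappa> \<epsilon>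
  proof -
    define v where "v = (\<lambda>z. norm (u z - u (of_real s * z)) powr p)"
    have v: "poisson_subharmonic v" unfolding v_def using p
      by (intro poisson_subharmonic_norm_powr poisson_harmonic_diff u poisson_harmonic_dilation s) auto
    define \<rho> where "\<rho> = (\<lambda>n::nat. 1 - 1 / (real n + 2))"
    have \<rho>: "0 \<le> \<rho> n" "\<rho> n < 1" "0 < \<rho> n" for n by (auto simp: \<rho>_def field_simps)
    define F where "F = (\<lambda>n. {\<zeta> \<in> sphere 0 1. \<exists>r\<in>{0..<1}. v (of_real (\<rho> n * r) * \<zeta>) > \<kappa>})"
    have Fs: "F n \<in> sets circle_measure" for n
      unfolding F_def using \<kappa> \<rho> by (intro radial_maximal_weak_type v) (auto simp: v_def)
    have Fm: "measure circle_measure (F n) \<le> 1280 / \<kappa> * \<epsilon>" for n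
    proof -
      have "measure circle_measure (F n) \<le> 1280 / \<kappa> * (LINT \<eta>|circle_measure. v (of_real (\<rho> n) * \<eta>))"
        unfolding F_def using \<kappa> \<rho> by (intro radial_maximal_weak_type v) (auto simp: v_def)
      also have "\<dots> \<le> 1280 / \<kappa> * \<epsilon>"
        using \<epsilon>[of "\<rho> n"] \<rho>[of n] \<kappa> by (intro mult_left_mono) (auto simp: v_def mult.assoc)
      finally show ?thesis .
    qed
    have EF: "E s \<kappa> = (\<Union>n. F n)"
    proof (intro equalityI subsetI)
      fix \<zeta> assume "\<zeta> \<in> E s \<kappa>"
      then obtain r where r: "cmod \<zeta> = 1" "0 \<le> r" "r < 1" "v (of_real r * \<zeta>) > \<kappa>"
        by (auto simp: E_def v_def mult.assoc)
      obtain n :: nat where n: "1 / (1 - r) < real n" using reals_Archimedean2 by blast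
      have "1 < real n * (1 - r)" using n r by (simp add: field_simps)
      also have "\<dots> \<le> (real n + 2) * (1 - r)" using r by (intro mult_right_mono) auto
      finally have "r < \<rho> n" by (simp add: \<rho>_def field_simps)
      then have "r / \<rho> n \<in> {0..<1}" "of_real (\<rho> n * (r / \<rho> n)) * \<zeta> = of_real r * \<zeta>"
        using r \<rho>[of n] by auto
      then have "\<zeta> \<in> F n" unfolding F_def using r by (auto intro!: bexI[of _ "r / \<rho> n"])
      then show "\<zeta> \<in> (\<Union>n. F n)" by blast
    next
      fix \<zeta> assume "\<zeta> \<in> (\<Union>n. F n)"
      then obtain n r where r: "cmod \<zeta> = 1" "0 \<le> r" "r < 1" "v (of_real (\<rho> n * r) * \<zeta>) > \<kappa>"
        by (auto simp: F_def)
      have "\<rho> n * r \<in> {0..<1}" using r \<rho>[of n] mult_le_one[of "\<rho> n" r] mult_strict_mono[of "\<rho> n" 1 r 1] by (cases "r = 0") auto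
      then show "\<zeta> \<in> E s \<kappa>" unfolding E_def using r
        by (auto intro!: bexI[of _ "\<rho> n * r"] simp: v_def mult.assoc)
    qed
    have incF: "incseq F"
    proof (rule incseq_SucI, rule subsetI)
      fix n \<zeta> assume "\<zeta> \<in> F n"
      then obtain r where r: "cmod \<zeta> = 1" "0 \<le> r" "r < 1" "v (of_real (\<rho> n * r) * \<zeta>) > \<kappa>"
        by (auto simp: F_def)
      \<comment> \<open>The same point of the disk, with the radius rescaled to the next circle.\<close>
      define r' where "r' = \<rho> n / \<rho> (Suc n) * r"
      have "\<rho> n \<le> \<rho> (Suc n)" by (simp add: \<rho>_def field_simps)
      then have "\<rho> n / \<rho> (Suc n) \<le> 1" using \<rho>[of "Suc n"] by simp
      then have "r' \<le> 1 * r" unfolding r'_def using r by (intro mult_right_mono) auto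
      moreover have "0 \<le> r'" using r \<rho>[of n] \<rho>[of "Suc n"] by (simp add: r'_def)
      moreover have "\<rho> (Suc n) * r' = \<rho> n * r" using \<rho>[of "Suc n"] by (simp add: r'_def)
      ultimately show "\<zeta> \<in> F (Suc n)" unfolding F_def using r by (auto intro!: bexI[of _ r'] simp del: of_real_mult)
    qed
    have "(\<lambda>n. measure circle_measure (F n)) \<longlonglongrightarrow> measure circle_measure (E s \<kappa>)"
      unfolding EF using Fs incF by (intro circle.finite_Lim_measure_incseq) auto
    then have "measure circle_measure (E s \<kappa>) \<le> 1280 / \<kappa> * \<epsilon>"
      using Fm by (intro LIMSEQ_le_const2) auto
    moreover have "E s \<kappa> \<in> sets circle_measure" unfolding EF using Fs by auto
    ultimately show ?thesis by blast
  qed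
  have AEm: "AE \<zeta> in circle_measure. \<exists>s\<in>{0..<1}. \<forall>r\<in>{0..<1}. norm (u (of_real r * \<zeta>) - u (of_real (s * r) * \<zeta>)) \<le> \<kappa>"
    if \<kappa>: "\<kappa> > 0" for \<kappa> :: real
  proof -
    have "\<exists>s\<in>{0..<1}. E s (\<kappa> powr p) \<in> sets circle_measure \<and> measure circle_measure (E s (\<kappa> powr p)) \<le> 1 / (real k + 1)" for k :: nat
    proof -
      define \<epsilon> where "\<epsilon> = \<kappa> powr p / 1280 / (real k + 1)"
      have "\<epsilon> > 0" using \<kappa> by (simp add: \<epsilon>_def)
      then obtain s0 where s0: "s0 < 1" "\<And>s r. s0 < s \<Longrightarrow> s < 1 \<Longrightarrow> 0 \<le> s \<Longrightarrow> r \<in> {0..<1} \<Longrightarrow>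
        (LINT \<zeta>|circle_measure. norm (u (of_real r * \<zeta>) - u (of_real (s * r) * \<zeta>)) powr p) \<le> \<epsilon>"
        using dilations_converge_in_mean[OF u p bdd, of \<epsilon>] by (auto simp: Ball_def)
      define s where "s = max 0 ((s0 + 1) / 2)"
      have s: "0 \<le> s" "s < 1" "s0 < s" using s0(1) by (auto simp: s_def max_def)
      have "1280 / (\<kappa> powr p) * \<epsilon> = 1 / (real k + 1)" using \<kappa> by (simp add: \<epsilon>_def field_simps)
      then show ?thesis using E[of s "\<kappa> powr p" \<epsilon>] s s0(2)[OF s(3,2,1)] \<kappa> by (intro bexI[of _ s]) auto
    qed
    then obtain S where S: "\<And>k. S k \<in> {0..<1}" "\<And>k. E (S k) (\<kappa> powr p) \<in> sets circle_measure"
      "\<And>k. measure circle_measure (E (S k) (\<kappa> powr p)) \<le> 1 / (real k + 1)" by metis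
    define N where "N = (\<Inter>k. E (S k) (\<kappa> powr p))"
    have N: "N \<in> sets circle_measure" unfolding N_def using S(2) by auto
    have "measure circle_measure N \<le> 1 / (real k + 1)" for k
    proof -
      have "measure circle_measure N \<le> measure circle_measure (E (S k) (\<kappa> powr p))"
        using S(2) by (intro circle.finite_measure_mono) (auto simp: N_def)
      then show ?thesis using S(3)[of k] by simp
    qed
    then have "measure circle_measure N \<le> 0"
      by (intro LIMSEQ_le_const[OF LIMSEQ_inverse_real_of_nat]) (auto simp: inverse_eq_divide add.commute)
    then have "measure circle_measure N = 0" using measure_nonneg[of circle_measure N] by linarith
    then have "N \<in> null_sets circle_measure"
      using N by (simp add: null_setsI circle.emeasure_eq_measure)
    then show ?thesis
    proof (rule AE_I')
      show "{\<zeta> \<in> space circle_measure. \<not> (\<exists>s\<in>{0..<1}. \<forall>r\<in>{0..<1}. norm (u (of_real r * \<zeta>) - u (of_real (s * r) * \<zeta>)) \<le> \<kappa>)} \<subseteq> N"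
      proof
        fix \<zeta> assume \<zeta>: "\<zeta> \<in> {\<zeta> \<in> space circle_measure. \<not> (\<exists>s\<in>{0..<1}. \<forall>r\<in>{0..<1}. norm (u (of_real r * \<zeta>) - u (of_real (s * r) * \<zeta>)) \<le> \<kappa>)}"
        have "\<zeta> \<in> E (S k) (\<kappa> powr p)" for k
        proof -
          have "\<exists>r\<in>{0..<1}. \<not> norm (u (of_real r * \<zeta>) - u (of_real (S k * r) * \<zeta>)) \<le> \<kappa>"
            using \<zeta> S(1)[of k] by blast
          then obtain r where r: "r \<in> {0..<1}" "\<kappa> < norm (u (of_real r * \<zeta>) - u (of_real (S k * r) * \<zeta>))"
            by (auto simp only: not_le)
          then have "\<kappa> powr p < norm (u (of_real r * \<zeta>) - u (of_real (S k * r) * \<zeta>)) powr p"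
            using \<kappa> p by (intro powr_less_mono2) auto
          then show ?thesis using r \<zeta> by (auto simp: E_def)
        qed
        then show "\<zeta> \<in> N" by (simp add: N_def)
      qed
    qed
  qed
  have c: "continuous_on (ball 0 1) u" using u by (simp add: poisson_harmonic_def)
  have "AE \<zeta> in circle_measure. \<forall>m::nat. \<exists>s\<in>{0..<1}. \<forall>r\<in>{0..<1}. norm (u (of_real r * \<zeta>) - u (of_real (s * r) * \<zeta>)) \<le> 1 / (4 * (real m + 1))"
    unfolding AE_all_countable by (intro allI AEm) simp
  then show ?thesis
  proof (rule AE_mp, intro AE_I2 impI)
    fix \<zeta> assume \<zeta>: "\<zeta> \<in> space circle_measure"
      and H: "\<forall>m::nat. \<exists>s\<in>{0..<1}. \<forall>r\<in>{0..<1}. norm (u (of_real r * \<zeta>) - u (of_real (s * r) * \<zeta>)) \<le> 1 / (4 * (real m + 1))"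
    show "\<exists>l. ((\<lambda>r. u (of_real r * \<zeta>)) \<longlongrightarrow> l) (at_left 1)"
      unfolding at_left_one_limit_iff_Cauchy
    proof
      fix m :: nat
      obtain s where s: "s \<in> {0..<1}" "\<And>r. r \<in> {0..<1} \<Longrightarrow> norm (u (of_real r * \<zeta>) - u (of_real (s * r) * \<zeta>)) \<le> 1 / (4 * (real m + 1))"
        using H by blast
      have "continuous_on {0..1} (\<lambda>r. u (of_real (s * r) * \<zeta>))"
      proof (rule continuous_on_compose2[OF c])
        show "(\<lambda>r. of_real (s * r) * \<zeta>) ` {0..1} \<subseteq> ball 0 1"
        proof (rule image_subsetI)
          fix r :: real assume r: "r \<in> {0..1}"
          then have "0 \<le> s * r" "s * r \<le> s * 1" using s by (auto intro!: mult_left_mono simp del: mult_1_right)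
          then show "of_real (s * r) * \<zeta> \<in> ball 0 1" using s \<zeta> by (simp add: norm_mult del: of_real_mult)
        qed
      qed (intro continuous_intros)
      then have "((\<lambda>r. u (of_real (s * r) * \<zeta>)) \<longlongrightarrow> u (of_real (s * 1) * \<zeta>)) (at_left 1)"
        by (rule continuous_on_Icc_at_leftD) simp
      then obtain k :: nat where k: "\<forall>r\<in>{1 - 1/(real k+2)<..<1}. \<forall>r'\<in>{1 - 1/(real k+2)<..<1}.
          norm (u (of_real (s * r) * \<zeta>) - u (of_real (s * r') * \<zeta>)) \<le> 1 / (real (2 * m + 1) + 1)"
        using at_left_one_limit_iff_Cauchy[of "\<lambda>r. u (of_real (s * r) * \<zeta>)"] by blast
      show "\<exists>k::nat. \<forall>r\<in>{1 - 1/(real k+2)<..<1}. \<forall>r'\<in>{1 - 1/(real k+2)<..<1}.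
          norm (u (of_real r * \<zeta>) - u (of_real r' * \<zeta>)) \<le> 1 / (real m+1)"
      proof (intro exI[of _ k] ballI)
        fix r r' assume rr: "r \<in> {1 - 1/(real k+2)<..<1}" "r' \<in> {1 - 1/(real k+2)<..<1}"
        have "0 \<le> 1 - 1/(real k+2)" by (simp add: field_simps)
        then have r01: "r \<in> {0..<1}" "r' \<in> {0..<1}" using rr unfolding greaterThanLessThan_iff atLeastLessThan_iff by linarith+
        have "norm (u (of_real r * \<zeta>) - u (of_real r' * \<zeta>))
          \<le> norm (u (of_real r * \<zeta>) - u (of_real (s * r) * \<zeta>)) + norm (u (of_real (s * r) * \<zeta>) - u (of_real (s * r') * \<zeta>))
            + norm (u (of_real (s * r') * \<zeta>) - u (of_real r' * \<zeta>))"
          by norm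
        also have "\<dots> \<le> 1 / (4 * (real m + 1)) + 1 / (real (2 * m + 1) + 1) + 1 / (4 * (real m + 1))"
          using s(2)[OF r01(1)] s(2)[OF r01(2)] k rr by (intro add_mono) (auto simp: norm_minus_commute)
        also have "\<dots> = 1 / (real m+1)"
        proof -
          have "1 / (4 * x) + 1 / (2 * x) + 1 / (4 * x) = 1 / x" if "x > 0" for x :: real
            using that by (simp add: field_simps)
          from this[of "real m + 1"] show ?thesis by (simp add: algebra_simps)
        qed
        finally show "norm (u (of_real r * \<zeta>) - u (of_real r' * \<zeta>)) \<le> 1 / (real m+1)" .
      qed
    qed
  qed
qed

lemma fatou_circle_mean:
  fixes W :: "complex \<Rightarrow> 'a::euclidean_space"
  assumes p: "0 < p" and Wm: "W \<in> borel_measurable circle_measure" and wc: "\<And>n. continuous_on (sphere 0 1) (w n)"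
    and wl: "AE \<zeta> in circle_measure. (\<lambda>n. w n \<zeta>) \<longlonglongrightarrow> W \<zeta>"
    and wb: "\<And>n. (LINT \<zeta>|circle_measure. norm (w n \<zeta>) powr p) \<le> \<epsilon>"
  shows "integrable circle_measure (\<lambda>\<zeta>. norm (W \<zeta>) powr p) \<and> (LINT \<zeta>|circle_measure. norm (W \<zeta>) powr p) \<le> \<epsilon>"
proof -
  have inp: "integrable circle_measure (\<lambda>\<zeta>. norm (w n \<zeta>) powr p)" for n
    using p by (intro integrable_circle_continuous continuous_on_norm_powr wc) auto
  have "(\<integral>\<^sup>+\<zeta>. ennreal (norm (W \<zeta>) powr p) \<partial>circle_measure) = (\<integral>\<^sup>+\<zeta>. liminf (\<lambda>n. ennreal (norm (w n \<zeta>) powr p)) \<partial>circle_measure)"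
  proof (rule nn_integral_cong_AE, rule AE_mp[OF wl], intro AE_I2 impI)
    fix \<zeta> assume "(\<lambda>n. w n \<zeta>) \<longlonglongrightarrow> W \<zeta>"
    then have "(\<lambda>n. norm (w n \<zeta>) powr p) \<longlonglongrightarrow> norm (W \<zeta>) powr p"
      using p by (intro tendsto_powr' tendsto_intros) auto
    then have "(\<lambda>n. ennreal (norm (w n \<zeta>) powr p)) \<longlonglongrightarrow> ennreal (norm (W \<zeta>) powr p)" by simp
    from lim_imp_Liminf[OF _ this] show "ennreal (norm (W \<zeta>) powr p) = liminf (\<lambda>n. ennreal (norm (w n \<zeta>) powr p))" by simp
  qed
  also have "\<dots> \<le> liminf (\<lambda>n. \<integral>\<^sup>+\<zeta>. ennreal (norm (w n \<zeta>) powr p) \<partial>circle_measure)"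
    using inp by (intro nn_integral_liminf) auto
  also have "\<dots> \<le> limsup (\<lambda>n. \<integral>\<^sup>+\<zeta>. ennreal (norm (w n \<zeta>) powr p) \<partial>circle_measure)"
    by (rule Liminf_le_Limsup) simp
  also have "\<dots> \<le> ennreal \<epsilon>"
  proof (rule Limsup_bounded, rule always_eventually, rule allI)
    fix n
    have "(\<integral>\<^sup>+\<zeta>. ennreal (norm (w n \<zeta>) powr p) \<partial>circle_measure) = ennreal (LINT \<zeta>|circle_measure. norm (w n \<zeta>) powr p)"
      by (intro nn_integral_eq_integral inp) auto
    then show "(\<integral>\<^sup>+\<zeta>. ennreal (norm (w n \<zeta>) powr p) \<partial>circle_measure) \<le> ennreal \<epsilon>"
      using wb[of n] by (simp add: ennreal_leI)
  qed
  finally have le: "(\<integral>\<^sup>+\<zeta>. ennreal (norm (W \<zeta>) powr p) \<partial>circle_measure) \<le> ennreal \<epsilon>" .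
  have "0 \<le> (LINT \<zeta>|circle_measure. norm (w 0 \<zeta>) powr p)" by (intro integral_nonneg_AE) auto
  then have \<epsilon>: "0 \<le> \<epsilon>" using wb[of 0] by linarith
  have int: "integrable circle_measure (\<lambda>\<zeta>. norm (W \<zeta>) powr p)"
  proof (rule integrableI_bounded)
    show "(\<lambda>\<zeta>. norm (W \<zeta>) powr p) \<in> borel_measurable circle_measure" using Wm by measurable
    show "(\<integral>\<^sup>+\<zeta>. ennreal (norm (norm (W \<zeta>) powr p)) \<partial>circle_measure) < \<infinity>"
      using le by (simp add: le_less_trans)
  qed
  have "ennreal (LINT \<zeta>|circle_measure. norm (W \<zeta>) powr p) \<le> ennreal \<epsilon>"
    using le nn_integral_eq_integral[OF int] by simp
  then show ?thesis using int \<epsilon> by (simp add: ennreal_le_iff)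
qed

text \<open>By Fatou's lemma the distance in mean between \<open>U\<close> and \<open>u\<close> on the circle of radius \<open>s\<close> is
  at most the bound for the dilations, hence small for \<open>s\<close> near \<open>1\<close>; and the means increase with the radius.\<close>

lemma poisson_harmonic_mean_le_boundary:
  fixes u :: "complex \<Rightarrow> 'a::euclidean_space"
  assumes u: "poisson_harmonic u" and p: "1 < p"
    and bdd: "\<And>r. 0 \<le> r \<Longrightarrow> r < 1 \<Longrightarrow> (LINT \<zeta>|circle_measure. norm (u (of_real r * \<zeta>)) powr p) \<le> B"
    and U: "U \<in> borel_measurable circle_measure"
    and lim: "AE \<zeta> in circle_measure. ((\<lambda>r. u (of_real r * \<zeta>)) \<longlongrightarrow> U \<zeta>) (at_left 1)"
    and r: "0 \<le> r" "r < 1"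
  shows "(LINT \<zeta>|circle_measure. norm (u (of_real r * \<zeta>)) powr p) \<le> (LINT \<zeta>|circle_measure. norm (U \<zeta>) powr p)"
proof -
  have c: "continuous_on (ball 0 1) u" using u by (simp add: poisson_harmonic_def)
  define \<rho> where "\<rho> = (\<lambda>n::nat. 1 - 1 / (real n + 2))"
  have \<rho>: "0 \<le> \<rho> n" "\<rho> n < 1" for n by (auto simp: \<rho>_def field_simps)
  have \<rho>lim: "filterlim \<rho> (at_left 1) sequentially"
    unfolding \<rho>_def by (rule filterlim_one_minus_inverse)
  have cu: "continuous_on (sphere 0 1) (\<lambda>\<zeta>. u (of_real r * \<zeta>))" if "0 \<le> r" "r < 1" for r
    by (rule continuous_on_circle_dilation[OF c that])
  have um: "(\<lambda>\<zeta>. u (of_real r * \<zeta>)) \<in> borel_measurable circle_measure" if "0 \<le> r" "r < 1" for r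
    by (intro borel_measurable_circle_continuous cu that)
  have inp: "integrable circle_measure (\<lambda>\<zeta>. norm (w \<zeta>) powr p)" if "continuous_on (sphere 0 1) w" for w :: "complex \<Rightarrow> 'a"
    using p by (intro integrable_circle_continuous continuous_on_norm_powr that) auto
  have sr: "0 \<le> s * r" "s * r < 1" if "0 \<le> s" "s < 1" "0 \<le> r" "r < 1" for s r :: real
    using that mult_strict_mono[of s 1 r 1] by (cases "r = 0"; auto)+
  have limn: "AE \<zeta> in circle_measure. (\<lambda>n. u (of_real (\<rho> n) * \<zeta>)) \<longlonglongrightarrow> U \<zeta>"
    using lim by eventually_elim (rule filterlim_compose[OF _ \<rho>lim])
  have intU: "integrable circle_measure (\<lambda>\<zeta>. norm (U \<zeta>) powr p)"
    using fatou_circle_mean[of p U "\<lambda>n \<zeta>. u (of_real (\<rho> n) * \<zeta>)" B] p U cu \<rho> limn bdd by auto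
  define I where "I = (LINT \<zeta>|circle_measure. norm (U \<zeta>) powr p)"
  have I0: "0 \<le> I" unfolding I_def by (intro integral_nonneg_AE) auto
  define m where "m = (LINT \<zeta>|circle_measure. norm (u (of_real r * \<zeta>)) powr p)"
  have step: "m \<le> (1 - t) powr (1 - p) * I + t powr (1 - p) * \<epsilon>" if t: "0 < t" "t < 1" and \<epsilon>: "\<epsilon> > 0" for t \<epsilon>
  proof -
    obtain s0 where s0: "s0 < 1" "\<And>s r. s0 < s \<Longrightarrow> s < 1 \<Longrightarrow> 0 \<le> s \<Longrightarrow> r \<in> {0..<1} \<Longrightarrow>
        (LINT \<zeta>|circle_measure. norm (u (of_real r * \<zeta>) - u (of_real (s * r) * \<zeta>)) powr p) \<le> \<epsilon>"
      using dilations_converge_in_mean[OF u p bdd \<epsilon>] by (auto simp: Ball_def)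
    define s where "s = max r ((s0 + 1) / 2)"
    have s: "r \<le> s" "s < 1" "s0 < s" "0 \<le> s" using s0(1) r by (auto simp: s_def max_def)
    have "integrable circle_measure (\<lambda>\<zeta>. norm (U \<zeta> - u (of_real s * \<zeta>)) powr p) \<and>
      (LINT \<zeta>|circle_measure. norm (U \<zeta> - u (of_real s * \<zeta>)) powr p) \<le> \<epsilon>"
    proof (rule fatou_circle_mean)
      show "0 < p" using p by simp
      show "(\<lambda>\<zeta>. U \<zeta> - u (of_real s * \<zeta>)) \<in> borel_measurable circle_measure"
        using U um[OF s(4,2)] by measurable
      show "continuous_on (sphere 0 1) (\<lambda>\<zeta>. u (of_real (\<rho> n) * \<zeta>) - u (of_real (s * \<rho> n) * \<zeta>))" for n
        using \<rho>[of n] sr[of s "\<rho> n"] s by (intro continuous_on_diff cu) auto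
      show "(LINT \<zeta>|circle_measure. norm (u (of_real (\<rho> n) * \<zeta>) - u (of_real (s * \<rho> n) * \<zeta>)) powr p) \<le> \<epsilon>" for n
        using s0(2)[OF s(3,2,4)] \<rho>[of n] by auto
      show "AE \<zeta> in circle_measure. (\<lambda>n. u (of_real (\<rho> n) * \<zeta>) - u (of_real (s * \<rho> n) * \<zeta>)) \<longlonglongrightarrow> U \<zeta> - u (of_real s * \<zeta>)"
        using limn AE_space
      proof eventually_elim
        case (elim \<zeta>)
        have "isCont u (of_real s * \<zeta>)"
          using c s elim(2) by (intro continuous_on_interior[of "ball 0 1"]) (auto simp: norm_mult interior_open)
        moreover have "\<rho> \<longlonglongrightarrow> 1" using \<rho>lim by (simp add: filterlim_at)
        then have "(\<lambda>n. of_real (s * \<rho> n) * \<zeta>) \<longlonglongrightarrow> of_real (s * 1) * \<zeta>"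
          by (intro tendsto_intros)
        ultimately have "(\<lambda>n. u (of_real (s * \<rho> n) * \<zeta>)) \<longlonglongrightarrow> u (of_real s * \<zeta>)"
          by (intro isCont_tendsto_compose[of _ u]) auto
        with elim(1) show ?case by (intro tendsto_diff)
      qed
    qed
    then have A: "integrable circle_measure (\<lambda>\<zeta>. norm (u (of_real s * \<zeta>) - U \<zeta>) powr p)"
      "(LINT \<zeta>|circle_measure. norm (u (of_real s * \<zeta>) - U \<zeta>) powr p) \<le> \<epsilon>"
      by (simp_all add: norm_minus_commute)
    have "m \<le> (LINT \<zeta>|circle_measure. norm (u (of_real s * \<zeta>)) powr p)"
      unfolding m_def using p r s
      by (intro poisson_subharmonic_mean_mono[OF poisson_subharmonic_norm_powr[OF u]]) auto
    also have "\<dots> \<le> (LINT \<zeta>|circle_measure. (1 - t) powr (1 - p) * norm (U \<zeta>) powr p + t powr (1 - p) * norm (u (of_real s * \<zeta>) - U \<zeta>) powr p)"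
    proof (rule integral_mono)
      show "integrable circle_measure (\<lambda>\<zeta>. norm (u (of_real s * \<zeta>)) powr p)" using s by (intro inp cu) auto
      show "integrable circle_measure (\<lambda>\<zeta>. (1 - t) powr (1 - p) * norm (U \<zeta>) powr p + t powr (1 - p) * norm (u (of_real s * \<zeta>) - U \<zeta>) powr p)"
        using intU A by auto
      fix \<zeta>
      show "norm (u (of_real s * \<zeta>)) powr p \<le> (1 - t) powr (1 - p) * norm (U \<zeta>) powr p + t powr (1 - p) * norm (u (of_real s * \<zeta>) - U \<zeta>) powr p"
        using norm_add_powr_le_convex[of p t "U \<zeta>" "u (of_real s * \<zeta>) - U \<zeta>"] p t by simp
    qed
    also have "\<dots> = (1 - t) powr (1 - p) * I + t powr (1 - p) * (LINT \<zeta>|circle_measure. norm (u (of_real s * \<zeta>) - U \<zeta>) powr p)"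
      using intU A(1) by (simp add: I_def)
    also have "\<dots> \<le> (1 - t) powr (1 - p) * I + t powr (1 - p) * \<epsilon>"
      using A(2) by (intro add_left_mono mult_left_mono) auto
    finally show ?thesis .
  qed
  have step2: "m \<le> (1 - t) powr (1 - p) * I" if t: "0 < t" "t < 1" for t
  proof (rule field_le_epsilon)
    fix e :: real assume e: "0 < e"
    have "t powr (1 - p) > 0" using t by simp
    then show "m \<le> (1 - t) powr (1 - p) * I + e"
      using step[OF t, of "e / t powr (1 - p)"] e by simp
  qed
  have "m \<le> (1 - 0) powr (1 - p) * I"
  proof (rule tendsto_lowerbound)
    show "((\<lambda>t. (1 - t) powr (1 - p) * I) \<longlongrightarrow> (1 - 0) powr (1 - p) * I) (at_right 0)"
      by (intro tendsto_intros) auto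
    show "\<forall>\<^sub>F t in at_right 0. m \<le> (1 - t) powr (1 - p) * I"
      unfolding eventually_at_right_field using step2 by (intro exI[of _ 1]) auto
  qed simp
  then show ?thesis by (simp add: m_def I_def)
qed

text \<open>The value of \<open>Lim\<close> is the same at all points without a limit, so it suffices that the set
  of convergence is measurable. It is, because the Cauchy condition is an intersection of closed
  conditions on the point \<open>\<zeta>\<close>, even over uncountably many radii.\<close>

lemma measurable_radial_limit:
  assumes c: "continuous_on (ball 0 1) g"
  shows "radial_limit g \<in> borel_measurable circle_measure"
proof -
  define A where "A = {\<zeta>\<in>sphere 0 1. \<exists>l. ((\<lambda>r. g (of_real r * \<zeta>)) \<longlongrightarrow> l) (at_left 1)}"
  have k2: "0 \<le> 1 - 1 / (real k + 2)" for k :: nat by (simp add: field_simps)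
  define Q where "Q = (\<lambda>m k. {\<zeta>\<in>sphere 0 1. \<forall>r\<in>{1 - 1/(real k+2)<..<1}. \<forall>r'\<in>{1 - 1/(real k+2)<..<1}.
      norm (g (of_real r * \<zeta>) - g (of_real r' * \<zeta>)) \<le> 1 / (real m+1)})"
  have Q: "Q m k \<in> sets circle_measure" for m k :: nat
  proof -
    have "closed (Q m k)"
    proof -
      have "Q m k = (\<Inter>r\<in>{1 - 1/(real k+2)<..<1}. \<Inter>r'\<in>{1 - 1/(real k+2)<..<1}.
         {\<zeta>\<in>sphere 0 1. norm (g (of_real r * \<zeta>) - g (of_real r' * \<zeta>)) \<le> 1 / (real m+1)})"
        (is "_ = (\<Inter>r\<in>?I. \<Inter>r'\<in>?I. ?S r r')")
      proof -
        have "(1 - 1/(real k+2) + 1) / 2 \<in> ?I" by (simp add: field_simps)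
        then have "?I \<noteq> {}" by blast
        then show ?thesis unfolding Q_def by blast
      qed
      moreover have "closed (?S r r')" if "r \<in> ?I" "r' \<in> ?I" for r r'
      proof -
        have "0 \<le> r" "r < 1" "0 \<le> r'" "r' < 1" using that k2[of k] unfolding greaterThanLessThan_iff by linarith+
        then have "continuous_on (sphere 0 1) (\<lambda>\<zeta>. norm (g (of_real r * \<zeta>) - g (of_real r' * \<zeta>)))"
          by (intro continuous_on_norm continuous_on_diff continuous_on_circle_dilation[OF c])
        then show ?thesis
          by (intro continuous_on_closed_Collect_le continuous_on_const) auto
      qed
      ultimately show ?thesis by (auto intro!: closed_INT)
    qed
    then have "Q m k \<inter> sphere 0 1 \<in> sets circle_measure" by (intro sets_circle_Int) auto
    moreover have "Q m k \<inter> sphere 0 1 = Q m k" by (auto simp: Q_def)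
    ultimately show ?thesis by simp
  qed
  have "A = sphere 0 1 \<inter> (\<Inter>m. \<Union>k. Q m k)"
    unfolding A_def at_left_one_limit_iff_Cauchy Q_def by auto
  moreover have "sphere 0 1 \<in> sets circle_measure" using sets.top[of circle_measure] by simp
  ultimately have A: "A \<in> sets circle_measure" using Q by auto
  define c0 where "c0 = (THE l::complex. False)"
  define \<rho> where "\<rho> = (\<lambda>n::nat. 1 - 1 / (real n + 2))"
  have \<rho>: "0 \<le> \<rho> n" "\<rho> n < 1" for n by (auto simp: \<rho>_def field_simps)
  have \<rho>lim: "filterlim \<rho> (at_left 1) sequentially"
    unfolding \<rho>_def by (rule filterlim_one_minus_inverse)
  define f where "f = (\<lambda>n \<zeta>. if \<zeta> \<in> A then g (of_real (\<rho> n) * \<zeta>) else c0)"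
  show ?thesis
  proof (rule borel_measurable_LIMSEQ_metric[where f = f])
    fix n
    have "(\<lambda>\<zeta>. g (of_real (\<rho> n) * \<zeta>)) \<in> borel_measurable circle_measure"
      using \<rho> by (intro borel_measurable_circle_continuous continuous_on_circle_dilation[OF c])
    then show "f n \<in> borel_measurable circle_measure" unfolding f_def using A by measurable
  next
    fix \<zeta> assume \<zeta>: "\<zeta> \<in> space circle_measure"
    show "(\<lambda>n. f n \<zeta>) \<longlonglongrightarrow> radial_limit g \<zeta>"
    proof (cases "\<zeta> \<in> A")
      case True
      then obtain l where l: "((\<lambda>r. g (of_real r * \<zeta>)) \<longlongrightarrow> l) (at_left 1)" by (auto simp: A_def)
      then have "radial_limit g \<zeta> = l" unfolding radial_limit_def by (intro tendsto_Lim) auto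
      moreover have "(\<lambda>n. g (of_real (\<rho> n) * \<zeta>)) \<longlonglongrightarrow> l" by (rule filterlim_compose[OF l \<rho>lim])
      ultimately show ?thesis using True by (simp add: f_def)
    next
      case False
      then have "\<not> ((\<lambda>r. g (of_real r * \<zeta>)) \<longlongrightarrow> l) (at_left 1)" for l using \<zeta> by (auto simp: A_def)
      then have "radial_limit g \<zeta> = c0" by (simp add: radial_limit_def t2_space_class.Lim_def c0_def)
      then show ?thesis using False by (simp add: f_def)
    qed
  qed
qed

lemma radial_limit_eqI: "((\<lambda>r. g (of_real r * \<zeta>)) \<longlongrightarrow> l) (at_left 1) \<Longrightarrow> radial_limit g \<zeta> = l"
  unfolding radial_limit_def by (intro tendsto_Lim) auto

lemma pair_mean_le_boundary:
  assumes g: "g holomorphic_on ball 0 1" and h: "h holomorphic_on ball 0 1" and p: "1 < p"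
    and bdd: "\<And>r. 0 \<le> r \<Longrightarrow> r < 1 \<Longrightarrow>
      (LINT \<zeta>|circle_measure. ((cmod (g (of_real r * \<zeta>)))\<^sup>2 + (cmod (h (of_real r * \<zeta>)))\<^sup>2) powr (p/2)) \<le> B"
    and r: "0 \<le> r" "r < 1"
  shows "(LINT \<zeta>|circle_measure. ((cmod (g (of_real r * \<zeta>)))\<^sup>2 + (cmod (h (of_real r * \<zeta>)))\<^sup>2) powr (p/2))
    \<le> (LINT \<zeta>|circle_measure. ((cmod (radial_limit g \<zeta>))\<^sup>2 + (cmod (radial_limit h \<zeta>))\<^sup>2) powr (p/2))"
proof -
  define u where "u = (\<lambda>z. (g z, h z))"
  have eq: "norm (a, b) powr p = ((cmod a)\<^sup>2 + (cmod b)\<^sup>2) powr (p/2)" for a b :: complex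
    by (simp add: norm_Pair powr_half_sqrt[symmetric] powr_powr)
  have u: "poisson_harmonic u" unfolding u_def by (intro poisson_harmonic_Pair poisson_harmonic_holomorphic g h)
  have bu: "(LINT \<zeta>|circle_measure. norm (u (of_real r * \<zeta>)) powr p) \<le> B" if "0 \<le> r" "r < 1" for r
    using bdd[OF that] by (simp add: u_def eq)
  define U where "U = (\<lambda>\<zeta>. (radial_limit g \<zeta>, radial_limit h \<zeta>))"
  have U: "U \<in> borel_measurable circle_measure" unfolding U_def
    using measurable_radial_limit[OF holomorphic_on_imp_continuous_on[OF g]]
      measurable_radial_limit[OF holomorphic_on_imp_continuous_on[OF h]] by (intro borel_measurable_Pair)
  have lim: "AE \<zeta> in circle_measure. ((\<lambda>r. u (of_real r * \<zeta>)) \<longlongrightarrow> U \<zeta>) (at_left 1)"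
  proof -
    have "AE \<zeta> in circle_measure. \<exists>l. ((\<lambda>r. u (of_real r * \<zeta>)) \<longlongrightarrow> l) (at_left 1)"
      by (rule poisson_harmonic_radial_limits_AE[OF u p bu])
    then show ?thesis
  proof eventually_elim
    case (elim \<zeta>)
    then obtain l where l: "((\<lambda>r. u (of_real r * \<zeta>)) \<longlongrightarrow> l) (at_left 1)" by blast
    have "((\<lambda>r. g (of_real r * \<zeta>)) \<longlongrightarrow> fst l) (at_left 1)" "((\<lambda>r. h (of_real r * \<zeta>)) \<longlongrightarrow> snd l) (at_left 1)"
      using tendsto_fst[OF l] tendsto_snd[OF l] by (simp_all add: u_def)
    then have "U \<zeta> = l" unfolding U_def by (simp add: radial_limit_eqI)
    with l show ?case by simp
  qed
  qed
  from poisson_harmonic_mean_le_boundary[OF u p bu U lim r] show ?thesis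
    by (simp add: u_def U_def eq)
qed

section \<open>The sub-mean-value inequality\<close>

lemma holomorphic_circle_mean_value:
  assumes F: "F holomorphic_on ball z0 R" and \<rho>: "0 < \<rho>" "\<rho> < R"
  shows "F z0 = (LINT \<eta>|circle_measure. F (z0 + of_real \<rho> * \<eta>))"
proof -
  have img: "z0 + of_real \<rho> * z \<in> ball z0 R" if "cmod z \<le> 1" for z
  proof -
    have "\<rho> * cmod z \<le> \<rho> * 1" using that \<rho> by (intro mult_left_mono) auto
    then have "\<rho> * cmod z < R" using \<rho> by linarith
    then show ?thesis using \<rho> by (simp add: dist_norm norm_mult)
  qed
  have G: "(\<lambda>z. F (z0 + of_real \<rho> * z)) holomorphic_on cball 0 1"
  proof -
    have "(F \<circ> (\<lambda>z. z0 + of_real \<rho> * z)) holomorphic_on cball 0 1"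
      by (rule holomorphic_on_compose_gen[OF _ F]) (use img in \<open>auto intro!: holomorphic_intros\<close>)
    then show ?thesis by (simp add: o_def)
  qed
  have "F (z0 + of_real \<rho> * 0) = (LINT \<eta>|circle_measure. poisson_kernel 0 \<eta> *\<^sub>R F (z0 + of_real \<rho> * \<eta>))"
    using G by (intro poisson_formula_holomorphic)
      (auto intro: holomorphic_on_subset holomorphic_on_imp_continuous_on)
  also have "\<dots> = (LINT \<eta>|circle_measure. F (z0 + of_real \<rho> * \<eta>))"
    by (intro Bochner_Integration.integral_cong) (auto simp: poisson_kernel_def)
  finally show ?thesis by simp
qed

text \<open>Real trigonometric polynomials, up to changes off the circle: on the circle these are the
  real parts of polynomials.\<close>

inductive trig_polynomial :: "(complex \<Rightarrow> real) \<Rightarrow> bool" where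
  monomial: "(\<And>z. cmod z = 1 \<Longrightarrow> f z = Re (a * z ^ n)) \<Longrightarrow> trig_polynomial f"
| sum: "trig_polynomial g \<Longrightarrow> trig_polynomial h \<Longrightarrow> (\<And>z. cmod z = 1 \<Longrightarrow> f z = g z + h z) \<Longrightarrow> trig_polynomial f"

lemma trig_polynomial_eq_Re_entire:
  "trig_polynomial f \<Longrightarrow> \<exists>H. H holomorphic_on UNIV \<and> (\<forall>z\<in>sphere 0 1. f z = Re (H z))"
proof (induction rule: trig_polynomial.induct)
  case (monomial f a n)
  then show ?case by (intro exI[of _ "\<lambda>z. a * z ^ n"]) (auto intro!: holomorphic_intros)
next
  case (sum g h f)
  then obtain G H where "G holomorphic_on UNIV" "\<forall>z\<in>sphere 0 1. g z = Re (G z)"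
    "H holomorphic_on UNIV" "\<forall>z\<in>sphere 0 1. h z = Re (H z)" by blast
  then show ?case using sum.hyps by (intro exI[of _ "\<lambda>z. G z + H z"]) (auto intro!: holomorphic_intros)
qed

lemma trig_polynomial_mult_monomial:
  fixes a b :: complex
  shows "trig_polynomial (\<lambda>z. Re (a * z ^ n) * Re (b * z ^ m))"
proof -
  have prod: "Re x * Re y = Re (x * y / 2) + Re (x * cnj y / 2)" for x y
    by (simp add: field_simps)
  have *: "trig_polynomial (\<lambda>z. Re (a * z ^ n) * Re (b * z ^ m))" if "m \<le> n" for a b :: complex and m n
  proof (rule trig_polynomial.sum)
    show "trig_polynomial (\<lambda>z. Re (a * b / 2 * z ^ (n + m)))" "trig_polynomial (\<lambda>z. Re (a * cnj b / 2 * z ^ (n - m)))"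
      by (rule trig_polynomial.monomial, rule refl)+
    fix z :: complex assume z: "cmod z = 1"
    have zz: "z * cnj z = 1" using complex_norm_square[of z] z by simp
    have "z ^ n * cnj z ^ m = z ^ (n - m) * (z * cnj z) ^ m"
      using that by (simp add: power_mult_distrib mult.assoc[symmetric] flip: power_add)
    also have "\<dots> = z ^ (n - m)" using zz by simp
    finally have "a * cnj b / 2 * (z ^ n * cnj z ^ m) = a * cnj b / 2 * z ^ (n - m)" by (rule arg_cong)
    moreover have "a * z ^ n * cnj (b * z ^ m) / 2 = a * cnj b / 2 * (z ^ n * cnj z ^ m)" by (simp add: mult_ac)
    ultimately have e2: "a * z ^ n * cnj (b * z ^ m) / 2 = a * cnj b / 2 * z ^ (n - m)" by simp
    have e1: "a * z ^ n * (b * z ^ m) / 2 = a * b / 2 * z ^ (n + m)" by (simp add: power_add mult_ac)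
    show "Re (a * z ^ n) * Re (b * z ^ m) = Re (a * b / 2 * z ^ (n + m)) + Re (a * cnj b / 2 * z ^ (n - m))"
      by (simp only: prod[of "a * z ^ n"] e1 e2)
  qed
  show ?thesis
  proof (cases "m \<le> n")
    case False
    then have "trig_polynomial (\<lambda>z. Re (b * z ^ m) * Re (a * z ^ n))" by (intro *) auto
    then show ?thesis by (simp only: mult.commute)
  qed (rule *)
qed

lemma trig_polynomial_cong:
  assumes "trig_polynomial f" "\<And>z. cmod z = 1 \<Longrightarrow> g z = f z"
  shows "trig_polynomial g"
proof (rule trig_polynomial.sum[OF assms(1)])
  show "trig_polynomial (\<lambda>z. 0)" by (rule trig_polynomial.monomial[of _ 0 0]) simp
qed (use assms in simp)

lemma trig_polynomial_mult:
  assumes "trig_polynomial f" "trig_polynomial g"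
  shows "trig_polynomial (\<lambda>z. f z * g z)"
  using assms(1)
proof (induction rule: trig_polynomial.induct)
  case (monomial f a n)
  have "trig_polynomial (\<lambda>z. Re (a * z ^ n) * g z)" using assms(2)
  proof (induction rule: trig_polynomial.induct)
    case (monomial g b m)
    show ?case by (rule trig_polynomial_cong[OF trig_polynomial_mult_monomial[of a n b m]]) (simp add: monomial)
  next
    case (sum g1 g2 g)
    show ?case by (rule trig_polynomial.sum[OF sum.IH]) (simp add: sum.hyps algebra_simps)
  qed
  then show ?case by (rule trig_polynomial_cong) (simp add: monomial)
next
  case (sum f1 f2 f)
  show ?case by (rule trig_polynomial.sum[OF sum.IH]) (simp add: sum.hyps algebra_simps)
qed

text \<open>The real parts of polynomials form an algebra on the circle, since
  \<open>cnj z = 1 / z\<close> there, so the Stone--Weierstrass theorem applies. It takes the place of the solution of the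
  Dirichlet problem.\<close>

lemma circle_continuous_approx_Re_entire:
  fixes v :: "complex \<Rightarrow> real"
  assumes "continuous_on (sphere 0 1) v" "0 < \<epsilon>"
  shows "\<exists>H. H holomorphic_on UNIV \<and> (\<forall>z\<in>sphere 0 1. \<bar>v z - Re (H z)\<bar> < \<epsilon>)"
proof -
  interpret function_ring_on "{f. trig_polynomial f}" "sphere (0::complex) 1"
  proof
    show "compact (sphere (0::complex) 1)" by simp
    fix f assume "f \<in> {f. trig_polynomial f}"
    then obtain H where H: "H holomorphic_on UNIV" "\<forall>z\<in>sphere 0 1. f z = Re (H z)"
      using trig_polynomial_eq_Re_entire by blast
    have "continuous_on (sphere 0 1) (\<lambda>z. Re (H z))"
      using holomorphic_on_imp_continuous_on[OF H(1)] by (intro continuous_intros) (auto elim: continuous_on_subset)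
    then show "continuous_on (sphere 0 1) f" using H(2) by (subst continuous_on_cong[OF refl, where g = "\<lambda>z. Re (H z)"]) auto
  next
    fix f g assume "f \<in> {f. trig_polynomial f}" "g \<in> {f. trig_polynomial f}"
    then show "(\<lambda>z. f z + g z) \<in> {f. trig_polynomial f}" "(\<lambda>z. f z * g z) \<in> {f. trig_polynomial f}"
      by (auto intro: trig_polynomial_mult trig_polynomial.sum)
  next
    fix c :: real
    show "(\<lambda>_. c) \<in> {f. trig_polynomial f}" by (auto intro!: trig_polynomial.monomial[of _ "of_real c" 0])
  next
    fix x y :: complex assume "x \<noteq> y"
    moreover have "trig_polynomial Re" "trig_polynomial Im"
      by (auto intro: trig_polynomial.monomial[of _ 1 1] trig_polynomial.monomial[of _ "-\<i>" 1])
    ultimately show "\<exists>f\<in>{f. trig_polynomial f}. f x \<noteq> f y" by (auto simp: complex_eq_iff)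
  qed
  obtain g where "trig_polynomial g" "\<forall>z\<in>sphere 0 1. \<bar>v z - g z\<bar> < \<epsilon>"
    using Stone_Weierstrass_basic[OF assms] by auto
  then show ?thesis using trig_polynomial_eq_Re_entire[of g] by force
qed

text \<open>A harmonic function touches \<open>\<Psi>\<close> from below at the point: a form of subharmonicity that needs no
  derivatives and is preserved by composition with holomorphic functions.\<close>

definition supported_by_Re_holomorphic :: "(complex \<Rightarrow> real) \<Rightarrow> complex \<Rightarrow> bool" where
  "supported_by_Re_holomorphic \<Psi> \<zeta>0 \<longleftrightarrow> (\<exists>b e. 0 < e \<and> b holomorphic_on ball \<zeta>0 e \<and> Re (b \<zeta>0) = \<Psi> \<zeta>0 \<and>
     (\<forall>\<zeta>\<in>ball \<zeta>0 e. Re (b \<zeta>) \<le> \<Psi> \<zeta>))"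

text \<open>The maximum principle for the difference of the two sides, with two perturbations. A multiple of
  \<open>ln |G|\<close> keeps the maximum away from the zeros of \<open>G\<close>, where no supporting function is available,
  and is harmonic elsewhere. A multiple of \<open>|z|\<^sup>2 - 1\<close> makes the function strictly
  subharmonic, which contradicts an interior maximum directly by the mean value property.\<close>

lemma harmonic_majorant_off_zeros:
  assumes G: "G holomorphic_on ball 0 R" "1 < R" and \<Psi>: "continuous_on UNIV \<Psi>"
    and supp: "\<And>\<zeta>. \<zeta> \<noteq> 0 \<Longrightarrow> supported_by_Re_holomorphic \<Psi> \<zeta>"
    and H: "H holomorphic_on UNIV" and maj: "\<And>z. cmod z = 1 \<Longrightarrow> \<Psi> (G z) < Re (H z)"
    and a: "cmod a \<le> 1" "G a \<noteq> 0"
  shows "\<Psi> (G a) \<le> Re (H a)"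
proof (rule ccontr)
  assume "\<not> ?thesis"
  then have D: "0 < \<Psi> (G a) - Re (H a)" by simp
  have cG: "continuous_on (cball 0 1) G"
    using G by (auto intro!: holomorphic_on_imp_continuous_on elim: holomorphic_on_subset)
  have cH: "continuous_on S H" for S using H by (meson holomorphic_on_imp_continuous_on continuous_on_subset subset_UNIV)
  define v where "v = (\<lambda>z. \<Psi> (G z) - Re (H z))"
  have cv: "continuous_on (cball 0 1) v" unfolding v_def
    by (intro continuous_intros cH continuous_on_compose2[OF \<Psi> cG]) auto
  obtain M where M: "M > 0" "\<And>z. cmod z \<le> 1 \<Longrightarrow> cmod (G z) \<le> M"
  proof -
    have "bounded (G ` cball 0 1)" by (intro compact_imp_bounded compact_continuous_image cG) simp
    then show ?thesis using that unfolding bounded_pos by auto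
  qed
  obtain B where B: "\<And>z. cmod z \<le> 1 \<Longrightarrow> \<bar>v z\<bar> \<le> B"
  proof -
    have "bounded (v ` cball 0 1)" by (intro compact_imp_bounded compact_continuous_image cv) simp
    then show ?thesis using that unfolding bounded_pos by fastforce
  qed
  define l where "l = ln (M / cmod (G a))"
  have l0: "0 \<le> l" using M a by (auto simp: l_def intro!: ln_ge_zero)
  define \<kappa> where "\<kappa> = v a / 4"
  define \<delta> where "\<delta> = v a / (4 * (l + 1))"
  have va: "v a > 0" using D by (simp add: v_def)
  have \<kappa>: "\<kappa> > 0" and \<delta>: "\<delta> > 0" using va l0 by (auto simp: \<kappa>_def \<delta>_def)
  have \<delta>l: "\<delta> * l \<le> v a / 4" using va l0 by (simp add: \<delta>_def field_simps)
  define w where "w = (\<lambda>z. v z + \<kappa> * ((cmod z)\<^sup>2 - 1) + \<delta> * ln (cmod (G z) / M))"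
  have wa: "w a > 0"
  proof -
    have "ln (cmod (G a) / M) = - l" using M a by (simp add: l_def ln_div)
    moreover have "- \<kappa> \<le> \<kappa> * ((cmod a)\<^sup>2 - 1)" using \<kappa> by (simp add: algebra_simps)
    ultimately show ?thesis using \<delta>l va unfolding w_def by (simp add: \<kappa>_def)
  qed
  have lnle: "ln (cmod (G z) / M) \<le> 0" if "cmod z \<le> 1" "G z \<noteq> 0" for z
    using M(2)[OF that(1)] M(1) that by (subst ln_le_zero_iff) auto
  have sq: "(cmod z)\<^sup>2 - 1 \<le> 0" if "cmod z \<le> 1" for z using that by (simp add: abs_square_le_1)
  \<comment> \<open>Below this modulus of \<open>G\<close> the logarithm outweighs the bounded part of \<open>w\<close>.\<close>
  define \<tau> where "\<tau> = min (cmod (G a)) (M * exp (- (\<bar>B\<bar> + 1) / \<delta>))"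
  have \<tau>: "\<tau> > 0" "\<tau> \<le> cmod (G a)" using a M by (auto simp: \<tau>_def)
  have small: "w z \<le> 0" if "cmod z \<le> 1" "cmod (G z) \<le> \<tau>" "G z \<noteq> 0" for z
  proof -
    have "cmod (G z) / M \<le> exp (- (\<bar>B\<bar> + 1) / \<delta>)" using that M by (simp add: \<tau>_def field_simps)
    then have "ln (cmod (G z) / M) \<le> ln (exp (- (\<bar>B\<bar> + 1) / \<delta>))" using that M by (subst ln_le_cancel_iff) auto
    then have "ln (cmod (G z) / M) \<le> - (\<bar>B\<bar> + 1) / \<delta>" by simp
    then have "\<delta> * ln (cmod (G z) / M) \<le> - (\<bar>B\<bar> + 1)" using \<delta> by (simp add: field_simps)
    moreover have "v z \<le> \<bar>B\<bar>" using B[OF that(1)] by linarith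
    moreover have "\<kappa> * ((cmod z)\<^sup>2 - 1) \<le> 0" using sq[OF that(1)] \<kappa> by (simp add: mult_le_0_iff)
    ultimately show ?thesis unfolding w_def by linarith
  qed
  have bdry: "w z \<le> 0" if "cmod z = 1" "G z \<noteq> 0" for z
  proof -
    have "\<delta> * ln (cmod (G z) / M) \<le> 0" using lnle[of z] that \<delta> by (simp add: mult_le_0_iff)
    then show ?thesis using maj[OF that(1)] that by (simp add: w_def v_def)
  qed
  define K where "K = cball 0 1 \<inter> {z \<in> cball 0 1. \<tau> \<le> cmod (G z)}"
  have "compact K" unfolding K_def
    by (intro compact_Int_closed compact_cball continuous_on_closed_Collect_le continuous_on_const continuous_on_norm cG) simp
  moreover have "a \<in> K" using a \<tau> by (auto simp: K_def)
  moreover have "continuous_on K w"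
  proof -
    have KS: "K \<subseteq> cball 0 1" by (auto simp: K_def)
    have "continuous_on K v" "continuous_on K G" using cv cG KS continuous_on_subset by blast+
    then show ?thesis unfolding w_def using \<tau> M by (intro continuous_intros) (auto simp: K_def)
  qed
  ultimately obtain z1 where z1: "z1 \<in> K" "\<And>z. z \<in> K \<Longrightarrow> w z \<le> w z1"
    using continuous_attains_sup[of K w] by blast
  have pos: "w z1 > 0" using z1(2)[OF \<open>a \<in> K\<close>] wa by simp
  have z1': "cmod z1 \<le> 1" "G z1 \<noteq> 0" using z1(1) \<tau> by (auto simp: K_def)
  have in1: "cmod z1 < 1" using bdry[of z1] pos z1' by fastforce
  have big: "\<tau> < cmod (G z1)" using small[of z1] pos z1' by fastforce
  obtain b e where b: "0 < e" "b holomorphic_on ball (G z1) e" "Re (b (G z1)) = \<Psi> (G z1)"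
     "\<And>\<zeta>. \<zeta> \<in> ball (G z1) e \<Longrightarrow> Re (b \<zeta>) \<le> \<Psi> \<zeta>"
    using supp[OF z1'(2)] unfolding supported_by_Re_holomorphic_def by blast
  define e' where "e' = min e (cmod (G z1) - \<tau>)"
  have e': "e' > 0" using b big by (simp add: e'_def)
  have "isCont G z1" using cG in1 by (intro continuous_on_interior[of "cball 0 1"]) auto
  then obtain d where d: "d > 0" "\<And>z. dist z z1 < d \<Longrightarrow> dist (G z) (G z1) < e'"
    using e' unfolding continuous_at_eps_delta by blast
  define R1 where "R1 = min d (1 - cmod z1)"
  have R1: "R1 > 0" using d in1 by (simp add: R1_def)
  have near: "cmod z < 1" "G z \<in> ball (G z1) e" "\<tau> < cmod (G z)" "cmod (G z - G z1) < cmod (G z1)" if "z \<in> ball z1 R1" for z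
  proof -
    have "cmod (z - z1) < 1 - cmod z1" using that by (simp add: R1_def dist_norm norm_minus_commute)
    then show "cmod z < 1" using norm_triangle_ineq2[of z z1] by linarith
    have g: "cmod (G z - G z1) < e'" using d(2)[of z] that by (simp add: R1_def dist_norm norm_minus_commute)
    then show "G z \<in> ball (G z1) e" by (simp add: e'_def dist_norm norm_minus_commute)
    show "\<tau> < cmod (G z)" using g norm_triangle_ineq2[of "G z1" "G z"] by (simp add: e'_def norm_minus_commute)
    show "cmod (G z - G z1) < cmod (G z1)" using g \<tau> by (simp add: e'_def)
  qed
  define \<rho> where "\<rho> = R1 / 2"
  have \<rho>: "0 < \<rho>" "\<rho> < R1" using R1 by (auto simp: \<rho>_def)
  define q where "q = (\<lambda>z. 2 * cnj z1 * (z - z1))"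
  have qh: "q holomorphic_on ball z1 R1" unfolding q_def by (intro holomorphic_intros)
  \<comment> \<open>On the circle of radius \<open>\<rho>\<close> about \<open>z1\<close> the real part of \<open>T\<close> lies below \<open>w\<close>: there
\<open>|z|\<^sup>2 = |z1|\<^sup>2 + \<rho>\<^sup>2 + Re (q z)\<close>. At the center it exceeds \<open>w z1\<close> by \<open>\<kappa> * \<rho>\<^sup>2\<close>.\<close>
  define T where "T = (\<lambda>z. b (G z) - H z + of_real \<delta> * (Ln (G z / G z1) + of_real (ln (cmod (G z1) / M)))
      + of_real \<kappa> * (of_real ((cmod z1)\<^sup>2 + \<rho>\<^sup>2 - 1) + q z))"
  have quot: "Re (G z / G z1) > 0" if "z \<in> ball z1 R1" for z
  proof -
    have "G z / G z1 - 1 = (G z - G z1) / G z1" using z1' by (simp add: field_simps)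
    then have "cmod (G z / G z1 - 1) < 1"
      using near(4)[OF that] z1' by (simp add: norm_divide)
    then have "\<bar>Re (G z / G z1 - 1)\<bar> < 1" using abs_Re_le_cmod[of "G z / G z1 - 1"] by linarith
    then show ?thesis by simp
  qed
  have GB: "G holomorphic_on ball z1 R1" using G near(1) by (elim holomorphic_on_subset) force
  have bG: "(\<lambda>z. b (G z)) holomorphic_on ball z1 R1"
    using holomorphic_on_compose_gen[OF GB b(2)] near(2) by (auto simp: o_def image_subset_iff)
  have quot': "G z / G z1 \<notin> \<real>\<^sub>\<le>\<^sub>0" if "z \<in> ball z1 R1" for z
    using quot[OF that] by (auto simp: complex_nonpos_Reals_iff)
  have T: "T holomorphic_on ball z1 R1"
    unfolding T_def using quot' z1' GB bG qh holomorphic_on_subset[OF H subset_UNIV]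
    by (intro holomorphic_intros) auto
  have Tw: "Re (T z) \<le> w z1" if z: "cmod (z - z1) = \<rho>" for z
  proof -
    have zB: "z \<in> ball z1 R1" using z \<rho> by (simp add: dist_norm norm_minus_commute)
    have "(cmod z)\<^sup>2 = (cmod z1)\<^sup>2 + \<rho>\<^sup>2 + Re (q z)"
    proof -
      have "(cmod z)\<^sup>2 = (cmod z1)\<^sup>2 + (cmod (z - z1))\<^sup>2 + 2 * Re (cnj z1 * (z - z1))"
        unfolding cmod_power2 by (simp add: power2_eq_square algebra_simps)
      then show ?thesis using z by (simp add: q_def mult.assoc)
    qed
    moreover have "Re (Ln (G z / G z1)) + ln (cmod (G z1) / M) = ln (cmod (G z) / M)"
    proof -
      have "G z \<noteq> 0" using near(3)[OF zB] \<tau> by auto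
      then show ?thesis using z1' M by (simp add: norm_divide ln_div)
    qed
    moreover have "Re (T z) = Re (b (G z)) - Re (H z) + \<delta> * (Re (Ln (G z / G z1)) + ln (cmod (G z1) / M))
        + \<kappa> * ((cmod z1)\<^sup>2 + \<rho>\<^sup>2 - 1 + Re (q z))"
      by (simp add: T_def)
    ultimately have "Re (T z) = Re (b (G z)) - Re (H z) + \<delta> * ln (cmod (G z) / M) + \<kappa> * ((cmod z)\<^sup>2 - 1)"
      by simp
    also have "\<dots> \<le> w z" using b(4)[OF near(2)[OF zB]] by (simp add: w_def v_def)
    also have "\<dots> \<le> w z1" using near[OF zB] by (intro z1) (auto simp: K_def)
    finally show ?thesis .
  qed
  have "w z1 < w z1 + \<kappa> * \<rho>\<^sup>2" using \<kappa> \<rho> by simp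
  also have "\<dots> = Re (T z1)" using b(3) z1' by (simp add: T_def q_def w_def v_def algebra_simps)
  also have "T z1 = (LINT \<eta>|circle_measure. T (z1 + of_real \<rho> * \<eta>))"
    by (rule holomorphic_circle_mean_value[OF T \<rho>])
  also have "Re \<dots> = (LINT \<eta>|circle_measure. Re (T (z1 + of_real \<rho> * \<eta>)))"
  proof (rule integral_bounded_linear[OF bounded_linear_Re, symmetric])
    show "integrable circle_measure (\<lambda>\<eta>. T (z1 + of_real \<rho> * \<eta>))"
      by (intro integrable_circle_continuous continuous_on_compose2[OF holomorphic_on_imp_continuous_on[OF T]])
        (use \<rho> in \<open>auto intro!: continuous_intros simp: dist_norm norm_mult\<close>)
  qed
  also have "\<dots> \<le> (LINT \<eta>|circle_measure. w z1)"
  proof (rule integral_mono)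
    show "integrable circle_measure (\<lambda>\<eta>. Re (T (z1 + of_real \<rho> * \<eta>)))"
      by (intro integrable_circle_continuous continuous_on_Re continuous_on_compose2[OF holomorphic_on_imp_continuous_on[OF T]])
        (use \<rho> in \<open>auto intro!: continuous_intros simp: dist_norm norm_mult\<close>)
    show "Re (T (z1 + of_real \<rho> * \<eta>)) \<le> w z1" if "\<eta> \<in> space circle_measure" for \<eta>
      using that \<rho> by (intro Tw) (simp add: norm_mult)
  qed simp
  also have "\<dots> = w z1" by simp
  finally show False by simp
qed

text \<open>Take a harmonic function that exceeds the boundary values by little. It is a majorant off the zeros of
  \<open>F\<close>, hence by continuity at the origin, where it equals its mean over the circle.\<close>

lemma submean_of_supported:
  assumes F: "F holomorphic_on ball 0 1" and \<Psi>: "continuous_on UNIV \<Psi>" and \<Psi>0: "\<Psi> 0 = 0"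
    and supp: "\<And>\<zeta>. \<zeta> \<noteq> 0 \<Longrightarrow> supported_by_Re_holomorphic \<Psi> \<zeta>"
    and r: "0 \<le> r" "r < 1"
  shows "\<Psi> (F 0) \<le> (LINT \<eta>|circle_measure. \<Psi> (F (of_real r * \<eta>)))"
proof (cases "r = 0")
  case False
  then have r0: "r > 0" using r by simp
  define G where "G = (\<lambda>z. F (of_real r * z))"
  have G: "G holomorphic_on ball 0 (1 / r)"
  proof -
    have "(F \<circ> (\<lambda>z. of_real r * z)) holomorphic_on ball 0 (1 / r)"
      by (rule holomorphic_on_compose_gen[OF _ F]) (use r0 in \<open>auto intro!: holomorphic_intros simp: norm_mult field_simps\<close>)
    then show ?thesis by (simp add: o_def G_def)
  qed
  have R: "1 < 1 / r" using r0 r by simp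
  have cG: "continuous_on (ball 0 (1/r)) G" by (rule holomorphic_on_imp_continuous_on[OF G])
  have cGs: "continuous_on (sphere 0 1) G" using cG R by (elim continuous_on_subset) auto
  have c\<Psi>G: "continuous_on (sphere 0 1) (\<lambda>z. \<Psi> (G z))" by (rule continuous_on_compose2[OF \<Psi> cGs]) auto
  show ?thesis
  proof (cases "\<forall>z\<in>ball 0 (1/r). G z = 0")
    case True
    then have "(LINT \<eta>|circle_measure. \<Psi> (F (of_real r * \<eta>))) = (LINT \<eta>|circle_measure. 0)"
      using R \<Psi>0 by (intro Bochner_Integration.integral_cong refl) (auto simp: G_def)
    moreover have "F 0 = 0" using True[rule_format, of 0] r0 by (simp add: G_def)
    ultimately show ?thesis using \<Psi>0 by simp
  next
    case False
    have "\<Psi> (G 0) \<le> (LINT \<eta>|circle_measure. \<Psi> (G \<eta>)) + e" if e: "0 < e" for e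
    proof -
      define \<epsilon> where "\<epsilon> = e / 2"
      have \<epsilon>: "\<epsilon> > 0" using e by (simp add: \<epsilon>_def)
      obtain H where H: "H holomorphic_on UNIV" "\<forall>z\<in>sphere 0 1. \<bar>\<Psi> (G z) - Re (H z)\<bar> < \<epsilon>"
        using circle_continuous_approx_Re_entire[OF c\<Psi>G \<epsilon>] by blast
      have maj: "\<Psi> (G a) \<le> Re (H a + of_real \<epsilon>)" if "cmod a \<le> 1" "G a \<noteq> 0" for a
      proof (rule harmonic_majorant_off_zeros[OF G R \<Psi> supp _ _ that])
        show "(\<lambda>z. H z + of_real \<epsilon>) holomorphic_on UNIV" using H by (intro holomorphic_intros) auto
        show "\<Psi> (G z) < Re (H z + of_real \<epsilon>)" if "cmod z = 1" for z using H(2)[rule_format, of z] that by (simp add: abs_less_iff)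
      qed
      have "0 \<in> closure {a \<in> ball 0 (1/r). G a \<noteq> 0}"
      proof (rule ccontr)
        assume "0 \<notin> closure {a \<in> ball 0 (1/r). G a \<noteq> 0}"
        then obtain d where d: "d > 0" "\<forall>y\<in>{a \<in> ball 0 (1/r). G a \<noteq> 0}. \<not> dist y 0 < d"
          unfolding closure_approachable by blast
        have "G z = 0" if "z \<in> ball 0 (1/r)" for z
        proof (rule analytic_continuation_open[of "ball 0 (min d (1/r))" "ball 0 (1/r)" G "\<lambda>_. 0" z])
          show "ball 0 (min d (1/r)) \<noteq> ({}::complex set)" using d(1) r0 by (simp add: not_le)
          show "G w = 0" if "w \<in> ball 0 (min d (1/r))" for w using d that by auto
        qed (use G that in auto)
        then show False using False by blast
      qed
      then obtain a where a: "\<And>n::nat. a n \<in> {a \<in> ball 0 (1/r). G a \<noteq> 0}" "a \<longlonglongrightarrow> 0"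
        unfolding closure_sequential by blast
      have "isCont G 0" using cG r0 by (intro continuous_on_interior[of "ball 0 (1/r)"]) (auto simp: interior_open)
      then have "(\<lambda>n. G (a n)) \<longlonglongrightarrow> G 0" by (rule isCont_tendsto_compose[OF _ a(2)])
      moreover have "isCont \<Psi> (G 0)" using \<Psi> by (simp add: continuous_on_eq_continuous_at)
      ultimately have l1: "(\<lambda>n. \<Psi> (G (a n))) \<longlonglongrightarrow> \<Psi> (G 0)" by (intro isCont_tendsto_compose[of _ \<Psi>]) auto
      have "isCont H 0" using holomorphic_on_imp_continuous_on[OF H(1)] by (simp add: continuous_on_eq_continuous_at)
      then have "(\<lambda>n. Re (H (a n) + of_real \<epsilon>)) \<longlonglongrightarrow> Re (H 0 + of_real \<epsilon>)"
        by (intro tendsto_intros isCont_tendsto_compose[OF _ a(2)])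
      moreover have "\<forall>\<^sub>F n in sequentially. \<Psi> (G (a n)) \<le> Re (H (a n) + of_real \<epsilon>)"
      proof -
        have "\<forall>\<^sub>F n in sequentially. dist (a n) 0 < 1" using a(2) by (rule tendstoD) simp
        then show ?thesis
        proof eventually_elim
          case (elim n)
          then show ?case using a(1)[of n] maj[of "a n"] by simp
        qed
      qed
      ultimately have "\<Psi> (G 0) \<le> Re (H 0 + of_real \<epsilon>)"
        using l1 by (intro tendsto_le[of sequentially]) auto
      also have "Re (H 0 + of_real \<epsilon>) = Re (H 0) + \<epsilon>" by simp
      also have "H 0 = (LINT \<eta>|circle_measure. H (0 + of_real 1 * \<eta>))"
        by (rule holomorphic_circle_mean_value[of H 0 2]) (use H in \<open>auto elim: holomorphic_on_subset\<close>)
      also have "Re \<dots> = (LINT \<eta>|circle_measure. Re (H \<eta>))"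
      proof -
        have "integrable circle_measure H"
          using holomorphic_on_imp_continuous_on[OF H(1)] by (intro integrable_circle_continuous) (auto elim: continuous_on_subset)
        from integral_bounded_linear[OF bounded_linear_Re this] show ?thesis by simp
      qed
      also have "\<dots> \<le> (LINT \<eta>|circle_measure. \<Psi> (G \<eta>) + \<epsilon>)"
      proof (rule integral_mono)
        show "integrable circle_measure (\<lambda>\<eta>. Re (H \<eta>))"
          using holomorphic_on_imp_continuous_on[OF H(1)] by (intro integrable_circle_continuous continuous_on_Re) (auto elim: continuous_on_subset)
        show "integrable circle_measure (\<lambda>\<eta>. \<Psi> (G \<eta>) + \<epsilon>)"
          by (intro integrable_circle_continuous continuous_intros c\<Psi>G)
        show "Re (H \<eta>) \<le> \<Psi> (G \<eta>) + \<epsilon>" if "\<eta> \<in> space circle_measure" for \<eta>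
          using H(2)[rule_format, of \<eta>] that by (simp add: abs_less_iff)
      qed
      also have "\<dots> = (LINT \<eta>|circle_measure. \<Psi> (G \<eta>)) + \<epsilon>"
        using integrable_circle_continuous[OF c\<Psi>G] by simp
      finally show ?thesis by (simp add: \<epsilon>_def)
    qed
    then have "\<Psi> (G 0) \<le> (LINT \<eta>|circle_measure. \<Psi> (G \<eta>))" by (rule field_le_epsilon)
    then show ?thesis by (simp add: G_def)
  qed
qed simp

section \<open>Two trigonometric inequalities\<close>

text \<open>The endpoints are exempt from differentiability because in the applications the base of a real
  power may vanish there.\<close>

lemma le_value_at_minimum_sign_change:
  fixes F F' :: "real \<Rightarrow> real"
  assumes F: "continuous_on {a..b} F"
    and F': "\<And>x. a < x \<Longrightarrow> x < b \<Longrightarrow> (F has_real_derivative F' x) (at x)"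
    and neg: "\<And>x. a < x \<Longrightarrow> x < c \<Longrightarrow> F' x \<le> 0" and pos: "\<And>x. c < x \<Longrightarrow> x < b \<Longrightarrow> 0 \<le> F' x"
    and c: "a \<le> c" "c \<le> b" and x: "a \<le> x" "x \<le> b"
  shows "F c \<le> F x"
proof (cases "x \<le> c")
  case True
  show ?thesis
  proof (rule DERIV_nonpos_imp_decreasing_open[OF True])
    show "\<exists>y. DERIV F z :> y \<and> y \<le> 0" if "x < z" "z < c" for z
      using that F'[of z] neg[of z] x c by force
    show "continuous_on {x..c} F" using F x c by (auto elim: continuous_on_subset)
  qed
next
  case False
  then have "c \<le> x" by simp
  then show ?thesis
  proof (rule DERIV_nonneg_imp_increasing_open)
    show "\<exists>y. DERIV F z :> y \<and> 0 \<le> y" if "c < z" "z < x" for z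
      using that F'[of z] pos[of z] x c by force
    show "continuous_on {c..x} F" using F x c by (auto elim: continuous_on_subset)
  qed
qed

text \<open>Both sides agree at \<open>\<phi> = \<alpha>\<close>, and the coefficient of \<open>cos (p * \<phi>)\<close> is the one for which the
  derivatives agree there as well. The derivative of the difference changes sign only at \<open>\<alpha>\<close>, because the quotient
  of \<open>sin (p * \<phi>)\<close> by \<open>sin \<phi> powr (p - 1) * cos \<phi>\<close> is increasing; \<open>L\<close> is the
  logarithm of that quotient.\<close>

lemma sin_powr_le_interpolation:
  fixes p \<alpha> \<phi> :: real
  assumes p: "1 < p" "p \<le> 2" and \<alpha>: "\<alpha> = pi / (2 * p)" and \<phi>: "0 \<le> \<phi>" "\<phi> \<le> pi / 2"
  shows "sin \<phi> powr p + sin \<alpha> powr (p - 1) * cos \<alpha> * cos (p * \<phi>) \<le> sin \<alpha> powr p"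
proof -
  have \<alpha>': "0 < \<alpha>" "\<alpha> < pi / 2" "p * \<alpha> = pi / 2" using p by (auto simp: \<alpha> field_simps)
  define k where "k = sin \<alpha> powr (p - 1) * cos \<alpha>"
  have sc: "0 < sin x" "0 < cos x" if "0 < x" "x < pi / 2" for x
    using that by (auto intro: sin_gt_zero cos_gt_zero)
  have k: "k > 0" using sc[of \<alpha>] \<alpha>' by (simp add: k_def)
  have sp: "0 < sin (p * x)" if "0 < x" "x < pi / 2" for x
  proof (rule sin_gt_zero)
    show "0 < p * x" using that p by simp
    have "p * x < 2 * (pi / 2)" using that p by (intro mult_le_less_imp_less) auto
    then show "p * x < pi" by simp
  qed
  define L where "L = (\<lambda>x. ln (sin (p * x)) - (p - 1) * ln (sin x) - ln (cos x))"
  have L': "(L has_real_derivative (p * cos (p * x) / sin (p * x) - (p - 1) * (cos x / sin x) + sin x / cos x)) (at x)"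
    if "0 < x" "x < pi / 2" for x
    unfolding L_def using sc[OF that] sp[OF that]
    by (auto intro!: derivative_eq_intros simp: mult_ac)
  have L'0: "0 \<le> p * cos (p * x) / sin (p * x) - (p - 1) * (cos x / sin x) + sin x / cos x"
    if x: "0 < x" "x < pi / 2" for x
  proof -
    define s c S C where "s = sin x" and "c = cos x" and "S = sin ((p - 1) * x)" and "C = cos ((p - 1) * x)"
    have pos: "0 < s" "0 < c" "0 < sin (p * x)" using sc[OF x] sp[OF x] by (auto simp: s_def c_def)
    have px: "p * x = x + (p - 1) * x" by (simp add: algebra_simps)
    have e: "sin (p * x) = s * C + c * S" "cos (p * x) = c * C - s * S"
      unfolding px sin_add cos_add by (simp_all add: s_def c_def S_def C_def)
    have kx: "0 \<le> (p - 1) * x" "(p - 1) * x \<le> x" using x p by (auto intro: mult_left_le_one_le)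
    have "(p - 1) * x \<le> pi" "x - (p - 1) * x \<le> pi" using kx x pi_gt_zero by linarith+
    then have S0: "0 \<le> S" and "0 \<le> sin (x - (p - 1) * x)" unfolding S_def using kx by (auto intro: sin_ge_zero)
    then have "c * S \<le> s * C" by (simp add: sin_diff s_def c_def S_def C_def)
    moreover have "(p - 1) * (c * S) \<le> 1 * (c * S)" using p pos S0 by (intro mult_right_mono) auto
    ultimately have "0 \<le> s * C - (p - 1) * (c * S)" by simp
    also have "\<dots> = (s\<^sup>2 + c\<^sup>2) * (s * C - (p - 1) * (c * S))" by (simp add: s_def c_def)
    also have "\<dots> = p * cos (p * x) * (s * c) - (p - 1) * sin (p * x) * c\<^sup>2 + sin (p * x) * s\<^sup>2"
      unfolding e by algebra
    also have "\<dots> = (p * cos (p * x) / sin (p * x) - (p - 1) * (c / s) + s / c) * (sin (p * x) * s * c)"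
      using pos by (simp add: field_simps power2_eq_square)
    finally have "0 * (sin (p * x) * s * c) \<le> (p * cos (p * x) / sin (p * x) - (p - 1) * (c / s) + s / c) * (sin (p * x) * s * c)"
      by simp
    then have "0 \<le> p * cos (p * x) / sin (p * x) - (p - 1) * (c / s) + s / c"
      by (rule mult_right_le_imp_le) (use pos in simp)
    then show ?thesis by (simp add: s_def c_def)
  qed
  have Lmono: "L x \<le> L y" if "0 < x" "x \<le> y" "y < pi / 2" for x y
  proof (rule DERIV_nonneg_imp_nondecreasing[OF \<open>x \<le> y\<close>])
    fix z assume "x \<le> z" "z \<le> y"
    then have "0 < z" "z < pi / 2" using that by auto
    then show "\<exists>d. DERIV L z :> d \<and> 0 \<le> d" using L' L'0 by blast
  qed
  have Leq: "exp (L x) = sin (p * x) / (sin x powr (p - 1) * cos x)" if "0 < x" "x < pi / 2" for x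
    using sc[OF that] sp[OF that] by (simp add: L_def exp_diff powr_def)
  have L\<alpha>: "exp (L \<alpha>) = 1 / k" using Leq[of \<alpha>] \<alpha>' by (simp add: k_def)
  define F where "F = (\<lambda>x. sin \<alpha> powr p - k * cos (p * x) - sin x powr p)"
  define F' where "F' = (\<lambda>x. p * (k * sin (p * x) - sin x powr (p - 1) * cos x))"
    have "0 \<le> sin x" if "x \<in> {0..pi/2}" for x using that by (intro sin_ge_zero) auto
    then have c1: "continuous_on {0..pi / 2} (\<lambda>x. sin x powr p)"
      using p by (intro continuous_on_powr'[OF continuous_on_sin[OF continuous_on_id] continuous_on_const]) simp
    have c2: "continuous_on {0..pi / 2} (\<lambda>x. sin \<alpha> powr p - k * cos (p * x))"
      by (intro continuous_on_diff continuous_on_add continuous_on_const continuous_on_mult continuous_on_cos continuous_on_id)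
    have cF: "continuous_on {0..pi / 2} F" unfolding F_def by (rule continuous_on_diff[OF c2 c1])
  have "F \<alpha> \<le> F \<phi>"
  proof (rule le_value_at_minimum_sign_change[where F = F and c = \<alpha> and a = 0 and b = "pi / 2" and F' = F'])
    show "continuous_on {0..pi / 2} F" by (rule cF)
  next
    fix x :: real assume "0 < x" "x < pi / 2"
    then show "(F has_real_derivative F' x) (at x)" unfolding F_def F'_def using sc[of x]
      by (auto intro!: derivative_eq_intros simp: algebra_simps)
  next
    fix x assume x: "0 < x" "x < \<alpha>"
    then have x2: "x < pi / 2" using \<alpha>' by simp
    have "exp (L x) \<le> 1 / k" using Lmono[of x \<alpha>] x \<alpha>' L\<alpha>[symmetric] by simp
    then have "k * sin (p * x) \<le> sin x powr (p - 1) * cos x"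
      using Leq[OF x(1) x2] sc[OF x(1) x2] k by (simp add: field_simps)
    then show "F' x \<le> 0" using p by (simp add: F'_def mult_le_0_iff)
  next
    fix x assume x: "\<alpha> < x" "x < pi / 2"
    then have x2: "0 < x" using \<alpha>' by simp
    have "1 / k \<le> exp (L x)" using Lmono[of \<alpha> x] x \<alpha>' L\<alpha>[symmetric] by simp
    then have "sin x powr (p - 1) * cos x \<le> k * sin (p * x)"
      using Leq[OF x2 x(2)] sc[OF x2 x(2)] k by (simp add: field_simps)
    then show "0 \<le> F' x" using p by (simp add: F'_def)
  qed (use \<alpha>' \<phi> in auto)
  moreover have "cos (p * \<alpha>) = 0" by (simp add: \<alpha>'(3))
  ultimately show ?thesis by (simp add: F_def k_def)
qed

lemma sin_cos_superadditive:
  fixes k x :: real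
  assumes "1 \<le> k" "0 \<le> x" "k * x \<le> pi"
  shows "k * (sin x * cos (k * x)) \<le> sin (k * x) * cos x"
proof -
  define D where "D = (\<lambda>x. sin (k * x) * cos x - k * (sin x * cos (k * x)))"
  have "D 0 \<le> D x"
  proof (rule DERIV_nonneg_imp_nondecreasing[OF assms(2)])
    fix z assume z: "0 \<le> z" "z \<le> x"
    have "k * z \<le> k * x" using z assms by (intro mult_left_mono) auto
    then have kz: "k * z \<le> pi" using assms by linarith
    have "1 * z \<le> k * z" using z assms by (intro mult_right_mono) auto
    then have "z \<le> pi" "0 \<le> k * z" using kz z by linarith+
    then have "0 \<le> sin z" "0 \<le> sin (k * z)" using kz z by (auto intro: sin_ge_zero)
    then have "0 \<le> (k\<^sup>2 - 1) * (sin z * sin (k * z))" using assms by (intro mult_nonneg_nonneg) auto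
    moreover have "DERIV D z :> (k\<^sup>2 - 1) * (sin z * sin (k * z))"
      unfolding D_def by (auto intro!: derivative_eq_intros simp: algebra_simps power2_eq_square)
    ultimately show "\<exists>y. DERIV D z :> y \<and> 0 \<le> y" by blast
  qed
  then show ?thesis by (simp add: D_def)
qed

text \<open>The counterpart for large exponents, with a decreasing quotient. The monotonicity now rests on
  \<open>sin_cos_superadditive\<close> with \<open>k = p - 1\<close>.\<close>

lemma cos_powr_le_interpolation:
  fixes p \<alpha> x :: real
  assumes p: "2 \<le> p" and \<alpha>: "\<alpha> = pi / (2 * p)" and x: "0 \<le> x" "x \<le> pi / p"
  shows "cos x powr p \<le> cos \<alpha> powr p + sin \<alpha> * cos \<alpha> powr (p - 1) * cos (p * x)"
proof -
  have \<alpha>': "0 < \<alpha>" "\<alpha> < pi / p" "p * \<alpha> = pi / 2" using p by (auto simp: \<alpha> field_simps)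
  have pp: "pi / p \<le> pi / 2" using p by (simp add: field_simps)
  define k where "k = sin \<alpha> * cos \<alpha> powr (p - 1)"
  have sc: "0 < sin x" "0 < cos x" "0 < sin (p * x)" if "0 < x" "x < pi / p" for x
  proof -
    have "x < pi / 2" "x < pi" using that pp pi_gt_zero by linarith+
    moreover have "p * x < pi" "0 < p * x" using that p by (auto simp: field_simps)
    ultimately show "0 < sin x" "0 < cos x" "0 < sin (p * x)"
      using that by (auto intro: sin_gt_zero cos_gt_zero)
  qed
  have k: "k > 0" using sc[of \<alpha>] \<alpha>' by (simp add: k_def)
  define L where "L = (\<lambda>x. ln (sin (p * x)) - (p - 1) * ln (cos x) - ln (sin x))"
  have L': "(L has_real_derivative (p * cos (p * x) / sin (p * x) + (p - 1) * (sin x / cos x) - cos x / sin x)) (at x)"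
    if "0 < x" "x < pi / p" for x
    unfolding L_def using sc[OF that] by (auto intro!: derivative_eq_intros simp: mult_ac)
  have L'0: "p * cos (p * x) / sin (p * x) + (p - 1) * (sin x / cos x) - cos x / sin x \<le> 0"
    if x: "0 < x" "x < pi / p" for x
  proof -
    define s c S C where "s = sin x" and "c = cos x" and "S = sin ((p - 1) * x)" and "C = cos ((p - 1) * x)"
    have pos: "0 < s" "0 < c" "0 < sin (p * x)" using sc[OF x] by (auto simp: s_def c_def)
    have px: "p * x = x + (p - 1) * x" by (simp add: algebra_simps)
    have e: "sin (p * x) = s * C + c * S" "cos (p * x) = c * C - s * S"
      unfolding px sin_add cos_add by (simp_all add: s_def c_def S_def C_def)
    have "(p - 1) * x \<le> p * x" using x by (intro mult_right_mono) auto
    also have "\<dots> \<le> pi" using x p by (simp add: field_simps)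
    finally have "(p - 1) * (s * C) \<le> S * c"
      unfolding s_def c_def S_def C_def using p x by (intro sin_cos_superadditive) auto
    then have "0 \<ge> (p - 1) * (s * C) - c * S" by (simp add: mult.commute)
    moreover have "(p - 1) * (s * C) - c * S = (s\<^sup>2 + c\<^sup>2) * ((p - 1) * (s * C) - c * S)" by (simp add: s_def c_def)
    moreover have "\<dots> = p * cos (p * x) * (s * c) + (p - 1) * sin (p * x) * s\<^sup>2 - sin (p * x) * c\<^sup>2"
      unfolding e by algebra
    moreover have "\<dots> = (p * cos (p * x) / sin (p * x) + (p - 1) * (s / c) - c / s) * (sin (p * x) * s * c)"
      using pos by (simp add: field_simps power2_eq_square)
    ultimately have "(p * cos (p * x) / sin (p * x) + (p - 1) * (s / c) - c / s) * (sin (p * x) * s * c) \<le> 0" by simp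
    then show ?thesis using pos by (simp add: mult_le_0_iff s_def c_def zero_less_mult_iff)
  qed
  have Lmono: "L y \<le> L x" if "0 < x" "x \<le> y" "y < pi / p" for x y
  proof (rule DERIV_nonpos_imp_nonincreasing[OF \<open>x \<le> y\<close>])
    fix z assume "x \<le> z" "z \<le> y"
    then have "0 < z" "z < pi / p" using that by auto
    then show "\<exists>d. DERIV L z :> d \<and> d \<le> 0" using L' L'0 by blast
  qed
  have Leq: "exp (L x) = sin (p * x) / (cos x powr (p - 1) * sin x)" if "0 < x" "x < pi / p" for x
    using sc[OF that] by (simp add: L_def exp_diff powr_def)
  have L\<alpha>: "exp (L \<alpha>) = 1 / k" using Leq[of \<alpha>] \<alpha>' by (simp add: k_def mult.commute[of "sin \<alpha>"])
  define F where "F = (\<lambda>x. cos \<alpha> powr p + k * cos (p * x) - cos x powr p)"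
  define F' where "F' = (\<lambda>x. p * (cos x powr (p - 1) * sin x - k * sin (p * x)))"
    have "0 \<le> cos x" if "x \<in> {0..pi/p}" for x
    proof (rule cos_ge_zero)
      show "- (pi / 2) \<le> x" "x \<le> pi / 2" using that pp pi_gt_zero unfolding atLeastAtMost_iff by linarith+
    qed
    then have c1: "continuous_on {0..pi / p} (\<lambda>x. cos x powr p)"
      using p by (intro continuous_on_powr'[OF continuous_on_cos[OF continuous_on_id] continuous_on_const]) simp
    have c2: "continuous_on {0..pi / p} (\<lambda>x. cos \<alpha> powr p + k * cos (p * x))"
      by (intro continuous_on_diff continuous_on_add continuous_on_const continuous_on_mult continuous_on_cos continuous_on_id)
    have cF: "continuous_on {0..pi / p} F" unfolding F_def by (rule continuous_on_diff[OF c2 c1])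
  have "F \<alpha> \<le> F x"
  proof (rule le_value_at_minimum_sign_change[where F = F and c = \<alpha> and a = 0 and b = "pi / p" and F' = F'])
    show "continuous_on {0..pi / p} F" by (rule cF)
  next
    fix x :: real assume "0 < x" "x < pi / p"
    then show "(F has_real_derivative F' x) (at x)" unfolding F_def F'_def using sc[of x]
      by (auto intro!: derivative_eq_intros simp: algebra_simps)
  next
    fix x assume x: "0 < x" "x < \<alpha>"
    then have x2: "x < pi / p" using \<alpha>' by simp
    have "1 / k \<le> exp (L x)" using Lmono[of x \<alpha>] x \<alpha>' L\<alpha>[symmetric] by simp
    then have "cos x powr (p - 1) * sin x \<le> k * sin (p * x)"
      using Leq[OF x(1) x2] sc[OF x(1) x2] k by (simp add: field_simps)
    then show "F' x \<le> 0" using p by (simp add: F'_def mult_le_0_iff)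
  next
    fix x assume x: "\<alpha> < x" "x < pi / p"
    then have x2: "0 < x" using \<alpha>' by simp
    have "exp (L x) \<le> 1 / k" using Lmono[of \<alpha> x] x \<alpha>' L\<alpha>[symmetric] by simp
    then have "k * sin (p * x) \<le> cos x powr (p - 1) * sin x"
      using Leq[OF x2 x(2)] sc[OF x2 x(2)] k by (simp add: field_simps)
    then show "0 \<le> F' x" using p by (simp add: F'_def)
  qed (use \<alpha>' x in auto)
  moreover have "cos (p * \<alpha>) = 0" by (simp add: \<alpha>'(3))
  ultimately show ?thesis by (simp add: F_def k_def)
qed

section \<open>The control function\<close>

text \<open>A function homogeneous of degree \<open>q\<close> and symmetric about the real axis is given by its
  profile \<open>V\<close> on the angles from \<open>0\<close> to \<open>pi\<close>.\<close>

definition angular_power :: "real \<Rightarrow> (real \<Rightarrow> real) \<Rightarrow> complex \<Rightarrow> real" where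
  "angular_power q V \<zeta> = cmod \<zeta> powr q * V (arccos (Re \<zeta> / cmod \<zeta>))"

lemma Re_div_cmod_bounds: "- 1 \<le> Re \<zeta> / cmod \<zeta>" "Re \<zeta> / cmod \<zeta> \<le> 1"
proof -
  have "\<bar>Re \<zeta> / cmod \<zeta>\<bar> \<le> 1"
    using abs_Re_le_cmod[of \<zeta>] by (cases "\<zeta> = 0") (auto simp: abs_divide)
  then show "- 1 \<le> Re \<zeta> / cmod \<zeta>" "Re \<zeta> / cmod \<zeta> \<le> 1" by linarith+
qed

lemma angle_bounds: "0 \<le> arccos (Re \<zeta> / cmod \<zeta>)" "arccos (Re \<zeta> / cmod \<zeta>) \<le> pi"
  using Re_div_cmod_bounds[of \<zeta>] by (simp_all add: arccos_lbound arccos_ubound)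

lemma cos_angle: "cmod \<zeta> * cos (arccos (Re \<zeta> / cmod \<zeta>)) = Re \<zeta>"
  using Re_div_cmod_bounds[of \<zeta>] by (cases "\<zeta> = 0") (auto simp: cos_arccos)

lemma angular_power_scale:
  assumes "0 < c" shows "angular_power q V (of_real c * \<zeta>) = c powr q * angular_power q V \<zeta>"
  using assms by (simp add: angular_power_def norm_mult powr_mult)

lemma continuous_on_angular_power:
  assumes V: "continuous_on {0..pi} V" and q: "0 < q"
  shows "continuous_on UNIV (angular_power q V)"
proof -
  have "isCont (angular_power q V) \<zeta>" for \<zeta>
  proof (cases "\<zeta> = 0")
    case False
    have "continuous_on (-{0}) (angular_power q V)"
      unfolding angular_power_def
    proof (intro continuous_on_mult)
      show "continuous_on (- {0}) (\<lambda>\<zeta>. cmod \<zeta> powr q)" using q by (intro continuous_intros) auto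
      have "continuous_on (- {0}) (\<lambda>\<zeta>. arccos (Re \<zeta> / cmod \<zeta>))"
        using Re_div_cmod_bounds by (intro continuous_on_arccos continuous_intros) auto
      then show "continuous_on (- {0}) (\<lambda>\<zeta>. V (arccos (Re \<zeta> / cmod \<zeta>)))"
        by (rule continuous_on_compose2[OF V]) (use angle_bounds in auto)
    qed
    then show ?thesis using False continuous_on_eq_continuous_at[of "- {0::complex}" "angular_power q V"] by auto
  next
    case True
    have "bounded (V ` {0..pi})" by (intro compact_imp_bounded compact_continuous_image V) auto
    then obtain B where B: "B > 0" "\<And>t. t \<in> {0..pi} \<Longrightarrow> \<bar>V t\<bar> \<le> B" unfolding bounded_pos by auto
    have "((\<lambda>\<zeta>. B * cmod \<zeta> powr q) \<longlongrightarrow> B * cmod 0 powr q) (at 0)"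
      using q by (intro tendsto_intros tendsto_powr') auto
    then have "((\<lambda>\<zeta>. B * cmod \<zeta> powr q) \<longlongrightarrow> 0) (at 0)" by simp
    then have "(angular_power q V \<longlongrightarrow> 0) (at 0)"
    proof (rule Lim_null_comparison[rotated], intro always_eventually allI)
      fix \<zeta>
      have "\<bar>V (arccos (Re \<zeta> / cmod \<zeta>))\<bar> \<le> B" using B(2) angle_bounds by auto
      then have "\<bar>V (arccos (Re \<zeta> / cmod \<zeta>))\<bar> * cmod \<zeta> powr q \<le> B * cmod \<zeta> powr q" by (rule mult_right_mono) simp
      then show "norm (angular_power q V \<zeta>) \<le> B * cmod \<zeta> powr q"
        by (simp add: angular_power_def abs_mult mult.commute)
    qed
    then show ?thesis using True by (simp add: isCont_def angular_power_def)
  qed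
  then show ?thesis by (simp add: continuous_on_eq_continuous_at)
qed

text \<open>Translates of \<open>cos (q * x)\<close> are the profiles of the real parts of branches of \<open>z powr q\<close>. The profile
  is extended to all angles by \<open>arccos (cos \<theta>)\<close>.\<close>

definition locally_supported_by_cosines :: "real \<Rightarrow> (real \<Rightarrow> real) \<Rightarrow> bool" where
  "locally_supported_by_cosines q V \<longleftrightarrow> (\<forall>\<theta>. \<bar>\<theta>\<bar> \<le> pi \<longrightarrow> (\<exists>\<beta> \<epsilon>. 0 < \<epsilon> \<and> V (arccos (cos \<theta>)) = cos \<beta> \<and>
     (\<forall>x. \<bar>x\<bar> < \<epsilon> \<longrightarrow> cos (\<beta> + q * x) \<le> V (arccos (cos (\<theta> + x))))))"

text \<open>The supporting function is the branch \<open>exp (q * Ln (\<zeta> / \<zeta>0))\<close> of the power near \<open>\<zeta>0\<close>, rotated by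
  \<open>\<beta>\<close> and scaled.\<close>

lemma supported_angular_power:
  assumes V: "locally_supported_by_cosines q V" and z: "\<zeta>0 \<noteq> 0"
  shows "supported_by_Re_holomorphic (angular_power q V) \<zeta>0"
proof -
  define \<theta> where "\<theta> = Arg \<zeta>0"
  have \<zeta>0: "\<zeta>0 = of_real (cmod \<zeta>0) * cis \<theta>" using rcis_cmod_Arg[of \<zeta>0] by (simp add: \<theta>_def rcis_def)
  have "\<bar>\<theta>\<bar> \<le> pi" using Arg_bounded[of \<zeta>0] by (auto simp: \<theta>_def)
  then obtain \<beta> \<epsilon> where \<beta>: "0 < \<epsilon>" "V (arccos (cos \<theta>)) = cos \<beta>"
      "\<And>x. \<bar>x\<bar> < \<epsilon> \<Longrightarrow> cos (\<beta> + q * x) \<le> V (arccos (cos (\<theta> + x)))"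
    using V unfolding locally_supported_by_cosines_def by blast
  have "isCont (\<lambda>\<zeta>. Im (Ln (\<zeta> / \<zeta>0))) \<zeta>0" using z by (intro isCont_Im isCont_Ln' continuous_intros) (auto simp: complex_nonpos_Reals_iff)
  then obtain d where d: "d > 0" "\<And>\<zeta>. dist \<zeta> \<zeta>0 < d \<Longrightarrow> dist (Im (Ln (\<zeta> / \<zeta>0))) (Im (Ln (\<zeta>0 / \<zeta>0))) < \<epsilon>"
    using \<beta>(1) unfolding continuous_at_eps_delta by blast
  define e where "e = min d (cmod \<zeta>0)"
  define b where "b = (\<lambda>\<zeta>. of_real (cmod \<zeta>0 powr q) * cis \<beta> * exp (of_real q * Ln (\<zeta> / \<zeta>0)))"
  have quot: "Re (\<zeta> / \<zeta>0) > 0" if "\<zeta> \<in> ball \<zeta>0 e" for \<zeta>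
  proof -
    have "\<zeta> / \<zeta>0 - 1 = (\<zeta> - \<zeta>0) / \<zeta>0" using z by (simp add: field_simps)
    then have "cmod (\<zeta> / \<zeta>0 - 1) < 1" using that z by (simp add: norm_divide e_def dist_norm norm_minus_commute)
    then have "\<bar>Re (\<zeta> / \<zeta>0 - 1)\<bar> < 1" using abs_Re_le_cmod[of "\<zeta> / \<zeta>0 - 1"] by linarith
    then show ?thesis by simp
  qed
  have key: "Re (b \<zeta>) = cmod \<zeta> powr q * cos (\<beta> + q * Im (Ln (\<zeta> / \<zeta>0)))"
    "Re \<zeta> / cmod \<zeta> = cos (\<theta> + Im (Ln (\<zeta> / \<zeta>0)))" if "\<zeta> \<in> ball \<zeta>0 e" for \<zeta>
  proof -
    have n0: "\<zeta> \<noteq> 0" using quot[OF that] by auto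
    define w where "w = Ln (\<zeta> / \<zeta>0)"
    have rw: "Re w = ln (cmod \<zeta> / cmod \<zeta>0)" using n0 z by (simp add: w_def norm_divide)
    have "exp (of_real q * w) = of_real (exp (q * Re w)) * cis (q * Im w)"
      by (simp add: exp_eq_polar)
    then have "b \<zeta> = of_real (cmod \<zeta>0 powr q * exp (q * Re w)) * cis (\<beta> + q * Im w)"
      by (simp add: b_def w_def[symmetric] flip: cis_mult)
    moreover have "cmod \<zeta>0 powr q * exp (q * Re w) = cmod \<zeta> powr q"
      using n0 z by (simp add: rw powr_def ln_div flip: exp_add) (simp add: algebra_simps)
    ultimately show "Re (b \<zeta>) = cmod \<zeta> powr q * cos (\<beta> + q * Im (Ln (\<zeta> / \<zeta>0)))" by (simp add: w_def)
    have "exp w = \<zeta> / \<zeta>0" unfolding w_def using n0 z by simp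
    then have "\<zeta> = \<zeta>0 * exp w" using z by simp
    also have "\<dots> = of_real (cmod \<zeta>0 * exp (Re w)) * cis (\<theta> + Im w)"
      by (subst \<zeta>0) (simp add: exp_eq_polar flip: cis_mult)
    finally have eq: "\<zeta> = of_real (cmod \<zeta>0 * exp (Re w)) * cis (\<theta> + Im w)" .
    have "cmod \<zeta> = cmod \<zeta>0 * exp (Re w)" by (subst eq) (simp add: norm_mult)
    moreover have "Re \<zeta> = cmod \<zeta>0 * exp (Re w) * cos (\<theta> + Im w)" by (subst eq) simp
    ultimately show "Re \<zeta> / cmod \<zeta> = cos (\<theta> + Im (Ln (\<zeta> / \<zeta>0)))" using n0 z by (simp add: w_def)
  qed
  have e0: "e > 0" using d z by (simp add: e_def)
  show ?thesis unfolding supported_by_Re_holomorphic_def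
  proof (intro exI[of _ b] exI[of _ e] conjI ballI e0)
    show "b holomorphic_on ball \<zeta>0 e" unfolding b_def using quot z
      by (intro holomorphic_intros) (fastforce simp: complex_nonpos_Reals_iff)+
    show "Re (b \<zeta>0) = angular_power q V \<zeta>0"
      using key[of \<zeta>0] e0 z \<beta>(2) by (simp add: angular_power_def)
    fix \<zeta> assume \<zeta>: "\<zeta> \<in> ball \<zeta>0 e"
    then have "\<bar>Im (Ln (\<zeta> / \<zeta>0))\<bar> < \<epsilon>" using d(2)[of \<zeta>] z by (simp add: e_def dist_commute)
    from \<beta>(3)[OF this] show "Re (b \<zeta>) \<le> angular_power q V \<zeta>"
      unfolding angular_power_def key[OF \<zeta>] by (intro mult_left_mono) auto
  qed
qed

text \<open>The profile is smooth across the negative axis. Across the positive axis it has a corner,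
  which is convex because \<open>sin (q * pi) \<ge> 0\<close>.\<close>

lemma locally_supported_cos_reflected:
  assumes q: "0 \<le> q" "q \<le> 1"
  shows "locally_supported_by_cosines q (\<lambda>t. cos (q * (pi - t)))"
proof -
  have *: "cos (q * (\<theta> - pi)) \<le> cos (q * (pi - arccos (cos \<theta>)))" if "- pi \<le> \<theta>" "\<theta> \<le> 2 * pi" for \<theta>
  proof (cases "\<theta> \<le> 0")
    case True
    have a: "arccos (cos \<theta>) = - \<theta>" using True that by (simp add: arccos_cos2)
    have "cos (q * pi + q * \<theta>) - cos (q * pi - q * \<theta>) = 2 * (sin (q * pi) * sin (- (q * \<theta>)))"
      by (simp add: cos_add cos_diff)
    moreover have "0 \<le> sin (q * pi)" using q by (intro sin_ge_zero) (auto simp: mult_left_le_one_le)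
    moreover have "0 \<le> sin (- (q * \<theta>))"
    proof (rule sin_ge_zero)
      show "0 \<le> - (q * \<theta>)" using q True by (simp add: mult_nonneg_nonpos)
      have "q * (- \<theta>) \<le> 1 * pi" using q True that by (intro mult_mono) auto
      then show "- (q * \<theta>) \<le> pi" by simp
    qed
    ultimately have "cos (q * pi - q * \<theta>) \<le> cos (q * pi + q * \<theta>)"
      by (metis diff_ge_0_iff_ge mult_nonneg_nonneg zero_le_numeral)
    moreover have "cos (q * (\<theta> - pi)) = cos (q * pi - q * \<theta>)"
      by (metis cos_minus minus_diff_eq right_diff_distrib)
    ultimately show ?thesis by (simp add: a algebra_simps)
  next
    case False
    show ?thesis
    proof (cases "\<theta> \<le> pi")
      case True
      then have "arccos (cos \<theta>) = \<theta>" using False by (simp add: arccos_cos)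
      moreover have "cos (q * (\<theta> - pi)) = cos (q * (pi - \<theta>))"
        by (metis cos_minus minus_diff_eq mult_minus_right)
      ultimately show ?thesis by simp
    next
      case False
      have "cos \<theta> = cos (2 * pi - \<theta>)" by simp
      then have "arccos (cos \<theta>) = 2 * pi - \<theta>" using False that by (simp add: arccos_cos del: cos_2pi_minus)
      then show ?thesis by simp
    qed
  qed
  show ?thesis unfolding locally_supported_by_cosines_def
  proof (intro allI impI)
    fix \<theta> :: real assume \<theta>: "\<bar>\<theta>\<bar> \<le> pi"
    show "\<exists>\<beta> \<epsilon>. 0 < \<epsilon> \<and> cos (q * (pi - arccos (cos \<theta>))) = cos \<beta> \<and>
     (\<forall>x. \<bar>x\<bar> < \<epsilon> \<longrightarrow> cos (\<beta> + q * x) \<le> cos (q * (pi - arccos (cos (\<theta> + x)))))"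
    proof (cases "0 \<le> \<theta>")
      case True
      have "cos (q * (pi - arccos (cos \<theta>))) = cos (q * (\<theta> - pi))"
        using True \<theta> by (simp add: arccos_cos) (metis cos_minus minus_diff_eq mult_minus_right)
      moreover have "cos (q * (\<theta> - pi) + q * x) \<le> cos (q * (pi - arccos (cos (\<theta> + x))))" if "\<bar>x\<bar> < pi" for x
        using *[of "\<theta> + x"] that \<theta> True by (simp add: algebra_simps)
      ultimately show ?thesis by (intro exI[of _ "q * (\<theta> - pi)"] exI[of _ pi]) auto
    next
      case False
      have "cos (q * (pi - arccos (cos \<theta>))) = cos (q * (\<theta> + pi))"
        using False \<theta> by (simp add: arccos_cos2 add.commute)
      moreover have "cos (q * (\<theta> + pi) + q * x) \<le> cos (q * (pi - arccos (cos (\<theta> + x))))" if "\<bar>x\<bar> < pi" for x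
      proof -
        have "cos (q * (- (\<theta> + x) - pi)) \<le> cos (q * (pi - arccos (cos (- (\<theta> + x)))))"
          using that \<theta> False by (intro *) auto
        moreover have "q * (- (\<theta> + x) - pi) = - (q * (\<theta> + pi) + q * x)" by (simp add: algebra_simps)
        ultimately show ?thesis by (simp only: cos_minus)
      qed
      ultimately show ?thesis by (intro exI[of _ "q * (\<theta> + pi)"] exI[of _ pi]) auto
    qed
  qed
qed

text \<open>The profile reaches its maximum \<open>1\<close> at the angle \<open>pi / q\<close> and is constant from there on.
  Truncation only increases it, and the constant \<open>1\<close> is supported by a cosine with its peak at the given angle.\<close>

lemma locally_supported_cos_truncated:
  assumes q: "1 < q"
  shows "locally_supported_by_cosines q (\<lambda>t. - cos (min (q * t) pi))"
  unfolding locally_supported_by_cosines_def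
proof (intro allI impI)
  fix \<theta> :: real assume \<theta>: "\<bar>\<theta>\<bar> \<le> pi"
  define a where "a = (\<lambda>\<theta>::real. arccos (cos \<theta>))"
  have ab: "a x = \<bar>x\<bar>" if "\<bar>x\<bar> \<le> pi" for x unfolding a_def using that by (simp add: arccos_cos_eq_abs)
  show "\<exists>\<beta> \<epsilon>. 0 < \<epsilon> \<and> - cos (min (q * arccos (cos \<theta>)) pi) = cos \<beta> \<and>
     (\<forall>x. \<bar>x\<bar> < \<epsilon> \<longrightarrow> cos (\<beta> + q * x) \<le> - cos (min (q * arccos (cos (\<theta> + x))) pi))"
  proof (cases "q * \<bar>\<theta>\<bar> \<le> pi")
    case True
    have lt: "\<bar>\<theta>\<bar> < pi"
    proof (cases "\<theta> = 0")
      case False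
      then have "1 * \<bar>\<theta>\<bar> < q * \<bar>\<theta>\<bar>" using q by (intro mult_strict_right_mono) auto
      then show ?thesis using True by simp
    qed simp
    have cq: "cos (q * \<bar>x\<bar>) = cos (q * x)" for x by (cases "0 \<le> x") auto
    have "- cos (min (q * a \<theta>) pi) = cos (q * \<theta> - pi)"
      using True \<theta> by (simp add: ab cq)
    moreover have "cos (q * \<theta> - pi + q * x) \<le> - cos (min (q * a (\<theta> + x)) pi)" if "\<bar>x\<bar> < pi - \<bar>\<theta>\<bar>" for x
    proof -
      have "a (\<theta> + x) = \<bar>\<theta> + x\<bar>" using that by (intro ab) auto
      moreover have "cos (q * \<theta> - pi + q * x) = - cos (q * \<bar>\<theta> + x\<bar>)"
        unfolding cq using cos_minus_pi[of "q * (\<theta> + x)"] by (simp add: algebra_simps)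
      ultimately show ?thesis by (auto simp: min_def)
    qed
    ultimately show ?thesis using lt unfolding a_def
      by (intro exI[of _ "q * \<theta> - pi"] exI[of _ "pi - \<bar>\<theta>\<bar>"]) auto
  next
    case False
    have "continuous_on UNIV a" unfolding a_def by (intro continuous_intros) auto
    then have "isCont a \<theta>" by (simp add: continuous_on_eq_continuous_at)
    moreover have "a \<theta> > pi / q" using False q \<theta> by (simp add: ab field_simps)
    then have "a \<theta> - pi / q > 0" by simp
    ultimately obtain d where d: "d > 0" "\<And>x. dist x \<theta> < d \<Longrightarrow> dist (a x) (a \<theta>) < a \<theta> - pi / q"
      unfolding continuous_at_eps_delta by blast
    have "pi / q < a (\<theta> + x)" if "\<bar>x\<bar> < d" for x
      using d(2)[of "\<theta> + x"] that by (simp add: dist_real_def abs_less_iff)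
    then have gt: "pi < q * a (\<theta> + x)" if "\<bar>x\<bar> < d" for x using that q by (simp add: pos_divide_less_eq mult.commute)
    then have one: "- cos (min (q * a (\<theta> + x)) pi) = 1" if "\<bar>x\<bar> < d" for x
      using gt[OF that] by (simp add: min_absorb2)
    show ?thesis using d(1) one one[of 0] unfolding a_def
      by (intro exI[of _ 0] exI[of _ d]) auto
  qed
qed

lemma square_powr_half: "0 \<le> x \<Longrightarrow> (x\<^sup>2) powr (p / 2) = x powr p" for x p :: real
  by (cases "x = 0") (auto simp: powr_powr simp flip: powr_numeral)

text \<open>Along a vertical line in the upper half-plane the function is the real part of a branch of a power, with
  derivative a positive multiple of \<open>sin (q * pi + (1 - q) * t)\<close>, where \<open>t\<close> is the argument.\<close>

lemma angular_power_reflected_mono: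
  assumes q: "0 < q" "q \<le> 1" and y: "0 \<le> y" "y \<le> y'"
  shows "angular_power q (\<lambda>t. cos (q * (pi - t))) (Complex x y) \<le> angular_power q (\<lambda>t. cos (q * (pi - t))) (Complex x y')"
proof -
  define \<Psi> where "\<Psi> = angular_power q (\<lambda>t. cos (q * (pi - t)))"
  define G where "G = (\<lambda>z. cis (- (q * pi)) * exp (of_real q * Ln z))"
  define f where "f = (\<lambda>y. \<Psi> (Complex x y))"
  have polar: "z = of_real (cmod z) * cis (Arg z)" for z
    using rcis_cmod_Arg[of z] by (simp add: rcis_def)
  have Gpolar: "exp (of_real q * Ln z) = of_real (cmod z powr q) * cis (q * Arg z)" if "z \<noteq> 0" for z
    using that by (simp add: exp_eq_polar powr_def Arg_eq_Im_Ln)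
  have ang: "arccos (Re z / cmod z) = Arg z" if "Im z > 0" for z
  proof -
    have "z \<noteq> 0" using that by auto
    have "Re z = cmod z * cos (Arg z)" by (subst polar) simp
    moreover have "0 < Arg z" "Arg z < pi" using that Arg_lt_pi[of z] by auto
    ultimately show ?thesis using \<open>z \<noteq> 0\<close> by (simp add: arccos_cos)
  qed
  have fG: "\<Psi> z = Re (G z)" if "Im z > 0" for z
  proof -
    have "z \<noteq> 0" using that by auto
    then have "G z = of_real (cmod z powr q) * cis (q * Arg z - q * pi)"
      unfolding G_def by (simp add: Gpolar flip: cis_mult) (simp add: mult_ac cis_mult)
    moreover have "cos (q * Arg z - q * pi) = cos (q * (pi - Arg z))"
      by (metis cos_minus minus_diff_eq right_diff_distrib)
    ultimately show ?thesis using ang[OF that] by (simp add: \<Psi>_def angular_power_def)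
  qed
  have cf: "continuous_on {y..y'} f"
  proof -
    have "continuous_on UNIV \<Psi>" unfolding \<Psi>_def using q
      by (intro continuous_on_angular_power continuous_intros)
    moreover have "f = (\<lambda>y. \<Psi> (of_real x + \<i> * of_real y))" by (simp add: f_def Complex_eq)
    ultimately show ?thesis
      by (auto intro!: continuous_on_compose2[of UNIV \<Psi>] continuous_intros)
  qed
  have df: "\<exists>d. DERIV f z :> d \<and> 0 \<le> d" if z: "y < z" "z < y'" for z
  proof -
    define w where "w = Complex x z"
    have w: "Im w > 0" "w \<noteq> 0" using z y by (auto simp: w_def complex_eq_iff)
    have "((\<lambda>y. Complex x y) has_vector_derivative \<i>) (at z)"
      unfolding Complex_eq by (auto intro!: derivative_eq_intros simp: has_vector_derivative_def scaleR_conv_of_real)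
    moreover have "(G has_field_derivative (cis (- (q * pi)) * (exp (of_real q * Ln w) * (of_real q * (1 / w))))) (at (Complex x z))"
      unfolding G_def w_def[symmetric] using w by (auto intro!: derivative_eq_intros simp: complex_nonpos_Reals_iff divide_inverse mult_ac)
    ultimately have "((G \<circ> Complex x) has_vector_derivative (\<i> * (cis (- (q * pi)) * (exp (of_real q * Ln w) * (of_real q * (1 / w)))))) (at z)"
      by (rule field_vector_diff_chain_at)
    from bounded_linear.has_vector_derivative[OF bounded_linear_Re this]
    have d: "DERIV (\<lambda>y. Re (G (Complex x y))) z :> Re (\<i> * (cis (- (q * pi)) * (exp (of_real q * Ln w) * (of_real q * (1 / w)))))"
      by (simp add: has_real_derivative_iff_has_vector_derivative o_def)
    have ev: "\<forall>\<^sub>F y in nhds z. f y = Re (G (Complex x y))"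
    proof -
      have "\<forall>\<^sub>F y in nhds z. y > 0" using z y by (intro eventually_nhds_in_open[of "{0<..}", simplified]) auto
      then show ?thesis by eventually_elim (simp add: f_def fG)
    qed
    have "DERIV f z :> Re (\<i> * (cis (- (q * pi)) * (exp (of_real q * Ln w) * (of_real q * (1 / w)))))"
      by (rule iffD2[OF DERIV_cong_ev[OF refl ev refl] d])
    moreover have "0 \<le> Re (\<i> * (cis (- (q * pi)) * (exp (of_real q * Ln w) * (of_real q * (1 / w)))))"
    proof -
      define t where "t = Arg w"
      have t: "0 < t" "t < pi" using w Arg_lt_pi[of w] by (auto simp: t_def)
      have wi: "1 / w = of_real (1 / cmod w) * cis (- t)"
        using w polar[of w] by (metis cis_divide cis_zero diff_0 divide_divide_eq_left mult_1 of_real_1 of_real_divide times_divide_times_eq t_def)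
      have "\<i> * (cis (- (q * pi)) * (exp (of_real q * Ln w) * (of_real q * (1 / w))))
        = of_real (q * cmod w powr q / cmod w) * (\<i> * (cis (- (q * pi)) * (cis (q * t) * cis (- t))))"
        unfolding Gpolar[OF w(2)] wi t_def[symmetric] by simp
      also have "\<dots> = of_real (q * cmod w powr q / cmod w) * (\<i> * cis (- (q * pi + (1 - q) * t)))"
        by (simp add: cis_mult algebra_simps)
      moreover have "Re (of_real c * (\<i> * cis (- a))) = c * sin a" for a c :: real by simp
      ultimately have e: "Re (\<i> * (cis (- (q * pi)) * (exp (of_real q * Ln w) * (of_real q * (1 / w)))))
        = q * cmod w powr q / cmod w * sin (q * pi + (1 - q) * t)" by (simp only:)
      have "(1 - q) * t \<le> (1 - q) * pi" using q t by (intro mult_left_mono) auto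
      then have "q * pi + (1 - q) * t \<le> pi" by (simp add: algebra_simps)
      then have "0 \<le> sin (q * pi + (1 - q) * t)" using q t by (intro sin_ge_zero add_nonneg_nonneg) auto
      then show ?thesis unfolding e using q by simp
    qed
    ultimately show ?thesis by blast
  qed
  have "f y \<le> f y'" by (rule DERIV_nonneg_imp_increasing_open[OF y(2) df cf])
  then show ?thesis by (simp add: f_def \<Psi>_def)
qed

text \<open>With \<open>S\<close> and \<open>Re \<zeta>\<close> fixed, only the control function depends on \<open>Im \<zeta>\<close>, and it increases with
  \<open>|Im \<zeta>|\<close>. So one may move \<open>\<zeta>\<close> vertically until \<open>2 |\<zeta>| = S\<close>, where the claim is
  \<open>sin_powr_le_interpolation\<close> at half the angle between \<open>\<zeta>\<close> and the negative axis.\<close>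

lemma pointwise_upper_small_exponent:
  fixes p :: real and \<zeta> :: complex
  assumes p: "1 < p" "p \<le> 2" and \<alpha>: "\<alpha> = pi / (2 * p)" and S: "2 * cmod \<zeta> \<le> S"
  shows "(S + 2 * Re \<zeta>) powr (p / 2) + 4 powr (p / 2) * (sin \<alpha> powr (p - 1) * cos \<alpha>) *
      angular_power (p / 2) (\<lambda>t. cos (p / 2 * (pi - t))) \<zeta> \<le> (2 * (sin \<alpha>)\<^sup>2 * S) powr (p / 2)"
proof (cases "S = 0")
  case True
  then have "\<zeta> = 0" using S by simp
  then show ?thesis using True p by (simp add: angular_power_def)
next
  case False
  then have S0: "0 < S" using S norm_ge_zero[of \<zeta>] by linarith
  define q where "q = p / 2"
  have q: "0 < q" "q \<le> 1" using p by (auto simp: q_def)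
  define \<Psi> where "\<Psi> = angular_power q (\<lambda>t. cos (q * (pi - t)))"
  define k where "k = sin \<alpha> powr (p - 1) * cos \<alpha>"
  have \<alpha>': "0 < \<alpha>" "\<alpha> < pi / 2" using p by (auto simp: \<alpha> field_simps)
  have sc: "0 < sin \<alpha>" "0 < cos \<alpha>" using \<alpha>' by (auto intro: sin_gt_zero cos_gt_zero)
  define x where "x = Re \<zeta>"
  define y' where "y' = sqrt ((S/2)\<^sup>2 - x\<^sup>2)"
  have "\<bar>x\<bar> \<le> cmod \<zeta>" unfolding x_def by (rule abs_Re_le_cmod)
  then have xS: "\<bar>x\<bar> \<le> S / 2" using S by simp
  have "(cmod \<zeta>)\<^sup>2 \<le> (S/2)\<^sup>2" using S by (intro power_mono) auto
  then have "(Im \<zeta>)\<^sup>2 \<le> (S/2)\<^sup>2 - x\<^sup>2" by (simp add: cmod_power2 x_def)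
  then have yy: "\<bar>Im \<zeta>\<bar> \<le> y'" unfolding y'_def by (metis real_sqrt_abs real_sqrt_le_mono)
  define \<zeta>' where "\<zeta>' = Complex x y'"
  have "x\<^sup>2 \<le> (S/2)\<^sup>2" using xS S0 by (metis abs_le_square_iff abs_of_pos half_gt_zero)
  then have c': "cmod \<zeta>' = S / 2" using S0 by (simp add: \<zeta>'_def cmod_def y'_def)
  have "\<Psi> \<zeta> = \<Psi> (Complex x \<bar>Im \<zeta>\<bar>)" by (simp add: \<Psi>_def angular_power_def x_def cmod_def)
  also have "\<dots> \<le> \<Psi> \<zeta>'" unfolding \<Psi>_def \<zeta>'_def using q yy by (intro angular_power_reflected_mono) auto
  finally have mono: "\<Psi> \<zeta> \<le> \<Psi> \<zeta>'" .
  define t where "t = arccos (Re \<zeta>' / cmod \<zeta>')"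
  have t: "0 \<le> t" "t \<le> pi" unfolding t_def by (rule angle_bounds)+
  have ct: "S / 2 * cos t = x" using cos_angle[of \<zeta>'] by (simp only: c' t_def) (simp add: \<zeta>'_def)
  define \<phi> where "\<phi> = (pi - t) / 2"
  have \<phi>: "0 \<le> \<phi>" "\<phi> \<le> pi / 2" using t by (auto simp: \<phi>_def)
  have "2 * \<phi> = pi - t" by (simp add: \<phi>_def)
  then have "cos t = - cos (2 * \<phi>)" by simp
  then have "1 + cos t = 2 * (sin \<phi>)\<^sup>2" by (simp add: cos_double_sin)
  moreover have "S + 2 * x = S * (1 + cos t)" using ct by (simp add: algebra_simps)
  ultimately have Sx: "S + 2 * x = 2 * S * (sin \<phi>)\<^sup>2" by simp
  have s0: "0 \<le> sin \<phi>" using \<phi> by (intro sin_ge_zero) auto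
  have A: "(S + 2 * x) powr q = (2 * S) powr q * sin \<phi> powr p"
    unfolding Sx q_def using S0 s0 by (simp add: powr_mult square_powr_half)
  have B: "\<Psi> \<zeta>' = (S / 2) powr q * cos (p * \<phi>)"
  proof -
    have "\<Psi> \<zeta>' = cmod \<zeta>' powr q * cos (q * (pi - t))" by (simp only: \<Psi>_def angular_power_def t_def)
    then show ?thesis by (simp add: c' \<phi>_def q_def)
  qed
  have C: "4 powr q * (S / 2) powr q = (2 * S) powr q"
  proof -
    have "4 powr q * (S / 2) powr q = (4 * (S / 2)) powr q" using S0 by (subst powr_mult) auto
    then show ?thesis by simp
  qed
  have "(S + 2 * x) powr q + 4 powr q * k * \<Psi> \<zeta> \<le> (S + 2 * x) powr q + 4 powr q * k * \<Psi> \<zeta>'"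
    using mono sc by (intro add_left_mono mult_left_mono) (auto simp: k_def)
  also have "\<dots> = (2 * S) powr q * sin \<phi> powr p + (4 powr q * (S / 2) powr q) * (k * cos (p * \<phi>))"
    unfolding A B by (simp add: mult_ac)
  also have "\<dots> = (2 * S) powr q * (sin \<phi> powr p + k * cos (p * \<phi>))"
    unfolding C by (simp add: algebra_simps)
  also have "\<dots> \<le> (2 * S) powr q * sin \<alpha> powr p"
    unfolding k_def using sin_powr_le_interpolation[OF p \<alpha> \<phi>] by (intro mult_left_mono) auto
  also have "\<dots> = (2 * (sin \<alpha>)\<^sup>2 * S) powr q"
  proof -
    have e: "2 * (sin \<alpha>)\<^sup>2 * S = (2 * S) * (sin \<alpha>)\<^sup>2" by simp
    show ?thesis unfolding e using S0 sc by (simp add: powr_mult q_def square_powr_half)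
  qed
  finally show ?thesis by (simp add: q_def k_def \<Psi>_def x_def)
qed

lemma powr_convex_combination:
  fixes a b s q :: real
  assumes "0 < a" "0 \<le> b" "0 \<le> s" "s < 1" "1 \<le> q"
  shows "((1 - s) * a + s * b) powr q \<le> (1 - s) * a powr q + s * b powr q"
proof -
  define m where "m = (1 - s) * a + s * b"
  have m: "m > 0" unfolding m_def using assms by (intro add_pos_nonneg mult_pos_pos) auto
  have "m powr q = (1 - s) * (m powr q + q * m powr (q - 1) * (a - m)) + s * (m powr q + q * m powr (q - 1) * (b - m))"
    unfolding m_def by (simp add: algebra_simps)
  also have "\<dots> \<le> (1 - s) * a powr q + s * b powr q"
    using assms m by (intro add_mono mult_left_mono powr_tangent) auto
  finally show ?thesis by (simp add: m_def)
qed

text \<open>On the boundary \<open>2 |\<zeta>| = S\<close> the claim is \<open>cos_powr_le_interpolation\<close> at half the angle between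
  \<open>\<zeta>\<close> and the positive axis (fact \<open>diag\<close>). If the profile \<open>V\<close> is nonnegative at this angle, then with the angle and
  \<open>S\<close> fixed the left-hand side is convex in \<open>|\<zeta>|\<close> and the claim follows from the two extreme cases. If \<open>V\<close> is negative there, then
  \<open>Re \<zeta> \<ge> 0\<close> and the difference of the two powers increases with \<open>S\<close>, so that the smallest
  admissible \<open>S\<close> is the worst.\<close>

lemma pointwise_upper_large_exponent:
  fixes p :: real and \<zeta> :: complex
  assumes p: "2 < p" and \<alpha>: "\<alpha> = pi / (2 * p)" and S: "2 * cmod \<zeta> \<le> S"
  shows "(S + 2 * Re \<zeta>) powr (p / 2) + 4 powr (p / 2) * (sin \<alpha> * cos \<alpha> powr (p - 1)) *
      angular_power (p / 2) (\<lambda>t. - cos (min (p / 2 * t) pi)) \<zeta> \<le> (2 * (cos \<alpha>)\<^sup>2 * S) powr (p / 2)"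
proof -
  define q where "q = p / 2"
  have q: "1 < q" using p by (auto simp: q_def)
  define V where "V = (\<lambda>t. - cos (min (q * t) pi))"
  define k where "k = sin \<alpha> * cos \<alpha> powr (p - 1)"
  have \<alpha>': "0 < \<alpha>" "\<alpha> < pi / 2" "\<alpha> \<le> pi / 4" using p by (auto simp: \<alpha> field_simps)
  have sc: "0 < sin \<alpha>" "0 < cos \<alpha>" using \<alpha>' by (auto intro: sin_gt_zero cos_gt_zero)
  have k0: "0 \<le> k" using sc by (simp add: k_def)
  define c2 where "c2 = 2 * (cos \<alpha>)\<^sup>2"
  have s1: "cos (t/2) powr p + k * V t \<le> cos \<alpha> powr p" if t: "0 \<le> t" "t \<le> pi" for t
  proof (cases "q * t \<le> pi")
    case True
    have "t / 2 \<le> pi / p" using True p by (simp add: q_def field_simps)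
    moreover have "V t = - cos (p * (t / 2))" using True by (simp add: V_def q_def)
    ultimately show ?thesis using cos_powr_le_interpolation[of p \<alpha> "t/2"] p \<alpha> t by (simp add: k_def)
  next
    case False
    have "cos (t / 2) \<le> cos (pi / p)" using False p t by (intro cos_monotone_0_pi_le) (auto simp: q_def field_simps)
    moreover have "0 \<le> cos (t / 2)" using t by (intro cos_ge_zero) auto
    ultimately have "cos (t / 2) powr p \<le> cos (pi / p) powr p" using p by (intro powr_mono2) auto
    also have "\<dots> \<le> cos \<alpha> powr p + k * cos (p * (pi / p))"
      unfolding k_def using p \<alpha> by (intro cos_powr_le_interpolation) auto
    finally show ?thesis using False p by (simp add: V_def)
  qed
  have "1 \<le> cos \<alpha> powr p + k"
    using cos_powr_le_interpolation[of p \<alpha> 0] p \<alpha> by (simp add: k_def)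
  also have "k \<le> cos \<alpha> * cos \<alpha> powr (p - 1)"
  proof -
    have "sin \<alpha> \<le> sin (pi / 4)" "cos (pi / 4) \<le> cos \<alpha>"
      using \<alpha>' by (auto intro!: sin_monotone_2pi_le cos_monotone_0_pi_le)
    then have "sin \<alpha> \<le> cos \<alpha>" by (simp add: sin_45 cos_45)
    then show ?thesis unfolding k_def by (intro mult_right_mono) auto
  qed
  also have "\<dots> = cos \<alpha> powr p" using sc by (simp add: powr_diff)
  \<comment> \<open>This is \<open>cos_powr_le_interpolation\<close> at \<open>0\<close>.\<close>
  finally have half: "1 \<le> 2 * cos \<alpha> powr p" by simp
  have "sqrt 2 / 2 \<le> cos \<alpha>" using cos_monotone_0_pi_le[of \<alpha> "pi/4"] \<alpha>' by (simp add: cos_45)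
  then have "(sqrt 2 / 2)\<^sup>2 \<le> (cos \<alpha>)\<^sup>2" by (intro power_mono) auto
  then have c21: "1 \<le> c2" by (simp add: c2_def power_divide)
  have c2p: "(c2 * x) powr q = (2 * x) powr q * cos \<alpha> powr p" if "0 \<le> x" for x
  proof -
    have e: "c2 * x = (2 * x) * (cos \<alpha>)\<^sup>2" by (simp add: c2_def)
    show ?thesis unfolding e using that sc by (simp add: powr_mult q_def square_powr_half)
  qed
  define \<rho> where "\<rho> = cmod \<zeta>"
  define t where "t = arccos (Re \<zeta> / cmod \<zeta>)"
  have t: "0 \<le> t" "t \<le> pi" unfolding t_def by (rule angle_bounds)+
  have ct: "\<rho> * cos t = Re \<zeta>" using cos_angle[of \<zeta>] by (simp add: \<rho>_def t_def)
  have \<rho>: "0 \<le> \<rho>" "2 * \<rho> \<le> S" using S by (auto simp: \<rho>_def)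
  have c1: "1 + cos t = 2 * (cos (t / 2))\<^sup>2" using cos_double_cos[of "t/2"] by simp
  have ch: "0 \<le> cos (t / 2)" using t by (intro cos_ge_zero) auto
  have lin: "(x * (1 + cos t)) powr q = (2 * x) powr q * cos (t / 2) powr p" if "0 \<le> x" for x
  proof -
    have e: "x * (1 + cos t) = (2 * x) * (cos (t / 2))\<^sup>2" by (simp add: c1)
    show ?thesis unfolding e using that ch by (simp add: powr_mult q_def square_powr_half)
  qed
  have four: "4 powr q * (x / 2) powr q = (2 * x) powr q" if "0 \<le> x" for x
  proof -
    have "4 powr q * (x / 2) powr q = (4 * (x / 2)) powr q" using that by (subst powr_mult) auto
    then show ?thesis by simp
  qed
  have diag: "(x * (1 + cos t)) powr q + 4 powr q * k * ((x / 2) powr q * V t) \<le> (c2 * x) powr q" if "0 \<le> x" for x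
  proof -
    have "(x * (1 + cos t)) powr q + 4 powr q * k * ((x / 2) powr q * V t)
       = (2 * x) powr q * cos (t / 2) powr p + (4 powr q * (x / 2) powr q) * (k * V t)"
      unfolding lin[OF that] by (simp add: mult_ac)
    also have "\<dots> = (2 * x) powr q * (cos (t / 2) powr p + k * V t)"
      unfolding four[OF that] by (simp add: algebra_simps)
    also have "\<dots> \<le> (2 * x) powr q * cos \<alpha> powr p" using s1[OF t] by (intro mult_left_mono) auto
    finally show ?thesis using c2p[OF that] by simp
  qed
  have goal: "(S + 2 * (\<rho> * cos t)) powr q + 4 powr q * k * (\<rho> powr q * V t) \<le> (c2 * S) powr q"
  proof (cases "\<rho> = 0 \<or> S = 2 * \<rho>")
    case True
    then show ?thesis
    proof
      assume r0: "\<rho> = 0"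
      have "S powr q \<le> (c2 * S) powr q" using c21 \<rho> r0 q mult_right_mono[of 1 c2 S] by (intro powr_mono2) auto
      then show ?thesis using r0 q by simp
    next
      assume "S = 2 * \<rho>"
      then show ?thesis using diag[of S] \<rho> by (simp add: algebra_simps)
    qed
  next
    case False
    then have \<rho>0: "0 < \<rho>" "2 * \<rho> < S" using \<rho> by auto
    have S0: "0 < S" using \<rho>0 by simp
    show ?thesis
    proof (cases "0 \<le> V t")
      case True
      define s where "s = 2 * \<rho> / S"
      have s: "0 < s" "s < 1" using \<rho>0 S0 by (auto simp: s_def)
      have \<rho>s: "\<rho> = s * (S / 2)" using S0 by (simp add: s_def)
      have "S + 2 * (\<rho> * cos t) = (1 - s) * S + s * (S * (1 + cos t))" unfolding \<rho>s by (simp add: algebra_simps)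
      also have "\<dots> powr q \<le> (1 - s) * S powr q + s * (S * (1 + cos t)) powr q"
      proof (rule powr_convex_combination)
        have "0 \<le> 1 + cos t" using cos_ge_minus_one[of t] by linarith
        then show "0 \<le> S * (1 + cos t)" using S0 by simp
      qed (use S0 s q in auto)
      finally have 1: "(S + 2 * (\<rho> * cos t)) powr q \<le> (1 - s) * S powr q + s * (S * (1 + cos t)) powr q" .
      have "s powr q \<le> s powr 1" using s q by (intro powr_mono') auto
      then have "s powr q * (S / 2) powr q \<le> s * (S / 2) powr q" using s by (intro mult_right_mono) auto
      then have "\<rho> powr q \<le> s * (S / 2) powr q" unfolding \<rho>s by (simp only: powr_mult)
      then have 2: "4 powr q * k * (\<rho> powr q * V t) \<le> 4 powr q * k * (s * (S / 2) powr q * V t)"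
        using True k0 by (intro mult_left_mono mult_right_mono) auto
      have "S powr q \<le> (c2 * S) powr q" using c21 S0 q mult_right_mono[of 1 c2 S] by (intro powr_mono2) auto
      then have 3: "(1 - s) * S powr q \<le> (1 - s) * (c2 * S) powr q" using s by (intro mult_left_mono) auto
      have 4: "s * ((S * (1 + cos t)) powr q + 4 powr q * k * ((S / 2) powr q * V t)) \<le> s * (c2 * S) powr q"
        using diag[of S] S0 s by (intro mult_left_mono) auto
      have "(S + 2 * (\<rho> * cos t)) powr q + 4 powr q * k * (\<rho> powr q * V t)
        \<le> (1 - s) * S powr q + s * (S * (1 + cos t)) powr q + 4 powr q * k * (s * (S / 2) powr q * V t)"
        using 1 2 by linarith
      also have "\<dots> = (1 - s) * S powr q + s * ((S * (1 + cos t)) powr q + 4 powr q * k * ((S / 2) powr q * V t))"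
        by (simp add: algebra_simps)
      also have "\<dots> \<le> (1 - s) * (c2 * S) powr q + s * (c2 * S) powr q" using 3 4 by linarith
      also have "\<dots> = (c2 * S) powr q" by (simp add: algebra_simps)
      finally show ?thesis .
    next
      case False
      have "q * t < pi / 2"
      proof (rule ccontr)
        assume "\<not> ?thesis"
        then have "0 \<le> - cos (min (q * t) pi)" using cos_monotone_0_pi_le[of "pi/2" "min (q * t) pi"] by auto
        then show False using False by (simp add: V_def)
      qed
      then have "t < pi / 2" using q t mult_right_mono[of 1 q t] by simp
      then have c0: "0 \<le> cos t" using t by (intro cos_ge_zero) auto
      define x where "x = \<rho> * cos t"
      have x: "0 \<le> x" "x \<le> \<rho>" using c0 \<rho>0 by (auto simp: x_def mult_left_le)
      define G where "G = (\<lambda>S. (c2 * S) powr q - (S + 2 * x) powr q)"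
      have "G (2 * \<rho>) \<le> G S"
      proof (rule DERIV_nonneg_imp_nondecreasing[of "2 * \<rho>" S G])
        show "2 * \<rho> \<le> S" using \<rho>0 by simp
        fix z assume z: "2 * \<rho> \<le> z" "z \<le> S"
        then have z0: "z > 0" using \<rho>0 by simp
        have "DERIV G z :> q * (c2 * z) powr (q - 1) * c2 - q * (z + 2 * x) powr (q - 1)"
          unfolding G_def using z0 x c21 by (auto intro!: derivative_eq_intros)
        moreover have "(z + 2 * x) powr (q - 1) \<le> (c2 * z) powr (q - 1) * c2"
        proof -
          have "(z + 2 * x) powr (q - 1) \<le> (2 * z) powr (q - 1)" using z x z0 q by (intro powr_mono2) auto
          also have "\<dots> * (2 * z) = (2 * z) powr q" using z0 by (simp add: powr_diff)
          then have "(2 * z) powr (q - 1) = (2 * z) powr q / (2 * z)" using z0 by (simp add: field_simps)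
          also have "\<dots> \<le> (2 * (2 * z) powr q * cos \<alpha> powr p) / (2 * z)"
            using half z0 mult_left_mono[OF half, of "(2 * z) powr q"] by (intro divide_right_mono) auto
          also have "\<dots> = (c2 * z) powr q / z" using c2p[of z] z0 by simp
          also have "\<dots> = (c2 * z) powr (q - 1) * c2" using z0 c21 by (simp add: powr_diff)
          finally show ?thesis .
        qed
        then have "0 \<le> q * (c2 * z) powr (q - 1) * c2 - q * (z + 2 * x) powr (q - 1)"
          using q mult_left_mono[of "(z + 2 * x) powr (q - 1)" "(c2 * z) powr (q - 1) * c2" q] by (simp add: mult.assoc)
        ultimately show "\<exists>d. DERIV G z :> d \<and> 0 \<le> d" by blast
      qed
      moreover have "4 powr q * k * (\<rho> powr q * V t) \<le> G (2 * \<rho>)"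
        using diag[of "2 * \<rho>"] \<rho>0 by (simp add: G_def x_def algebra_simps)
      ultimately show ?thesis by (simp add: G_def x_def)
    qed
  qed
  have "angular_power q V \<zeta> = \<rho> powr q * V t" by (simp add: angular_power_def \<rho>_def t_def)
  then show ?thesis using goal by (simp add: ct c2_def q_def k_def V_def)
qed

text \<open>The properties through which \<open>\<Psi>\<close> acts on both estimates. The value at \<open>1/2\<close> serves
  the reverse inequality: it makes \<open>\<Psi>\<close> negative on the positive axis, where \<open>- g h\<close> lies at
  points with \<open>f = 0\<close> and \<open>g \<noteq> 0\<close>.\<close>

definition control_function :: "real \<Rightarrow> (complex \<Rightarrow> real) \<Rightarrow> real \<Rightarrow> bool" where
  "control_function p \<Psi> d \<longleftrightarrow> 0 \<le> d \<and> continuous_on UNIV \<Psi> \<and> \<Psi> 0 = 0 \<and>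
     (\<forall>\<zeta>. \<zeta> \<noteq> 0 \<longrightarrow> supported_by_Re_holomorphic \<Psi> \<zeta>) \<and>
     (\<forall>c \<zeta>. 0 < c \<longrightarrow> \<Psi> (of_real c * \<zeta>) = c powr (p / 2) * \<Psi> \<zeta>) \<and>
     (\<forall>\<zeta>. Re \<zeta> \<le> 0 \<longrightarrow> 0 \<le> \<Psi> \<zeta>) \<and> \<Psi> (1/2) < 0 \<and>
     (\<forall>z w. cmod (z + cnj w) powr p + d * \<Psi> (z * w) \<le>
        (sqrt 2 * max (sin (pi / (2 * p))) (cos (pi / (2 * p)))) powr p * ((cmod z)\<^sup>2 + (cmod w)\<^sup>2) powr (p / 2))"

text \<open>The angle at which the profile vanishes is \<open>pi - pi / p\<close> for \<open>p \<le> 2\<close> and \<open>pi / p\<close> for \<open>p > 2\<close>. In both cases it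
  is at most a right angle, which gives nonnegativity on the left half-plane.\<close>

lemma exists_control_function:
  fixes p :: real
  assumes p: "1 < p"
  shows "\<exists>\<Psi> d. control_function p \<Psi> d"
proof -
  define \<alpha> where "\<alpha> = pi / (2 * p)"
  have \<alpha>': "0 < \<alpha>" "\<alpha> < pi / 2" using p by (auto simp: \<alpha>_def field_simps)
  have sc: "0 < sin \<alpha>" "0 < cos \<alpha>" using \<alpha>' by (auto intro: sin_gt_zero cos_gt_zero)
  have expand: "cmod (z + cnj w) powr p = ((cmod z)\<^sup>2 + (cmod w)\<^sup>2 + 2 * Re (z * w)) powr (p / 2)" for z w
  proof -
    have "(cmod (z + cnj w))\<^sup>2 = (cmod z)\<^sup>2 + (cmod w)\<^sup>2 + 2 * Re (z * w)"
      unfolding cmod_power2 by (simp add: power2_eq_square algebra_simps)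
    then show ?thesis using square_powr_half[of "cmod (z + cnj w)" p] by simp
  qed
  have amgm: "2 * cmod (z * w) \<le> (cmod z)\<^sup>2 + (cmod w)\<^sup>2" for z w
    using sum_squares_bound[of "cmod z" "cmod w"] by (simp add: norm_mult mult.assoc)
  have const: "(2 * m\<^sup>2 * S) powr (p / 2) = (sqrt 2 * m) powr p * S powr (p / 2)" if "0 \<le> m" "0 \<le> S" for m S
  proof -
    have e: "2 * m\<^sup>2 * S = (sqrt 2 * m)\<^sup>2 * S" by (simp add: power_mult_distrib)
    have "((sqrt 2 * m)\<^sup>2) powr (p / 2) = (sqrt 2 * m) powr p" using that by (intro square_powr_half) auto
    then show ?thesis unfolding e using that by (subst powr_mult) auto
  qed
  show ?thesis
  proof (cases "p \<le> 2")
    case True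
    define V where "V = (\<lambda>t. cos (p / 2 * (pi - t)))"
    define d where "d = 4 powr (p / 2) * (sin \<alpha> powr (p - 1) * cos \<alpha>)"
    have "cos \<alpha> \<le> sin \<alpha>"
    proof -
      have "pi / 4 \<le> \<alpha>" using True p by (simp add: \<alpha>_def field_simps)
      then have "sin (pi / 4) \<le> sin \<alpha>" "cos \<alpha> \<le> cos (pi / 4)"
        using \<alpha>' by (auto intro!: sin_monotone_2pi_le cos_monotone_0_pi_le)
      then show ?thesis by (simp add: sin_45 cos_45)
    qed
    then have mx: "max (sin \<alpha>) (cos \<alpha>) = sin \<alpha>" by simp
    show ?thesis unfolding control_function_def
    proof (intro exI[of _ "angular_power (p / 2) V"] exI[of _ d] conjI allI impI)
      show "0 \<le> d" using sc by (simp add: d_def)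
      show "continuous_on UNIV (angular_power (p / 2) V)" unfolding V_def using p
        by (intro continuous_on_angular_power continuous_intros) auto
      show "angular_power (p / 2) V 0 = 0" by (simp add: angular_power_def)
      show "supported_by_Re_holomorphic (angular_power (p / 2) V) \<zeta>" if "\<zeta> \<noteq> 0" for \<zeta>
        unfolding V_def using that p True by (intro supported_angular_power locally_supported_cos_reflected) auto
      show "angular_power (p / 2) V (of_real c * \<zeta>) = c powr (p / 2) * angular_power (p / 2) V \<zeta>" if "0 < c" for c \<zeta>
        by (rule angular_power_scale[OF that])
      show "0 \<le> angular_power (p / 2) V \<zeta>" if "Re \<zeta> \<le> 0" for \<zeta>
      proof -
        define t where "t = arccos (Re \<zeta> / cmod \<zeta>)"
        have t: "0 \<le> t" "t \<le> pi" unfolding t_def by (rule angle_bounds)+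
        have "arccos 0 \<le> t" unfolding t_def using that Re_div_cmod_bounds[of \<zeta>]
          by (subst arccos_le_arccos) (auto simp: divide_le_0_iff)
        then have "p / 2 * (pi - t) \<le> 1 * (pi / 2)" using True p t by (intro mult_mono) auto
        then have "0 \<le> V t" unfolding V_def using p t by (intro cos_ge_zero) (auto intro: order_trans[of _ 0])
        then show ?thesis by (simp add: angular_power_def t_def)
      qed
      have "cos (p / 2 * pi) < 0"
      proof -
        have "cos (p / 2 * pi) < cos (pi / 2)" using p True by (intro cos_monotone_0_pi) (auto simp: field_simps)
        then show ?thesis by simp
      qed
      then show "angular_power (p / 2) V (1/2) < 0"
        by (simp add: angular_power_def V_def mult_pos_neg)
      show "cmod (z + cnj w) powr p + d * angular_power (p / 2) V (z * w) \<le>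
        (sqrt 2 * max (sin (pi / (2 * p))) (cos (pi / (2 * p)))) powr p * ((cmod z)\<^sup>2 + (cmod w)\<^sup>2) powr (p / 2)" for z w
        using pointwise_upper_small_exponent[OF p True \<alpha>_def amgm[of z w]] sc
        unfolding expand \<alpha>_def[symmetric] mx d_def V_def by (simp add: const)
    qed
  next
    case False
    define V where "V = (\<lambda>t. - cos (min (p / 2 * t) pi))"
    define d where "d = 4 powr (p / 2) * (sin \<alpha> * cos \<alpha> powr (p - 1))"
    have "sin \<alpha> \<le> cos \<alpha>"
    proof -
      have "\<alpha> \<le> pi / 4" using False p by (simp add: \<alpha>_def field_simps)
      then have "sin \<alpha> \<le> sin (pi / 4)" "cos (pi / 4) \<le> cos \<alpha>"
        using \<alpha>' by (auto intro!: sin_monotone_2pi_le cos_monotone_0_pi_le)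
      then show ?thesis by (simp add: sin_45 cos_45)
    qed
    then have mx: "max (sin \<alpha>) (cos \<alpha>) = cos \<alpha>" by simp
    show ?thesis unfolding control_function_def
    proof (intro exI[of _ "angular_power (p / 2) V"] exI[of _ d] conjI allI impI)
      show "0 \<le> d" using sc by (simp add: d_def)
      show "continuous_on UNIV (angular_power (p / 2) V)" unfolding V_def using p
        by (intro continuous_on_angular_power continuous_intros) auto
      show "angular_power (p / 2) V 0 = 0" by (simp add: angular_power_def)
      show "supported_by_Re_holomorphic (angular_power (p / 2) V) \<zeta>" if "\<zeta> \<noteq> 0" for \<zeta>
        unfolding V_def using that False by (intro supported_angular_power locally_supported_cos_truncated) auto
      show "angular_power (p / 2) V (of_real c * \<zeta>) = c powr (p / 2) * angular_power (p / 2) V \<zeta>" if "0 < c" for c \<zeta>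
        by (rule angular_power_scale[OF that])
      show "0 \<le> angular_power (p / 2) V \<zeta>" if "Re \<zeta> \<le> 0" for \<zeta>
      proof -
        define t where "t = arccos (Re \<zeta> / cmod \<zeta>)"
        have "arccos 0 \<le> t" unfolding t_def using that Re_div_cmod_bounds[of \<zeta>]
          by (subst arccos_le_arccos) (auto simp: divide_le_0_iff)
        then have "1 * (pi / 2) \<le> p / 2 * t" using False by (intro mult_mono) auto
        then have "cos (min (p / 2 * t) pi) \<le> cos (pi / 2)" by (intro cos_monotone_0_pi_le) auto
        then have "0 \<le> V t" unfolding V_def by simp
        then show ?thesis by (simp add: angular_power_def t_def)
      qed
      show "angular_power (p / 2) V (1/2) < 0"
        by (simp add: angular_power_def V_def)
      show "cmod (z + cnj w) powr p + d * angular_power (p / 2) V (z * w) \<le>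
        (sqrt 2 * max (sin (pi / (2 * p))) (cos (pi / (2 * p)))) powr p * ((cmod z)\<^sup>2 + (cmod w)\<^sup>2) powr (p / 2)" for z w
        using pointwise_upper_large_exponent[OF _ \<alpha>_def amgm[of z w]] False sc
        unfolding expand \<alpha>_def[symmetric] mx d_def V_def by (simp add: const)
    qed
  qed
qed

section \<open>The upper estimate\<close>

text \<open>Both sides are homogeneous, so it suffices to consider the unit sphere. Where
  \<open>z + cnj w = 0\<close> one has \<open>- (z * w) = 1/2\<close> on the sphere, so a suitable \<open>B\<close> makes the second term equal to
  \<open>2\<close>. It stays above \<open>1\<close> near these points, and on the compact rest a large \<open>A\<close> suffices.\<close>

lemma pair_norm_le_harmonic_minus_control:
  fixes \<Psi> :: "complex \<Rightarrow> real"
  assumes p: "1 < p" and c: "continuous_on UNIV \<Psi>"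
    and hom: "\<And>c \<zeta>. 0 < c \<Longrightarrow> \<Psi> (of_real c * \<zeta>) = c powr (p / 2) * \<Psi> \<zeta>" and neg: "\<Psi> (1/2) < 0" and z0: "\<Psi> 0 = 0"
  shows "\<exists>A\<ge>0. \<exists>B\<ge>0. \<forall>z w. ((cmod z)\<^sup>2 + (cmod w)\<^sup>2) powr (p / 2) \<le> A * cmod (z + cnj w) powr p - B * \<Psi> (- (z * w))"
proof -
  define B where "B = - 2 / \<Psi> (1/2)"
  have B: "B \<ge> 0" using neg by (simp add: B_def divide_nonpos_neg)
  define F where "F = (\<lambda>v::complex \<times> complex. - B * \<Psi> (- (fst v * snd v)))"
  define D where "D = (\<lambda>v::complex \<times> complex. cmod (fst v + cnj (snd v)) powr p)"
  have cF: "continuous_on UNIV F" unfolding F_def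
    by (intro continuous_intros continuous_on_compose2[OF c]) auto
  have cD: "continuous_on UNIV D" unfolding D_def using p
    by (intro continuous_on_norm_powr continuous_intros) auto
  define K where "K = sphere 0 1 \<inter> {v. F v \<le> 1}"
  have K: "compact K" unfolding K_def
    by (intro compact_Int_closed closed_Collect_le cF continuous_on_const) auto
  have Dpos: "0 < D v" if "v \<in> K" for v
  proof -
    obtain z w where v: "v = (z, w)" by (cases v)
    have "z + cnj w \<noteq> 0"
    proof
      assume "z + cnj w = 0"
      then have w: "w = - cnj z" by (metis add_eq_0_iff complex_cnj_cnj complex_cnj_minus minus_minus)
      have "norm v = 1" using that by (auto simp: K_def)
      then have "(cmod z)\<^sup>2 + (cmod w)\<^sup>2 = 1" by (simp add: v norm_Pair)
      then have "(cmod z)\<^sup>2 = 1 / 2" by (simp add: w)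
      moreover have "- (z * w) = of_real ((cmod z)\<^sup>2)" using complex_norm_square[of z] by (simp add: w)
      ultimately have "- (z * w) = 1 / 2" by (metis of_real_divide of_real_1 of_real_numeral)
      then have "F v = - B * \<Psi> (1 / 2)" by (simp only: F_def v fst_conv snd_conv)
      then have "F v = 2" using neg by (simp add: B_def)
      then show False using that by (simp add: K_def)
    qed
    then show ?thesis by (simp add: D_def v)
  qed
  obtain \<delta> where \<delta>: "\<delta> > 0" "\<And>v. v \<in> K \<Longrightarrow> \<delta> \<le> D v"
  proof (cases "K = {}")
    case True then show ?thesis using that[of 1] by auto
  next
    case False
    then obtain v where "v \<in> K" "\<And>w. w \<in> K \<Longrightarrow> D v \<le> D w"
      using continuous_attains_inf[OF K False continuous_on_subset[OF cD]] by auto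
    then show ?thesis using that[of "D v"] Dpos by auto
  qed
  have "bounded (F ` sphere 0 1)"
    by (intro compact_imp_bounded compact_continuous_image continuous_on_subset[OF cF]) auto
  then obtain M where M: "M > 0" "\<And>v. v \<in> sphere 0 1 \<Longrightarrow> \<bar>F v\<bar> \<le> M" unfolding bounded_pos by auto
  define A where "A = (1 + M) / \<delta>"
  have A: "A \<ge> 0" using M \<delta> by (simp add: A_def)
  have S: "1 \<le> A * D v + F v" if "v \<in> sphere 0 1" for v
  proof (cases "v \<in> K")
    case True
    have "1 + M = A * \<delta>" using \<delta> by (simp add: A_def)
    also have "\<dots> \<le> A * D v" using \<delta>(2)[OF True] A by (rule mult_left_mono)
    finally show ?thesis using M(2)[OF that] by linarith
  next
    case False
    then have "1 \<le> F v" using that by (auto simp: K_def)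
    moreover have "0 \<le> A * D v" using A by (simp add: D_def)
    ultimately show ?thesis by linarith
  qed
  have "((cmod z)\<^sup>2 + (cmod w)\<^sup>2) powr (p / 2) \<le> A * cmod (z + cnj w) powr p - B * \<Psi> (- (z * w))" for z w
  proof (cases "z = 0 \<and> w = 0")
    case True
    then show ?thesis using z0 by simp
  next
    case False
    define n where "n = norm (z, w)"
    have n: "n > 0" using False by (auto simp: n_def norm_Pair sum_power2_gt_zero_iff)
    define v where "v = (1 / n) *\<^sub>R (z, w)"
    have "norm v = \<bar>1 / n\<bar> * norm (z, w)" unfolding v_def by (rule norm_scaleR)
    then have vs: "v \<in> sphere 0 1" using n by (simp add: n_def)
    have "((cmod z)\<^sup>2 + (cmod w)\<^sup>2) powr (p / 2) = n powr p * 1"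
      using square_powr_half[of n p] n by (simp add: n_def norm_Pair)
    also have "\<dots> \<le> n powr p * (A * D v + F v)" using S[OF vs] by (intro mult_left_mono) auto
    also have "\<dots> = A * (n powr p * D v) + n powr p * F v" by (simp add: algebra_simps)
    also have "n powr p * D v = cmod (z + cnj w) powr p"
    proof -
      have "fst v + cnj (snd v) = (1 / n) *\<^sub>R (z + cnj w)" by (simp add: v_def algebra_simps)
      then have "D v = (cmod (z + cnj w) / n) powr p" using n by (simp add: D_def)
      then show ?thesis using n by (simp add: powr_divide)
    qed
    also have "n powr p * F v = - B * \<Psi> (- (z * w))"
    proof -
      have e: "- (z * w) = of_real (n\<^sup>2) * - (fst v * snd v)" using n by (simp add: v_def scaleR_conv_of_real power2_eq_square)
      have "\<Psi> (- (z * w)) = (n\<^sup>2) powr (p / 2) * \<Psi> (- (fst v * snd v))"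
        unfolding e by (rule hom) (use n in simp)
      then show ?thesis using square_powr_half[of n p] n by (simp add: F_def)
    qed
    finally show ?thesis by simp
  qed
  then show ?thesis using A B by blast
qed

lemma hp_norm_le_pair_norm:
  assumes p: "1 < p" and adm: "admissible p f g h"
  shows "hp_norm p f \<le> sqrt 2 * max (sin (pi / (2 * p))) (cos (pi / (2 * p))) * pair_norm p g h"
proof -
  define c where "c = sqrt 2 * max (sin (pi / (2 * p))) (cos (pi / (2 * p)))"
  have c0: "0 \<le> c"
  proof -
    have "0 \<le> pi / (2 * p)" "pi / (2 * p) \<le> pi / 2" using p by (auto simp: field_simps)
    then have "0 \<le> cos (pi / (2 * p))" using pi_gt_zero by (intro cos_ge_zero) linarith+
    then have "0 \<le> max (sin (pi / (2 * p))) (cos (pi / (2 * p)))" by (rule max.coboundedI2)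
    then show ?thesis unfolding c_def by (intro mult_nonneg_nonneg) simp_all
  qed
  have hol: "g holomorphic_on ball 0 1" "h holomorphic_on ball 0 1"
    and f: "\<And>z. z \<in> ball 0 1 \<Longrightarrow> f z = g z + cnj (h z)" and gh0: "Re (g 0 * h 0) \<le> 0"
    and bdd: "bdd_above (hp_mean p f ` {0<..<1})"
    using adm by (auto simp: admissible_def hp_class_def)
  obtain \<Psi> d where ctrl: "control_function p \<Psi> d" using exists_control_function[OF p] by blast
  have d: "0 \<le> d" and \<Psi>: "continuous_on UNIV \<Psi>" "\<Psi> 0 = 0" "\<And>\<zeta>. \<zeta> \<noteq> 0 \<Longrightarrow> supported_by_Re_holomorphic \<Psi> \<zeta>"
    "\<And>c \<zeta>. 0 < c \<Longrightarrow> \<Psi> (of_real c * \<zeta>) = c powr (p / 2) * \<Psi> \<zeta>" "\<And>\<zeta>. Re \<zeta> \<le> 0 \<Longrightarrow> 0 \<le> \<Psi> \<zeta>" "\<Psi> (1/2) < 0"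
    and upper: "\<And>z w. cmod (z + cnj w) powr p + d * \<Psi> (z * w) \<le> c powr p * ((cmod z)\<^sup>2 + (cmod w)\<^sup>2) powr (p / 2)"
    using ctrl unfolding control_function_def c_def by simp_all
  obtain A B where AB: "0 \<le> A" "0 \<le> B"
    and lower: "\<And>z w. ((cmod z)\<^sup>2 + (cmod w)\<^sup>2) powr (p / 2) \<le> A * cmod (z + cnj w) powr p - B * \<Psi> (- (z * w))"
    using pair_norm_le_harmonic_minus_control[OF p \<Psi>(1) \<Psi>(4) \<Psi>(6) \<Psi>(2)] by blast
  have cg: "continuous_on (sphere 0 1) (\<lambda>\<zeta>. g (of_real r * \<zeta>))" "continuous_on (sphere 0 1) (\<lambda>\<zeta>. h (of_real r * \<zeta>))"
    if "0 \<le> r" "r < 1" for r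
    by (intro continuous_on_circle_dilation holomorphic_on_imp_continuous_on hol that)+
  have i1: "integrable circle_measure (\<lambda>\<zeta>. cmod (g (of_real r * \<zeta>) + cnj (h (of_real r * \<zeta>))) powr p)"
    if "0 \<le> r" "r < 1" for r
    using p by (intro integrable_circle_continuous continuous_on_norm_powr continuous_intros cg that) auto
  have i2: "integrable circle_measure (\<lambda>\<zeta>. ((cmod (g (of_real r * \<zeta>)))\<^sup>2 + (cmod (h (of_real r * \<zeta>)))\<^sup>2) powr (p / 2))"
    if "0 \<le> r" "r < 1" for r
    using p by (intro integrable_circle_continuous continuous_on_powr' continuous_intros cg that) auto
  have i3: "integrable circle_measure (\<lambda>\<zeta>. \<Psi> (s * (g (of_real r * \<zeta>) * h (of_real r * \<zeta>))))"
    if "0 \<le> r" "r < 1" for r s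
    by (intro integrable_circle_continuous continuous_on_compose2[OF \<Psi>(1)] continuous_intros cg that) auto
  have sub: "\<Psi> (s * (g 0 * h 0)) \<le> (LINT \<zeta>|circle_measure. \<Psi> (s * (g (of_real r * \<zeta>) * h (of_real r * \<zeta>))))"
    if "0 \<le> r" "r < 1" for r s
    by (rule submean_of_supported[OF _ \<Psi>(1,2,3) that, of "\<lambda>z. s * (g z * h z)"]) (auto intro!: holomorphic_intros hol)
  define mf where "mf = (\<lambda>r. LINT \<zeta>|circle_measure. cmod (g (of_real r * \<zeta>) + cnj (h (of_real r * \<zeta>))) powr p)"
  define mp where "mp = (\<lambda>r. LINT \<zeta>|circle_measure. ((cmod (g (of_real r * \<zeta>)))\<^sup>2 + (cmod (h (of_real r * \<zeta>)))\<^sup>2) powr (p / 2))"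
  have hpm: "hp_mean p f r = mf r powr (1 / p)" if "r \<in> {0<..<1}" for r
  proof -
    have "(LINT z|circle_measure. cmod (f (of_real r * z)) powr p) = mf r"
      unfolding mf_def using that by (intro Bochner_Integration.integral_cong) (auto simp: f norm_mult)
    then show ?thesis by (simp add: hp_mean_def)
  qed
  have mf0: "0 \<le> mf r" for r unfolding mf_def by (intro integral_nonneg_AE) auto
  obtain K where K: "\<And>r. r \<in> {0<..<1} \<Longrightarrow> hp_mean p f r \<le> K" using bdd unfolding bdd_above_def by blast
  have mfK: "mf r \<le> K powr p" if "r \<in> {0<..<1}" for r
  proof -
    have "mf r = (mf r powr (1 / p)) powr p" using mf0[of r] p by (simp add: powr_powr)
    also have "\<dots> \<le> K powr p" using K[OF that] p by (intro powr_mono2) (auto simp: hpm[OF that])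
    finally show ?thesis .
  qed
  \<comment> \<open>The means of \<open>f\<close> are controlled for positive radii only, so the radius \<open>0\<close> is added by hand.\<close>
  define Bd where "Bd = max (A * K powr p - B * \<Psi> (- (g 0 * h 0))) (mp 0)"
  have mpB: "mp r \<le> Bd" if r: "0 \<le> r" "r < 1" for r
  proof (cases "r = 0")
    case False
    have "mp r \<le> (LINT \<zeta>|circle_measure. A * cmod (g (of_real r * \<zeta>) + cnj (h (of_real r * \<zeta>))) powr p
        - B * \<Psi> (- 1 * (g (of_real r * \<zeta>) * h (of_real r * \<zeta>))))"
      unfolding mp_def
    proof (rule integral_mono[OF i2[OF r]])
      show "integrable circle_measure (\<lambda>\<zeta>. A * cmod (g (of_real r * \<zeta>) + cnj (h (of_real r * \<zeta>))) powr p
        - B * \<Psi> (- 1 * (g (of_real r * \<zeta>) * h (of_real r * \<zeta>))))"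
        by (intro Bochner_Integration.integrable_diff integrable_mult_right i1[OF r] i3[OF r])
    qed (simp add: lower)
    also have "\<dots> = A * mf r - B * (LINT \<zeta>|circle_measure. \<Psi> (- 1 * (g (of_real r * \<zeta>) * h (of_real r * \<zeta>))))"
      using i1[OF r] i3[OF r, of "- 1"] by (simp add: mf_def)
    also have "\<dots> \<le> A * K powr p - B * \<Psi> (- 1 * (g 0 * h 0))"
      using AB mfK[of r] False r by (intro diff_mono mult_left_mono sub[OF r]) auto
    finally show ?thesis by (simp add: Bd_def)
  qed (simp add: Bd_def)
  define P where "P = (LINT \<zeta>|circle_measure. ((cmod (radial_limit g \<zeta>))\<^sup>2 + (cmod (radial_limit h \<zeta>))\<^sup>2) powr (p/2))"
  have P0: "0 \<le> P" unfolding P_def by (intro integral_nonneg_AE) auto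
  have mpP: "mp r \<le> P" if r: "0 \<le> r" "r < 1" for r
    unfolding mp_def P_def by (rule pair_mean_le_boundary[OF hol p mpB[unfolded mp_def] r])
  have "hp_mean p f r \<le> c * pair_norm p g h" if r: "r \<in> {0<..<1}" for r
  proof -
    have r': "0 \<le> r" "r < 1" using r by auto
    have "mf r + d * \<Psi> (1 * (g 0 * h 0)) \<le> mf r + d * (LINT \<zeta>|circle_measure. \<Psi> (1 * (g (of_real r * \<zeta>) * h (of_real r * \<zeta>))))"
      using d by (intro add_left_mono mult_left_mono sub[OF r'])
    also have "\<dots> = (LINT \<zeta>|circle_measure. cmod (g (of_real r * \<zeta>) + cnj (h (of_real r * \<zeta>))) powr p + d * \<Psi> (1 * (g (of_real r * \<zeta>) * h (of_real r * \<zeta>))))"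
      using i1[OF r'] i3[OF r', of 1] by (simp add: mf_def)
    also have "\<dots> \<le> (LINT \<zeta>|circle_measure. c powr p * ((cmod (g (of_real r * \<zeta>)))\<^sup>2 + (cmod (h (of_real r * \<zeta>)))\<^sup>2) powr (p / 2))"
    proof (rule integral_mono)
      show "integrable circle_measure (\<lambda>\<zeta>. cmod (g (of_real r * \<zeta>) + cnj (h (of_real r * \<zeta>))) powr p + d * \<Psi> (1 * (g (of_real r * \<zeta>) * h (of_real r * \<zeta>))))"
        by (intro Bochner_Integration.integrable_add integrable_mult_right i1[OF r'] i3[OF r'])
      show "integrable circle_measure (\<lambda>\<zeta>. c powr p * ((cmod (g (of_real r * \<zeta>)))\<^sup>2 + (cmod (h (of_real r * \<zeta>)))\<^sup>2) powr (p / 2))"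
        by (intro integrable_mult_right i2[OF r'])
    qed (simp add: upper)
    also have "\<dots> = c powr p * mp r" by (simp add: mp_def)
    also have "\<dots> \<le> c powr p * P" using mpP[OF r'] by (intro mult_left_mono) auto
    finally have "mf r + d * \<Psi> (g 0 * h 0) \<le> c powr p * P" by simp
    moreover have "0 \<le> d * \<Psi> (g 0 * h 0)" using d \<Psi>(5)[OF gh0] by simp
    ultimately have "mf r \<le> c powr p * P" by linarith
    then have "mf r powr (1 / p) \<le> (c powr p * P) powr (1 / p)" using mf0 p by (intro powr_mono2) auto
    also have "\<dots> = (c powr p) powr (1 / p) * P powr (1 / p)" using P0 by (simp add: powr_mult)
    also have "(c powr p) powr (1 / p) = c" using c0 p by (simp add: powr_powr)
    finally show ?thesis using hpm[OF r] by (simp add: pair_norm_def P_def)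
  qed
  then show ?thesis unfolding hp_norm_def c_def by (intro cSUP_least) auto
qed

section \<open>Sharpness\<close>

lemma circle_null_finite: "finite A \<Longrightarrow> A \<subseteq> sphere 0 1 \<Longrightarrow> A \<in> null_sets circle_measure"
proof (induction rule: finite_induct)
  case (insert a A)
  have a: "cmod a = 1" using insert by auto
  have s: "{a} \<in> sets circle_measure" using sets_circle_Int[of "{a}"] a by simp
  have "measure circle_measure {a} \<le> 4 * \<delta>" if "0 < \<delta>" for \<delta>
  proof -
    have "measure circle_measure {a} \<le> measure circle_measure (cball a \<delta> \<inter> sphere 0 1)"
      using a that by (intro circle.finite_measure_mono sets_circle_Int) auto
    then show ?thesis using measure_circle_cball_le[OF a that] by simp
  qed
  then have "measure circle_measure {a} \<le> 0 + e" if "0 < e" for e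
    using that by (metis add_0 divide_pos_pos mult.commute nonzero_eq_divide_eq times_divide_eq_right zero_less_numeral zero_neq_numeral)
  then have "measure circle_measure {a} \<le> 0" by (rule field_le_epsilon)
  then have "measure circle_measure {a} = 0" using measure_nonneg[of circle_measure "{a}"] by linarith
  then have "{a} \<in> null_sets circle_measure" using s by (simp add: null_setsI circle.emeasure_eq_measure)
  moreover have "A \<in> null_sets circle_measure" using insert by auto
  ultimately have "{a} \<union> A \<in> null_sets circle_measure" by (rule null_sets.Un)
  then show ?case by simp
qed simp

definition cayley :: "complex \<Rightarrow> complex" where
  "cayley z = (1 + z) / (1 - z)"

lemma Re_cayley_pos: "cmod z < 1 \<Longrightarrow> 0 < Re (cayley z)"
proof -
  assume z: "cmod z < 1"
  then have "z \<noteq> 1" by auto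
  have "Re (cayley z) = (1 - (cmod z)\<^sup>2) / (cmod (1 - z))\<^sup>2"
    unfolding cayley_def Re_divide cmod_power2 by (simp add: power2_eq_square algebra_simps)
  moreover have "(cmod z)\<^sup>2 < 1" using z by (simp add: abs_square_less_1)
  ultimately show ?thesis using \<open>z \<noteq> 1\<close> by simp
qed

lemma cayley_power_holomorphic: "(\<lambda>z. cayley z powr of_real \<gamma>) holomorphic_on ball 0 1"
proof -
  have "cayley holomorphic_on ball 0 1"
    unfolding cayley_def by (intro holomorphic_intros) auto
  then show ?thesis
    using Re_cayley_pos by (intro holomorphic_intros) (fastforce simp: complex_nonpos_Reals_iff)+
qed

text \<open>The Cayley transform maps into the right half-plane, where \<open>|w|\<^sup>s\<close> is at most a multiple of the harmonic function
  \<open>Re (w powr s)\<close>, whose mean is its value \<open>1\<close> at the center.\<close>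

lemma cayley_mean_le:
  assumes s: "0 < s" "s < 1" and r: "0 \<le> r" "r < 1"
  shows "(LINT \<zeta>|circle_measure. cmod (cayley (of_real r * \<zeta>)) powr s) \<le> 1 / cos (s * pi / 2)"
proof -
  define F where "F = (\<lambda>z. cayley z powr of_real s)"
  have F: "F holomorphic_on ball 0 1" unfolding F_def by (rule cayley_power_holomorphic)
  have cF: "continuous_on (sphere 0 1) (\<lambda>\<zeta>. F (of_real r * \<zeta>))"
    by (intro continuous_on_circle_dilation holomorphic_on_imp_continuous_on F r)
  have c0: "0 < cos (s * pi / 2)" using s by (intro cos_gt_zero_pi) (auto simp: field_simps intro: less_trans[of _ 0])
  have F0: "F 0 = (LINT \<eta>|circle_measure. F (of_real r * \<eta>))"
  proof (cases "r = 0")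
    case False
    then show ?thesis using holomorphic_circle_mean_value[OF F, of r] r by simp
  qed simp
  have "F 0 = 1" by (simp add: F_def cayley_def)
  have "(LINT \<zeta>|circle_measure. cmod (cayley (of_real r * \<zeta>)) powr s) \<le> (LINT \<zeta>|circle_measure. 1 / cos (s * pi / 2) * Re (F (of_real r * \<zeta>)))"
  proof (rule integral_mono)
    have e: "cmod (F z) = cmod (cayley z) powr s" if "cmod z < 1" for z
    proof -
      have "cayley z \<noteq> 0" using Re_cayley_pos[OF that] by auto
      then show ?thesis by (simp add: F_def powr_def)
    qed
    have "integrable circle_measure (\<lambda>\<zeta>. cmod (F (of_real r * \<zeta>)))"
      by (intro integrable_circle_continuous continuous_on_norm cF)
    then show "integrable circle_measure (\<lambda>\<zeta>. cmod (cayley (of_real r * \<zeta>)) powr s)"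
      by (rule Bochner_Integration.integrable_cong[THEN iffD1, rotated 2]) (use r in \<open>auto simp: e norm_mult\<close>)
    show "integrable circle_measure (\<lambda>\<zeta>. 1 / cos (s * pi / 2) * Re (F (of_real r * \<zeta>)))"
      by (intro integrable_mult_right integrable_circle_continuous continuous_on_Re cF)
    fix \<zeta> assume "\<zeta> \<in> space circle_measure"
    then have z: "cmod (of_real r * \<zeta>) < 1" using r by (simp add: norm_mult)
    define w where "w = cayley (of_real r * \<zeta>)"
    have w: "0 < Re w" using Re_cayley_pos[OF z] by (simp add: w_def)
    then have wn: "w \<noteq> 0" by auto
    have im: "\<bar>Im (Ln w)\<bar> < pi / 2" using Re_Ln_pos_lt[OF wn] w by blast
    have "Re (w powr of_real s) = cmod w powr s * cos (s * Im (Ln w))"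
      using wn by (simp add: powr_def Re_exp)
    moreover have "cos (s * pi / 2) \<le> cos (s * Im (Ln w))"
    proof -
      have "cos (s * pi / 2) \<le> cos \<bar>s * Im (Ln w)\<bar>"
      proof (rule cos_monotone_0_pi_le)
        have "s * \<bar>Im (Ln w)\<bar> \<le> s * (pi / 2)" using im s by (intro mult_left_mono) auto
        then show "\<bar>s * Im (Ln w)\<bar> \<le> s * pi / 2" using s by (simp add: abs_mult)
        have "s * pi \<le> 1 * pi" using s by (intro mult_right_mono) auto
        then show "s * pi / 2 \<le> pi" using pi_gt_zero by linarith
      qed simp
      then show ?thesis by simp
    qed
    ultimately have "cmod w powr s * cos (s * pi / 2) \<le> Re (w powr of_real s)" by (simp add: mult_left_mono)
    then show "cmod (cayley (of_real r * \<zeta>)) powr s \<le> 1 / cos (s * pi / 2) * Re (F (of_real r * \<zeta>))"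
      using c0 by (simp add: F_def w_def field_simps)
  qed
  also have "\<dots> = 1 / cos (s * pi / 2) * (LINT \<zeta>|circle_measure. Re (F (of_real r * \<zeta>)))" by simp
  also have "(LINT \<zeta>|circle_measure. Re (F (of_real r * \<zeta>))) = Re (F 0)"
    unfolding F0 by (intro integral_bounded_linear[OF bounded_linear_Re] integrable_circle_continuous cF)
  also have "\<dots> = 1" by (simp add: \<open>F 0 = 1\<close>)
  finally show ?thesis by simp
qed

lemma cayley_circle:
  assumes "cmod \<zeta> = 1" "\<zeta> \<noteq> 1" "\<zeta> \<noteq> -1"
  shows "Re (cayley \<zeta>) = 0" "cayley \<zeta> \<noteq> 0"
proof -
  have "1 + \<zeta> \<noteq> 0" using assms(3) by (metis add_eq_0_iff)
  then show "cayley \<zeta> \<noteq> 0" using assms by (simp add: cayley_def)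
  have "(Re \<zeta>)\<^sup>2 + (Im \<zeta>)\<^sup>2 = 1" using assms(1) cmod_power2[of \<zeta>] by simp
  then show "Re (cayley \<zeta>) = 0" unfolding cayley_def Re_divide
    by (simp add: power2_eq_square algebra_simps)
qed

text \<open>On the circle, away from \<open>\<plusminus> 1\<close>, the Cayley transform is purely imaginary, so its powers have the arguments
  \<open>\<plusminus> \<gamma> pi / 2\<close>.\<close>

lemma cayley_power_circle:
  assumes \<zeta>: "cmod \<zeta> = 1" "\<zeta> \<noteq> 1" "\<zeta> \<noteq> -1"
  shows "((\<lambda>r. cayley (of_real r * \<zeta>) powr of_real \<gamma>) \<longlongrightarrow> cayley \<zeta> powr of_real \<gamma>) (at_left 1)"
    and "cmod (cayley \<zeta> powr of_real \<gamma>) = cmod (cayley \<zeta>) powr \<gamma>"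
    and "\<bar>Re (cayley \<zeta> powr of_real \<gamma>)\<bar> = cmod (cayley \<zeta>) powr \<gamma> * \<bar>cos (\<gamma> * pi / 2)\<bar>"
    and "\<bar>Im (cayley \<zeta> powr of_real \<gamma>)\<bar> = cmod (cayley \<zeta>) powr \<gamma> * \<bar>sin (\<gamma> * pi / 2)\<bar>"
proof -
  define w where "w = cayley \<zeta>"
  have w: "Re w = 0" "w \<noteq> 0" using cayley_circle[OF \<zeta>] by (auto simp: w_def)
  then have iw: "Im w \<noteq> 0" by (auto simp: complex_eq_iff)
  have nR: "w \<notin> \<real>\<^sub>\<le>\<^sub>0" using iw by (auto simp: complex_nonpos_Reals_iff)
  have "((\<lambda>r. of_real r * \<zeta>) \<longlongrightarrow> of_real 1 * \<zeta>) (at_left 1)" by (intro tendsto_intros)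
  then have "((\<lambda>r. cayley (of_real r * \<zeta>)) \<longlongrightarrow> cayley \<zeta>) (at_left 1)"
    unfolding cayley_def using \<zeta> by (intro tendsto_intros) auto
  then show "((\<lambda>r. cayley (of_real r * \<zeta>) powr of_real \<gamma>) \<longlongrightarrow> cayley \<zeta> powr of_real \<gamma>) (at_left 1)"
    using nR unfolding w_def by (intro tendsto_powr_complex tendsto_const)
  have e: "w powr of_real \<gamma> = of_real (cmod w powr \<gamma>) * cis (\<gamma> * Im (Ln w))"
    using w by (simp add: powr_def exp_eq_polar)
  have "Im (Ln w) = pi / 2 \<or> Im (Ln w) = - (pi / 2)"
  proof (cases "0 < Im w")
    case True
    have "w = \<i> * of_real (Im w)" using w by (simp add: complex_eq_iff)
    then have "Arg w = pi / 2" using True by (metis Arg_ii Arg_times_of_real2)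
    then show ?thesis using w by (simp add: Arg_eq_Im_Ln)
  next
    case False
    have "w = - \<i> * of_real (- Im w)" using w by (simp add: complex_eq_iff)
    moreover have "- Im w > 0" using False iw by simp
    ultimately have "Arg w = Arg (- \<i>)" by (metis Arg_times_of_real2)
    then have "Arg w = - (pi / 2)" by simp
    then show ?thesis using w by (simp add: Arg_eq_Im_Ln)
  qed
  then have t: "\<bar>cos (\<gamma> * Im (Ln w))\<bar> = \<bar>cos (\<gamma> * pi / 2)\<bar>" "\<bar>sin (\<gamma> * Im (Ln w))\<bar> = \<bar>sin (\<gamma> * pi / 2)\<bar>"
    by (elim disjE; simp only: mult_minus_right cos_minus sin_minus abs_minus_cancel times_divide_eq_right)+
  show "cmod (cayley \<zeta> powr of_real \<gamma>) = cmod (cayley \<zeta>) powr \<gamma>"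
    unfolding w_def[symmetric] e by (simp add: norm_mult)
  show "\<bar>Re (cayley \<zeta> powr of_real \<gamma>)\<bar> = cmod (cayley \<zeta>) powr \<gamma> * \<bar>cos (\<gamma> * pi / 2)\<bar>"
    unfolding w_def[symmetric] e by (simp add: abs_mult t)
  show "\<bar>Im (cayley \<zeta> powr of_real \<gamma>)\<bar> = cmod (cayley \<zeta>) powr \<gamma> * \<bar>sin (\<gamma> * pi / 2)\<bar>"
    unfolding w_def[symmetric] e by (simp add: abs_mult t)
qed

lemma cayley_lower_bound:
  assumes "0 < t" "t \<le> 1"
  shows "1 / t \<le> cmod (cayley (cis t))"
proof -
  have "1 \<le> cmod (1 + cis t)"
  proof -
    have "0 \<le> cos t" using assms pi_gt3 by (intro cos_ge_zero) auto
    then show ?thesis using complex_Re_le_cmod[of "1 + cis t"] by simp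
  qed
  moreover have "cmod (1 - cis t) \<le> t"
  proof -
    have "(cmod (1 - cis t))\<^sup>2 = 2 - 2 * cos t"
      unfolding cmod_power2 using sin_cos_squared_add[of t] by (simp add: power2_eq_square algebra_simps)
    also have "\<dots> = (2 * sin (t / 2))\<^sup>2" using cos_double_sin[of "t / 2"] by (simp add: power_mult_distrib)
    also have "\<dots> \<le> t\<^sup>2"
    proof (rule power_mono)
      show "2 * sin (t / 2) \<le> t" using sin_x_le_x[of "t/2"] assms by simp
      show "0 \<le> 2 * sin (t / 2)" using assms pi_gt3 by (auto intro: sin_ge_zero)
    qed
    finally show ?thesis using assms by (simp add: power2_le_iff_abs_le)
  qed
  moreover have "1 - cis t \<noteq> 0"
  proof
    assume "1 - cis t = 0"
    then have "sin t = 0" by (simp add: complex_eq_iff)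
    then show False using sin_gt_zero[of t] assms pi_gt3 by simp
  qed
  ultimately show ?thesis unfolding cayley_def norm_divide using assms
    by (intro frac_le) auto
qed

text \<open>Compare with the integral of \<open>t powr (- s)\<close> over the unit interval. The bound tends to infinity
  as \<open>s\<close> increases to \<open>1\<close>.\<close>

lemma cayley_boundary_mean_ge:
  assumes s: "0 < s" "s < 1" and int: "integrable circle_measure (\<lambda>\<zeta>. cmod (cayley \<zeta>) powr s)"
  shows "1 / (2 * pi * (1 - s)) \<le> (LINT \<zeta>|circle_measure. cmod (cayley \<zeta>) powr s)"
proof -
  have m [measurable]: "(\<lambda>\<zeta>. cmod (cayley \<zeta>) powr s) \<in> borel_measurable circle_measure" using int by simp
  have m' [measurable]: "(\<lambda>\<zeta>. cmod (cayley \<zeta>) powr s) \<in> borel_measurable (restrict_space borel (sphere 0 1))"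
    using m by (simp add: measurable_cong_sets[OF sets_circle_measure refl])
  have "((\<lambda>t. t powr (- s)) has_integral (1 powr (- s + 1) / (- s + 1))) {0..1}"
    using s by (intro has_integral_powr_from_0) auto
  then have hi: "((\<lambda>t. t powr (- s)) has_integral 1 / (1 - s)) {0..1}" by simp
  have nn: "(\<integral>\<^sup>+t. ennreal (t powr (- s)) * indicator {0..1} t \<partial>lborel) = ennreal (1 / (1 - s))"
    by (rule nn_integral_has_integral_lebesgue'[OF _ hi]) simp
  have "ennreal (1 / (2 * pi * (1 - s))) = ennreal (1 / (2 * pi)) * ennreal (1 / (1 - s))"
    using s by (simp flip: ennreal_mult)
  also have "\<dots> = (\<integral>\<^sup>+t. ennreal (1 / (2 * pi)) * (ennreal (t powr (- s)) * indicator {0..1} t) \<partial>lborel)"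
    unfolding nn[symmetric] by (rule nn_integral_cmult[symmetric]) simp
  also have "\<dots> \<le> (\<integral>\<^sup>+t. ennreal (indicator {0..2*pi} t / (2*pi)) * ennreal (cmod (cayley (cis t)) powr s) \<partial>lborel)"
  proof (rule nn_integral_mono)
    fix t :: real
    show "ennreal (1 / (2 * pi)) * (ennreal (t powr (- s)) * indicator {0..1} t)
      \<le> ennreal (indicator {0..2*pi} t / (2*pi)) * ennreal (cmod (cayley (cis t)) powr s)"
    proof (cases "0 < t \<and> t \<le> 1")
      case True
      then have "t \<le> 2 * pi" using pi_gt3 by simp
      have "t powr (- s) = (1 / t) powr s" using True by (simp add: powr_minus_divide powr_divide)
      also have "\<dots> \<le> cmod (cayley (cis t)) powr s" using cayley_lower_bound[of t] True s by (intro powr_mono2) auto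
      finally show ?thesis using True \<open>t \<le> 2 * pi\<close> by (auto intro!: mult_left_mono ennreal_leI)
    next
      case False
      then have "ennreal (t powr (- s)) * indicator {0..1} t = 0" by (cases "t = 0") auto
      then show ?thesis by (simp only: mult_zero_right zero_le)
    qed
  qed
  also have "\<dots> = (\<integral>\<^sup>+\<zeta>. ennreal (cmod (cayley \<zeta>) powr s) \<partial>circle_measure)"
    unfolding circle_measure_eq_density
    by (subst nn_integral_distr) (auto simp: nn_integral_density)
  also have "\<dots> = ennreal (LINT \<zeta>|circle_measure. cmod (cayley \<zeta>) powr s)"
    by (intro nn_integral_eq_integral int) auto
  finally show ?thesis
    by (subst (asm) ennreal_le_iff) (auto intro!: integral_nonneg_AE)
qed


text \<open>The constant \<open>1\<close> is the value of the power at the origin.\<close>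

definition extremal :: "real \<Rightarrow> complex \<Rightarrow> complex" where
  "extremal \<gamma> z = cayley z powr of_real \<gamma> - 1"

lemma extremal_holomorphic: "extremal \<gamma> holomorphic_on ball 0 1"
  unfolding extremal_def by (intro holomorphic_intros cayley_power_holomorphic)

lemma cayley_power_boundary_integrable:
  assumes s: "0 < p" "0 < \<gamma>" "\<gamma> * p < 1"
  shows "integrable circle_measure (\<lambda>\<zeta>. cmod (cayley \<zeta>) powr (\<gamma> * p))"
    and "(\<lambda>\<zeta>. cayley \<zeta> powr of_real \<gamma>) \<in> borel_measurable circle_measure"
proof -
  have *: "(\<lambda>\<zeta>. cayley \<zeta> powr of_real \<gamma>) \<in> borel_measurable borel"
    unfolding cayley_def powr_def by measurable
  then show m: "(\<lambda>\<zeta>. cayley \<zeta> powr of_real \<gamma>) \<in> borel_measurable circle_measure"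
    by (rule borel_measurable_circleI)
  define \<rho> where "\<rho> = (\<lambda>n::nat. 1 - 1 / (real n + 2))"
  have \<rho>: "0 \<le> \<rho> n" "\<rho> n < 1" for n by (auto simp: \<rho>_def field_simps)
  have \<rho>lim: "filterlim \<rho> (at_left 1) sequentially"
    unfolding \<rho>_def by (rule filterlim_one_minus_inverse)
  have pw: "cmod (z powr of_real \<gamma>) powr p = cmod z powr (\<gamma> * p)" for z
    by (cases "z = 0") (auto simp: powr_def)
  have ae: "AE \<zeta> in circle_measure. \<zeta> \<noteq> 1 \<and> \<zeta> \<noteq> -1"
    by (rule AE_I'[OF circle_null_finite[of "{1, -1}"]]) auto
  have "integrable circle_measure (\<lambda>\<zeta>. cmod (cayley \<zeta> powr of_real \<gamma>) powr p) \<and>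
     (LINT \<zeta>|circle_measure. cmod (cayley \<zeta> powr of_real \<gamma>) powr p) \<le> 1 / cos (\<gamma> * p * pi / 2)"
  proof (rule fatou_circle_mean[OF s(1) m])
    show "continuous_on (sphere 0 1) (\<lambda>\<zeta>. cayley (of_real (\<rho> n) * \<zeta>) powr of_real \<gamma>)" for n
      using \<rho> by (intro continuous_on_circle_dilation[of "\<lambda>z. cayley z powr of_real \<gamma>"]
          holomorphic_on_imp_continuous_on cayley_power_holomorphic)
    show "AE \<zeta> in circle_measure. (\<lambda>n. cayley (of_real (\<rho> n) * \<zeta>) powr of_real \<gamma>) \<longlonglongrightarrow> cayley \<zeta> powr of_real \<gamma>"
      using ae AE_space by eventually_elim (auto intro!: filterlim_compose[OF cayley_power_circle(1) \<rho>lim])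
    show "(LINT \<zeta>|circle_measure. cmod (cayley (of_real (\<rho> n) * \<zeta>) powr of_real \<gamma>) powr p) \<le> 1 / cos (\<gamma> * p * pi / 2)" for n
      unfolding pw using cayley_mean_le[of "\<gamma> * p" "\<rho> n"] \<rho>[of n] s by simp
  qed
  then show "integrable circle_measure (\<lambda>\<zeta>. cmod (cayley \<zeta>) powr (\<gamma> * p))" by (simp add: pw)
qed

text \<open>The value \<open>sg\<close> selects whether \<open>f\<close> is essentially twice the real part or twice the imaginary part of \<open>G\<close>, up
  to a constant. In the second claim only \<open>\<kappa>\<close> and \<open>I\<close> depend on \<open>\<gamma>\<close>, so the additive term becomes
  negligible when \<open>I\<close> is large.\<close>

lemma extremal_pair_bounds:
  assumes p: "1 < p" and \<gamma>: "0 < \<gamma>" "\<gamma> * p < 1" and sg: "sg = 1 \<or> sg = (-1::real)"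
    and t: "0 < t" "t < 1" and C: "0 \<le> C"
  defines "g \<equiv> extremal \<gamma>"
  defines "h \<equiv> (\<lambda>z. of_real sg * extremal \<gamma> z)"
  defines "f \<equiv> (\<lambda>z. g z + cnj (h z))"
  defines "\<kappa> \<equiv> (if sg = 1 then cos (\<gamma> * pi / 2) else sin (\<gamma> * pi / 2))"
  defines "I \<equiv> (LINT \<zeta>|circle_measure. cmod (cayley \<zeta>) powr (\<gamma> * p))"
  shows "admissible p f g h"
    and "hp_norm p f \<le> C * pair_norm p g h \<Longrightarrow>
      (2 * \<kappa>) powr p * I \<le> ((1 - t) powr (1 - p))\<^sup>2 * C powr p * 2 powr (p / 2) * I
        + ((1 - t) powr (1 - p) * C powr p * 2 powr (p / 2) * t powr (1 - p) + t powr (1 - p) * 2 powr p)"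
proof -
  define G where "G = (\<lambda>z. cayley z powr of_real \<gamma>)"
  have gG: "g z = G z - 1" and hG: "h z = of_real sg * (G z - 1)" for z by (simp_all add: g_def h_def G_def extremal_def)
  have hol: "g holomorphic_on ball 0 1" "h holomorphic_on ball 0 1"
    unfolding g_def h_def by (intro holomorphic_intros extremal_holomorphic)+
  have cG: "continuous_on (sphere 0 1) (\<lambda>\<zeta>. G (of_real r * \<zeta>))" if "0 \<le> r" "r < 1" for r
    unfolding G_def using that
    by (intro continuous_on_circle_dilation[of "\<lambda>z. cayley z powr of_real \<gamma>"]
          holomorphic_on_imp_continuous_on cayley_power_holomorphic)
  have cf: "continuous_on (sphere 0 1) (\<lambda>\<zeta>. f (of_real r * \<zeta>))" if "0 \<le> r" "r < 1" for r
    unfolding f_def gG hG by (intro continuous_intros cG that)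
  have pw: "cmod (z powr of_real \<gamma>) powr p = cmod z powr (\<gamma> * p)" for z
    by (cases "z = 0") (auto simp: powr_def)
  have two: "cmod (G z - 1) powr p \<le> (1 - t) powr (1 - p) * cmod (cayley z) powr (\<gamma> * p) + t powr (1 - p)" for z
    using norm_add_powr_le_convex[of p t "G z" "- 1"] p t by (simp add: G_def pw)
  have fle: "cmod (f z) \<le> 2 * cmod (G z - 1)" for z
  proof -
    have "cmod (f z) \<le> cmod (g z) + cmod (cnj (h z))" unfolding f_def by (rule norm_triangle_ineq)
    also have "\<dots> = 2 * cmod (G z - 1)" unfolding complex_mod_cnj using sg by (auto simp: gG hG norm_mult)
    finally show ?thesis .
  qed
  have fle': "cmod (f z) powr p \<le> 2 powr p * ((1 - t) powr (1 - p) * cmod (cayley z) powr (\<gamma> * p) + t powr (1 - p))" for z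
  proof -
    have "cmod (f z) powr p \<le> (2 * cmod (G z - 1)) powr p" using fle p by (intro powr_mono2) auto
    also have "\<dots> = 2 powr p * cmod (G z - 1) powr p" by (simp add: powr_mult)
    also have "\<dots> \<le> 2 powr p * ((1 - t) powr (1 - p) * cmod (cayley z) powr (\<gamma> * p) + t powr (1 - p))"
      using two by (intro mult_left_mono) auto
    finally show ?thesis .
  qed
  define mf where "mf = (\<lambda>r. LINT \<zeta>|circle_measure. cmod (f (of_real r * \<zeta>)) powr p)"
  have mf0: "0 \<le> mf r" for r unfolding mf_def by (intro integral_nonneg_AE) auto
  define Bd where "Bd = 2 powr p * ((1 - t) powr (1 - p) * (1 / cos (\<gamma> * p * pi / 2)) + t powr (1 - p))"
  have mfB: "mf r \<le> Bd" if r: "0 \<le> r" "r < 1" for r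
  proof -
    have iW: "integrable circle_measure (\<lambda>\<zeta>. cmod (cayley (of_real r * \<zeta>)) powr (\<gamma> * p))"
    proof -
      have "integrable circle_measure (\<lambda>\<zeta>. cmod (G (of_real r * \<zeta>)) powr p)"
        using p by (intro integrable_circle_continuous continuous_on_norm_powr cG r) auto
      then show ?thesis by (simp add: G_def pw)
    qed
    have "mf r \<le> (LINT \<zeta>|circle_measure. 2 powr p * ((1 - t) powr (1 - p) * cmod (cayley (of_real r * \<zeta>)) powr (\<gamma> * p) + t powr (1 - p)))"
      unfolding mf_def
    proof (rule integral_mono)
      show "integrable circle_measure (\<lambda>\<zeta>. cmod (f (of_real r * \<zeta>)) powr p)"
        using p by (intro integrable_circle_continuous continuous_on_norm_powr cf r) auto
    qed (use iW fle' in auto)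
    also have "\<dots> = 2 powr p * ((1 - t) powr (1 - p) * (LINT \<zeta>|circle_measure. cmod (cayley (of_real r * \<zeta>)) powr (\<gamma> * p)) + t powr (1 - p))"
      using iW by simp
    also have "\<dots> \<le> Bd" unfolding Bd_def
      using cayley_mean_le[of "\<gamma> * p" r] \<gamma> p r by (intro mult_left_mono add_right_mono) auto
    finally show ?thesis .
  qed
  have hpm: "hp_mean p f r = mf r powr (1 / p)" for r by (simp add: hp_mean_def mf_def)
  have bdd: "bdd_above (hp_mean p f ` {0<..<1})"
  proof (intro bdd_aboveI2)
    fix r :: real assume "r \<in> {0<..<1}"
    then show "hp_mean p f r \<le> Bd powr (1 / p)" unfolding hpm using mf0 mfB p by (intro powr_mono2) auto
  qed
  show "admissible p f g h" unfolding admissible_def hp_class_def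
  proof (intro conjI CollectI bdd hol)
    show "\<exists>g h. g holomorphic_on ball 0 1 \<and> h holomorphic_on ball 0 1 \<and> (\<forall>z\<in>ball 0 1. f z = g z + cnj (h z))"
      using hol by (intro exI[of _ g] exI[of _ h]) (auto simp: f_def)
    show "\<forall>z\<in>ball 0 1. f z = g z + cnj (h z)" by (simp add: f_def)
    show "Re (g 0 * h 0) \<le> 0" by (simp add: gG G_def cayley_def)
  qed
  assume H: "hp_norm p f \<le> C * pair_norm p g h"
  have int: "integrable circle_measure (\<lambda>\<zeta>. cmod (cayley \<zeta>) powr (\<gamma> * p))"
    and Gm: "G \<in> borel_measurable circle_measure"
    unfolding G_def using p \<gamma> by (intro cayley_power_boundary_integrable; simp)+
  have ae: "AE \<zeta> in circle_measure. cmod \<zeta> = 1 \<and> \<zeta> \<noteq> 1 \<and> \<zeta> \<noteq> -1"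
    by (rule AE_I'[OF circle_null_finite[of "{1, -1}"]]) auto
  have Glim: "((\<lambda>r. G (of_real r * \<zeta>)) \<longlongrightarrow> G \<zeta>) (at_left 1)" if "cmod \<zeta> = 1 \<and> \<zeta> \<noteq> 1 \<and> \<zeta> \<noteq> -1" for \<zeta>
    unfolding G_def using that by (intro cayley_power_circle) auto
  have glim: "radial_limit g \<zeta> = g \<zeta>" "radial_limit h \<zeta> = h \<zeta>" if "cmod \<zeta> = 1 \<and> \<zeta> \<noteq> 1 \<and> \<zeta> \<noteq> -1" for \<zeta>
    unfolding gG hG by (intro radial_limit_eqI tendsto_intros Glim[OF that])+
  have flim: "((\<lambda>r. f (of_real r * \<zeta>)) \<longlongrightarrow> f \<zeta>) (at_left 1)" if "cmod \<zeta> = 1 \<and> \<zeta> \<noteq> 1 \<and> \<zeta> \<noteq> -1" for \<zeta>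
    unfolding f_def gG hG by (intro tendsto_intros Glim[OF that])
  define \<rho> where "\<rho> = (\<lambda>n::nat. 1 - 1 / (real n + 2))"
  have \<rho>: "0 < \<rho> n" "\<rho> n < 1" for n by (auto simp: \<rho>_def field_simps)
  have \<rho>lim: "filterlim \<rho> (at_left 1) sequentially"
    unfolding \<rho>_def by (rule filterlim_one_minus_inverse)
  have fm: "f \<in> borel_measurable circle_measure"
  proof -
    have "(\<lambda>\<zeta>. (G \<zeta> - 1) + cnj (of_real sg * (G \<zeta> - 1))) \<in> borel_measurable circle_measure"
      using Gm bounded_linear_cnj[THEN bounded_linear.continuous_on, OF continuous_on_id]
      by (intro borel_measurable_add borel_measurable_diff borel_measurable_const
          borel_measurable_continuous_on[where f = cnj] borel_measurable_times) auto
    then show ?thesis by (simp add: f_def[abs_def] gG hG)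
  qed
  have mfh: "mf r \<le> hp_norm p f powr p" if r: "r \<in> {0<..<1}" for r
  proof -
    have "mf r = (mf r powr (1 / p)) powr p" using mf0[of r] p by (simp add: powr_powr)
    also have "\<dots> \<le> hp_norm p f powr p"
      unfolding hpm[symmetric] hp_norm_def using p r by (intro powr_mono2 cSUP_upper bdd) (auto simp: hpm)
    finally show ?thesis .
  qed
  have fat: "integrable circle_measure (\<lambda>\<zeta>. cmod (f \<zeta>) powr p) \<and> (LINT \<zeta>|circle_measure. cmod (f \<zeta>) powr p) \<le> hp_norm p f powr p"
  proof (rule fatou_circle_mean)
    show "0 < p" using p by simp
    show "continuous_on (sphere 0 1) (\<lambda>\<zeta>. f (of_real (\<rho> n) * \<zeta>))" for n using \<rho>[of n] by (intro cf) auto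
    show "AE \<zeta> in circle_measure. (\<lambda>n. f (of_real (\<rho> n) * \<zeta>)) \<longlonglongrightarrow> f \<zeta>"
      using ae by eventually_elim (rule filterlim_compose[OF flim \<rho>lim])
    show "(LINT \<zeta>|circle_measure. cmod (f (of_real (\<rho> n) * \<zeta>)) powr p) \<le> hp_norm p f powr p" for n
      using mfh[of "\<rho> n"] \<rho>[of n] by (simp add: mf_def)
  qed (rule fm)
  define P where "P = (LINT \<zeta>|circle_measure. ((cmod (radial_limit g \<zeta>))\<^sup>2 + (cmod (radial_limit h \<zeta>))\<^sup>2) powr (p/2))"
  have P0: "0 \<le> P" unfolding P_def by (intro integral_nonneg_AE) auto
  have hn0: "0 \<le> hp_norm p f"
  proof -
    have "0 \<le> hp_mean p f (1/2)" by (simp add: hpm)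
    also have "\<dots> \<le> hp_norm p f" unfolding hp_norm_def by (intro cSUP_upper bdd) auto
    finally show ?thesis .
  qed
  have "hp_norm p f powr p \<le> (C * P powr (1 / p)) powr p"
    using H hn0 p by (intro powr_mono2) (auto simp: pair_norm_def P_def)
  also have "\<dots> = C powr p * P" using C P0 p by (simp add: powr_mult powr_powr)
  finally have HP: "hp_norm p f powr p \<le> C powr p * P" .
  have Pup: "P \<le> 2 powr (p / 2) * ((1 - t) powr (1 - p) * I + t powr (1 - p))"
  proof -
    have pm: "((cmod (radial_limit g \<zeta>))\<^sup>2 + (cmod (radial_limit h \<zeta>))\<^sup>2) powr (p/2) = 2 powr (p/2) * cmod (G \<zeta> - 1) powr p"
      if "cmod \<zeta> = 1 \<and> \<zeta> \<noteq> 1 \<and> \<zeta> \<noteq> -1" for \<zeta>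
    proof -
      have "(cmod (radial_limit g \<zeta>))\<^sup>2 + (cmod (radial_limit h \<zeta>))\<^sup>2 = 2 * (cmod (G \<zeta> - 1))\<^sup>2"
        using sg by (auto simp: glim[OF that] gG hG norm_mult)
      then show ?thesis by (simp add: powr_mult square_powr_half)
    qed
    have "P \<le> (LINT \<zeta>|circle_measure. 2 powr (p/2) * ((1 - t) powr (1 - p) * cmod (cayley \<zeta>) powr (\<gamma> * p) + t powr (1 - p)))"
      unfolding P_def
    proof (rule integral_mono_AE')
      show "integrable circle_measure (\<lambda>\<zeta>. 2 powr (p/2) * ((1 - t) powr (1 - p) * cmod (cayley \<zeta>) powr (\<gamma> * p) + t powr (1 - p)))"
        using int by auto
      show "AE \<zeta> in circle_measure. ((cmod (radial_limit g \<zeta>))\<^sup>2 + (cmod (radial_limit h \<zeta>))\<^sup>2) powr (p/2)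
          \<le> 2 powr (p/2) * ((1 - t) powr (1 - p) * cmod (cayley \<zeta>) powr (\<gamma> * p) + t powr (1 - p))"
        using ae by eventually_elim (use two in \<open>auto simp: pm intro!: mult_left_mono\<close>)
    qed auto
    also have "\<dots> = 2 powr (p / 2) * ((1 - t) powr (1 - p) * I + t powr (1 - p))" using int by (simp add: I_def)
    finally show ?thesis .
  qed
  have "(2 * \<kappa>) powr p * I = (LINT \<zeta>|circle_measure. (2 * \<kappa>) powr p * cmod (cayley \<zeta>) powr (\<gamma> * p))"
    by (simp add: I_def)
  also have "\<dots> \<le> (LINT \<zeta>|circle_measure. (1 - t) powr (1 - p) * cmod (f \<zeta>) powr p + t powr (1 - p) * 2 powr p)"
  proof (rule integral_mono_AE)
    show "integrable circle_measure (\<lambda>\<zeta>. (2 * \<kappa>) powr p * cmod (cayley \<zeta>) powr (\<gamma> * p))" using int by auto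
    show "integrable circle_measure (\<lambda>\<zeta>. (1 - t) powr (1 - p) * cmod (f \<zeta>) powr p + t powr (1 - p) * 2 powr p)" using fat by auto
    show "AE \<zeta> in circle_measure. (2 * \<kappa>) powr p * cmod (cayley \<zeta>) powr (\<gamma> * p)
        \<le> (1 - t) powr (1 - p) * cmod (f \<zeta>) powr p + t powr (1 - p) * 2 powr p"
      using ae
    proof eventually_elim
      case (elim \<zeta>)
      have "\<gamma> * 1 \<le> \<gamma> * p" using \<gamma> p by (intro mult_left_mono) auto
      then have g1: "\<gamma> < 1" using \<gamma> by linarith
      then have gp: "\<gamma> * pi / 2 \<le> pi / 2" "0 \<le> \<gamma> * pi / 2" using \<gamma> by (auto simp: mult_left_le_one_le)
      then have sc: "0 \<le> cos (\<gamma> * pi / 2)" "0 \<le> sin (\<gamma> * pi / 2)"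
        using pi_gt_zero by (auto intro!: cos_ge_zero sin_ge_zero simp del: le_divide_eq_numeral1 divide_le_eq_numeral1)
      have "cmod (G \<zeta> + of_real sg * cnj (G \<zeta>)) = 2 * \<kappa> * cmod (cayley \<zeta>) powr \<gamma>"
        using sg
      proof
        assume s1: "sg = 1"
        have "G \<zeta> + of_real sg * cnj (G \<zeta>) = of_real (2 * Re (G \<zeta>))" by (simp add: s1 complex_add_cnj)
        then have "cmod (G \<zeta> + of_real sg * cnj (G \<zeta>)) = 2 * \<bar>Re (G \<zeta>)\<bar>" by (simp only: norm_of_real abs_mult abs_numeral)
        then show ?thesis unfolding G_def using elim sc by (simp add: cayley_power_circle(3) s1 \<kappa>_def)
      next
        assume s1: "sg = - 1"
        have "G \<zeta> + of_real sg * cnj (G \<zeta>) = of_real (2 * Im (G \<zeta>)) * \<i>" using complex_diff_cnj[of "G \<zeta>"] by (simp add: s1)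
        then have "cmod (G \<zeta> + of_real sg * cnj (G \<zeta>)) = 2 * \<bar>Im (G \<zeta>)\<bar>" by (simp only: norm_mult norm_of_real abs_mult abs_numeral norm_ii mult_1_right)
        then show ?thesis unfolding G_def using elim sc by (simp add: cayley_power_circle(4) s1 \<kappa>_def)
      qed
      moreover have "G \<zeta> + of_real sg * cnj (G \<zeta>) = f \<zeta> + of_real (1 + sg)" by (simp add: f_def gG hG algebra_simps)
      ultimately have e: "2 * \<kappa> * cmod (cayley \<zeta>) powr \<gamma> = cmod (f \<zeta> + of_real (1 + sg))" by simp
      have k0: "0 \<le> \<kappa>" using sc by (simp add: \<kappa>_def)
      have "(2 * \<kappa>) powr p * cmod (cayley \<zeta>) powr (\<gamma> * p) = (2 * \<kappa> * cmod (cayley \<zeta>) powr \<gamma>) powr p"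
        using k0 by (simp add: powr_mult powr_powr)
      also have "\<dots> \<le> (1 - t) powr (1 - p) * cmod (f \<zeta>) powr p + t powr (1 - p) * cmod (of_real (1 + sg)) powr p"
        unfolding e using p t by (intro norm_add_powr_le_convex) auto
      also have "\<dots> \<le> (1 - t) powr (1 - p) * cmod (f \<zeta>) powr p + t powr (1 - p) * 2 powr p"
        using sg p by (intro add_left_mono mult_left_mono powr_mono2) auto
      finally show ?case .
    qed
  qed
  also have "\<dots> = (1 - t) powr (1 - p) * (LINT \<zeta>|circle_measure. cmod (f \<zeta>) powr p) + t powr (1 - p) * 2 powr p"
    using fat by simp
  also have "\<dots> \<le> (1 - t) powr (1 - p) * (C powr p * (2 powr (p / 2) * ((1 - t) powr (1 - p) * I + t powr (1 - p)))) + t powr (1 - p) * 2 powr p"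
  proof (intro add_right_mono mult_left_mono)
    have "(LINT \<zeta>|circle_measure. cmod (f \<zeta>) powr p) \<le> C powr p * P" using fat HP by simp
    also have "\<dots> \<le> C powr p * (2 powr (p / 2) * ((1 - t) powr (1 - p) * I + t powr (1 - p)))"
      using Pup by (intro mult_left_mono) auto
    finally show "(LINT \<zeta>|circle_measure. cmod (f \<zeta>) powr p) \<le> \<dots>" .
  qed simp
  finally show "(2 * \<kappa>) powr p * I \<le> ((1 - t) powr (1 - p))\<^sup>2 * C powr p * 2 powr (p / 2) * I
        + ((1 - t) powr (1 - p) * C powr p * 2 powr (p / 2) * t powr (1 - p) + t powr (1 - p) * 2 powr p)"
    by (simp add: algebra_simps power2_eq_square)
qed

text \<open>Divide the inequality of the preceding lemma by \<open>I\<close>, let \<open>\<gamma>\<close> increase to \<open>1/p\<close>, and then let \<open>t\<close> tend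
  to \<open>0\<close>.\<close>

lemma constant_sharp:
  assumes p: "1 < p" and C: "C < sqrt 2 * max (sin (pi / (2 * p))) (cos (pi / (2 * p)))"
  shows "\<exists>f g h. admissible p f g h \<and> \<not> hp_norm p f \<le> C * pair_norm p g h"
proof (rule ccontr)
  assume "\<not> ?thesis"
  then have all: "\<And>f g h. admissible p f g h \<Longrightarrow> hp_norm p f \<le> C * pair_norm p g h" by blast
  \<comment> \<open>An estimate with a negative constant would imply the one with constant \<open>0\<close>.\<close>
  define C' where "C' = max C 0"
  have C': "0 \<le> C'" by (simp add: C'_def)
  have all': "hp_norm p f \<le> C' * pair_norm p g h" if "admissible p f g h" for f g h
  proof -
    have "C * pair_norm p g h \<le> C' * pair_norm p g h"
      by (intro mult_right_mono) (auto simp: C'_def pair_norm_def)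
    then show ?thesis using all[OF that] by linarith
  qed
  \<comment> \<open>The sign is chosen according to which of the two terms attains the maximum.\<close>
  define sg :: real where "sg = (if sin (pi / (2 * p)) \<le> cos (pi / (2 * p)) then 1 else - 1)"
  have sg: "sg = 1 \<or> sg = -1" by (simp add: sg_def)
  define \<kappa> where "\<kappa> = (\<lambda>\<gamma>. if sg = 1 then cos (\<gamma> * pi / 2) else sin (\<gamma> * pi / 2))"
  have \<kappa>p: "\<kappa> (1 / p) = max (sin (pi / (2 * p))) (cos (pi / (2 * p)))"
    by (auto simp: \<kappa>_def sg_def max_def mult.commute)
  have "0 < pi / (2 * p)" "pi / (2 * p) < pi / 2" using p by (auto simp: field_simps)
  then have "0 < sin (pi / (2 * p))" by (intro sin_gt_zero2) auto
  then have \<kappa>pos: "0 < \<kappa> (1 / p)" unfolding \<kappa>p by (simp add: less_max_iff_disj)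
  define I where "I = (\<lambda>\<gamma>. LINT \<zeta>|circle_measure. cmod (cayley \<zeta>) powr (\<gamma> * p))"
  have ineq: "(2 * \<kappa> (1/p)) powr p \<le> ((1 - t) powr (1 - p))\<^sup>2 * C' powr p * 2 powr (p / 2)" if t: "0 < t" "t < 1" for t
  proof -
    define a where "a = ((1 - t) powr (1 - p))\<^sup>2 * C' powr p * 2 powr (p / 2)"
    define b where "b = (1 - t) powr (1 - p) * C' powr p * 2 powr (p / 2) * t powr (1 - p) + t powr (1 - p) * 2 powr p"
    have b0: "0 \<le> b" by (simp add: b_def)
    have step: "(2 * \<kappa> \<gamma>) powr p \<le> a + b * (2 * pi * (1 - \<gamma> * p))" if \<gamma>: "0 < \<gamma>" "\<gamma> * p < 1" for \<gamma>
    proof -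
      have "(2 * \<kappa> \<gamma>) powr p * I \<gamma> \<le> a * I \<gamma> + b"
        unfolding a_def b_def I_def \<kappa>_def
        by (rule extremal_pair_bounds(2)[OF p \<gamma> sg t C' all'[OF extremal_pair_bounds(1)[OF p \<gamma> sg t C']]])
      moreover have Ige: "1 / (2 * pi * (1 - \<gamma> * p)) \<le> I \<gamma>"
        unfolding I_def using \<gamma> p by (intro cayley_boundary_mean_ge cayley_power_boundary_integrable) auto
      have q0: "0 < 1 / (2 * pi * (1 - \<gamma> * p))" using \<gamma> by simp
      then have I0: "0 < I \<gamma>" using Ige by linarith
      ultimately have "(2 * \<kappa> \<gamma>) powr p \<le> a + b / I \<gamma>" by (simp add: field_simps)
      also have "b / I \<gamma> \<le> b / (1 / (2 * pi * (1 - \<gamma> * p)))" using b0 Ige q0 I0 by (intro divide_left_mono mult_pos_pos)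
      finally show ?thesis by simp
    qed
    have "(2 * \<kappa> (1 / p)) powr p \<le> a + b * (2 * pi * (1 - 1 / p * p))"
    proof (rule tendsto_le)
      show "((\<lambda>\<gamma>. a + b * (2 * pi * (1 - \<gamma> * p))) \<longlongrightarrow> a + b * (2 * pi * (1 - 1 / p * p))) (at_left (1/p))"
        by (intro tendsto_intros)
      have "(\<kappa> \<longlongrightarrow> \<kappa> (1 / p)) (at_left (1/p))" unfolding \<kappa>_def by (cases "sg = 1") (auto intro!: tendsto_eq_intros)
      then show "((\<lambda>\<gamma>. (2 * \<kappa> \<gamma>) powr p) \<longlongrightarrow> (2 * \<kappa> (1 / p)) powr p) (at_left (1/p))"
        using \<kappa>pos by (intro tendsto_intros) auto
      show "\<forall>\<^sub>F \<gamma> in at_left (1/p). (2 * \<kappa> \<gamma>) powr p \<le> a + b * (2 * pi * (1 - \<gamma> * p))"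
        unfolding eventually_at_left_field using step p
        by (intro exI[of _ 0]) (auto simp: field_simps)
    qed simp
    then show ?thesis using p by (simp add: a_def)
  qed
  have "(2 * \<kappa> (1/p)) powr p \<le> ((1 - 0) powr (1 - p))\<^sup>2 * C' powr p * 2 powr (p / 2)"
  proof (rule tendsto_lowerbound)
    show "((\<lambda>t. ((1 - t) powr (1 - p))\<^sup>2 * C' powr p * 2 powr (p / 2)) \<longlongrightarrow> ((1 - 0) powr (1 - p))\<^sup>2 * C' powr p * 2 powr (p / 2)) (at_right (0::real))"
      by (intro tendsto_intros) auto
    show "\<forall>\<^sub>F t in at_right 0. (2 * \<kappa> (1/p)) powr p \<le> ((1 - t) powr (1 - p))\<^sup>2 * C' powr p * 2 powr (p / 2)"
      unfolding eventually_at_right_field using ineq by (intro exI[of _ 1]) auto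
  qed simp
  also have "\<dots> = (C' * sqrt 2) powr p"
  proof -
    have "2 powr (p / 2) = sqrt 2 powr p" using square_powr_half[of "sqrt 2" p] by simp
    then show ?thesis using C' by (simp add: powr_mult)
  qed
  finally have le: "(2 * \<kappa> (1/p)) powr p \<le> (C' * sqrt 2) powr p" .
  have "C' * sqrt 2 < 2 * \<kappa> (1/p)"
  proof -
    have "C' < sqrt 2 * \<kappa> (1/p)" using C \<kappa>pos by (simp add: C'_def \<kappa>p)
    then have "C' * sqrt 2 < sqrt 2 * \<kappa> (1/p) * sqrt 2" by (rule mult_strict_right_mono) simp
    also have "\<dots> = (sqrt 2 * sqrt 2) * \<kappa> (1/p)" by (simp only: mult_ac)
    finally show ?thesis by simp
  qed
  then have "(C' * sqrt 2) powr p < (2 * \<kappa> (1/p)) powr p" using C' p by (intro powr_less_mono2) auto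
  then show False using le by simp
qed

theorem theorem2p3:
  fixes p :: real
  assumes "1 < p"
  shows "(\<forall>f g h. admissible p f g h \<longrightarrow>
            hp_norm p f \<le> sqrt 2 * max (sin (pi / (2 * p))) (cos (pi / (2 * p))) * pair_norm p g h) \<and>
         (\<forall>C < sqrt 2 * max (sin (pi / (2 * p))) (cos (pi / (2 * p))).
            \<exists>f g h. admissible p f g h \<and> \<not> hp_norm p f \<le> C * pair_norm p g h)"
  using hp_norm_le_pair_norm[OF assms] constant_sharp[OF assms] by blast

end
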